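(* Consider the decoupled discrete gradient flow algorithm (defined in the context). The following statements hold. (i) For all $i\in\mathbb{N}_0$, the variational problem (D) admits a unique solution $(v_{1,h}^i,v_{2,h}^i)\in\mathcal{K}_h[m_{1,h}^i]\times\mathcal{K}_h[m_{2,h}^i]$. (ii) Suppose that $\tau$ satisfies $c_{\mathcal{H}}(c_{\mathcal{H}}/2+c_{\mathcal{T}})|a_0|\tau<1$, where $c_{\mathcal{T}}>0$ is a constant which depends only on the shape-regularity of the family of meshes. Then the algorithm terminates within a finite number of iterations. In particular, the approximate stationary point $(m_{1,h},m_{2,h})$ is well defined. (iii) For all $i\in\mathbb{N}_0$ the iterates of the algorithm satisfy $$\mathcal{E}[m_{1,h}^{i+1},m_{2,h}^{i+1}] - \mathcal{E}[m_{1,h}^i,m_{2,h}^i] = -\tau\sum_{\ell=1}^2\|v_{\ell,h}^i\|_{\mathcal{H}}^2 - \frac{\tau^2}{2}\sum_{\ell=1}^2 a_{\ell\ell}\|\nabla v_{\ell,h}^i\|^2 + a_{12}\tau^2\langle\nabla v_{1,h}^i,\nabla v_{2,h}^i\rangle - a_0\tau^2\langle v_{1,h}^i,v_{2,h}^i\rangle.$$ Moreover, if $\tau$ satisfies $c_{\mathcal{H}}^2|a_0|\tau\le2$, then the sequence of energies generated by the algorithm is monotonically decreasing, i.e., $\mathcal{E}[m_{1,h}^{i+1},m_{2,h}^{i+1}]\le\mathcal{E}[m_{1,h}^i,m_{2,h}^i]$. (iv) Under the assumptions of part (ii), there exists $C>0$ such that the approximate stationary point $(m_{1,h},m_{2,h})$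 satisfies $$\|\mathcal{I}_h[|m_{\ell,h}|^2]-1\|_{L^1(\Omega)} \le C\tau\Big(1+\sum_{k=1}^2\|m_{k,h}^0\|_{H^1(\Omega)}^2\Big)\quad\text{for all } \ell=1,2.$$ The constant $C>0$ depends only on $a_{11},a_{12},a_{22},a_0,c_{\mathcal{H}}$ and the shape-regularity of the family of meshes.
   Context: $\Omega\subset\mathbb{R}^3$ is a bounded Lipschitz polyhedral domain; $\langle\cdot,\cdot\rangle$, $\|\cdot\|$ are the $L^2(\Omega)$ inner product and norm (also for vector- and matrix-valued functions). $a_{11},a_{22},a_{12},a_0\in\mathbb{R}$ satisfy $a_{11}+a_{22}>0$, $a_{11}a_{22}>a_{12}^2$, and $$\mathcal{E}[m_1,m_2] = \frac12\sum_{\ell=1}^2 a_{\ell\ell}\|\nabla m_\ell\|^2 + a_{12}\langle\nabla m_1,\nabla m_2\rangle - a_0\langle m_1,m_2\rangle.$$ $\mathcal{X}=\{(m_1,m_2)\in H^1(\Omega;\mathbb{R}^3)^2: |m_1|=|m_2|=1\text{ a.e.}\}$. $\mathcal{H}$ is a Hilbert space with inner product $\langle\cdot,\cdot\rangle_{\mathcal{H}}$ and norm $\|\cdot\|_{\mathcal{H}}$ such that $\mathcal{X}$ is continuously embedded in $\mathcal{H}\times\mathcal{H}$, and $c_{\mathcal{H}}\ge1$ is a constant with $c_{\mathcal{H}}^{-1}\|\phi\|\le\|\phi\|_{\mathcal{H}}\le c_{\mathcal{H}}\|\phi\|_{H^1(\Omega)}$ for all $\phi\in H^1(\Omega;\mathbb{R}^3)$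 (so $H^1(\Omega;\mathbb{R}^3)\subset\mathcal{H}$). $\{\mathcal{T}_h\}_{h>0}$ is a shape-regular family of tetrahedral meshes of $\Omega$ with mesh size $h$ (maximal element diameter) and vertex set $\mathcal{N}_h$; $\mathcal{S}^1(\mathcal{T}_h)$ is the space of continuous piecewise affine functions, $\mathcal{I}_h$ the nodal interpolant onto it. For $m_h\in\mathcal{S}^1(\mathcal{T}_h)^3$ nonvanishing at all vertices, $\mathcal{K}_h[m_h]=\{\phi_h\in\mathcal{S}^1(\mathcal{T}_h)^3: m_h(z)\cdot\phi_h(z)=0\ \forall z\in\mathcal{N}_h\}$. Decoupled discrete gradient flow algorithm. Parameters: $h>0$, time-step size $\tau>0$, tolerance $\varepsilon>0$. Input: $(m_{1,h}^0,m_{2,h}^0)\in\mathcal{S}^1(\mathcal{T}_h)^3\times\mathcal{S}^1(\mathcal{T}_h)^3$ with $|m_{\ell,h}^0(z)|=1$ for all $z\in\mathcal{N}_h$, $\ell=1,2$. For $i=0,1,2,\dots$: find $(v_{1,h}^i,v_{2,h}^i)\in\mathcal{K}_h[m_{1,h}^i]\times\mathcal{K}_h[m_{2,h}^i]$ such that for all $(\phi_{1,h},\phi_{2,h})\in\mathcal{K}_h[m_{1,h}^i]\times\mathcal{K}_h[m_{2,h}^i]$ and $\ell=1,2$, $$\text{(D)}\quad \langle v_{\ell,h}^i,\phi_{\ell,h}\rangle_{\mathcal{H}} + a_{\ell\ell}\tau\langle\nabla v_{\ell,h}^i,\nabla\phi_{\ell,h}\rangle = -a_{\ell\ell}\langle\nabla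 m_{\ell,h}^i,\nabla\phi_{\ell,h}\rangle - a_{12}\langle\nabla m_{3-\ell,h}^i,\nabla\phi_{\ell,h}\rangle + a_0\langle m_{3-\ell,h}^i,\phi_{\ell,h}\rangle;$$ then set $m_{\ell,h}^{i+1}:=m_{\ell,h}^i+\tau v_{\ell,h}^i$, $\ell=1,2$. The algorithm terminates at the smallest integer $i^*\in\mathbb{N}_0$ (if any) such that $\max_{\ell=1,2}(\|v_{\ell,h}^{i^*}\|_{\mathcal{H}}^2+\tau\|\nabla v_{\ell,h}^{i^*}\|^2)\le\varepsilon^2|\Omega|$, and the output (approximate stationary point) is $(m_{1,h},m_{2,h}):=(m_{1,h}^{i^*},m_{2,h}^{i^*})$. In statements "for all $i$" the iteration is considered without stopping.
   Formalization: The constant c_T may depend on c_H as well as on shape-regularity, with c_T ≤ k·c_H and k depending only on shape-regularity, since (ii) fails for c_T independent of c_H; the carrier type of the Hilbert space H is fixed before the constants (ℓ² serves all H). *)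

theory Defs
  imports "HOL-Analysis.Analysis"
begin

section \<open>Domains\<close>

text \<open>Lipschitz boundary: near each boundary point the domain is the strict subgraph, in some
  direction \<open>n\<close>, of a Lipschitz function on the plane orthogonal to \<open>n\<close>.\<close>

definition lipschitz_boundary :: "(real^3) set \<Rightarrow> bool" where
  "lipschitz_boundary \<Omega> \<longleftrightarrow>
     (\<forall>p\<in>frontier \<Omega>. \<exists>n r L \<gamma>. norm n = 1 \<and> r > 0 \<and> L-lipschitz_on {y. y \<bullet> n = 0} \<gamma> \<and>
        \<Omega> \<inter> ball p r = {x \<in> ball p r. x \<bullet> n < \<gamma> (x - (x \<bullet> n) *\<^sub>R n)})"

definition lipschitz_polyhedral_domain :: "(real^3) set \<Rightarrow> bool" where
  "lipschitz_polyhedral_domain \<Omega> \<longleftrightarrow>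
     \<Omega> \<noteq> {} \<and> open \<Omega> \<and> connected \<Omega> \<and> bounded \<Omega> \<and> lipschitz_boundary \<Omega> \<and>
     (\<exists>\<P>. finite \<P> \<and> (\<forall>P\<in>\<P>. polytope P) \<and> closure \<Omega> = \<Union>\<P>)"

section \<open>Lebesgue and Sobolev spaces\<close>

text \<open>Elements of \<open>L\<^sup>2\<close> and \<open>H\<^sup>1\<close> are represented by functions; functions that agree almost
  everywhere in \<open>\<Omega>\<close> are not identified. For matrix-valued functions the library inner product on
  \<^typ>\<open>real^3^3\<close> is the Frobenius product.\<close>

definition L2 :: "(real^3) set \<Rightarrow> (real^3 \<Rightarrow> 'b::euclidean_space) set" where
  "L2 \<Omega> = {u \<in> borel_measurable (lebesgue_on \<Omega>). integrable (lebesgue_on \<Omega>) (\<lambda>x. (norm (u x))\<^sup>2)}"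

definition L2_inner :: "(real^3) set \<Rightarrow> (real^3 \<Rightarrow> 'b::euclidean_space) \<Rightarrow> (real^3 \<Rightarrow> 'b) \<Rightarrow> real" where
  "L2_inner \<Omega> u v = (LINT x|lebesgue_on \<Omega>. u x \<bullet> v x)"

definition L2_norm :: "(real^3) set \<Rightarrow> (real^3 \<Rightarrow> 'b::euclidean_space) \<Rightarrow> real" where
  "L2_norm \<Omega> u = sqrt (L2_inner \<Omega> u u)"

definition L1_norm :: "(real^3) set \<Rightarrow> (real^3 \<Rightarrow> real) \<Rightarrow> real" where
  "L1_norm \<Omega> f = (LINT x|lebesgue_on \<Omega>. \<bar>f x\<bar>)"

text \<open>\<open>D js\<close> is the iterated partial derivative of \<open>\<phi>\<close> in the directions listed in \<open>js\<close>; each of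
  them being differentiable everywhere amounts to \<open>\<phi>\<close> being infinitely often continuously
  differentiable.\<close>

definition smooth :: "(real^3 \<Rightarrow> real) \<Rightarrow> bool" where
  "smooth \<phi> \<longleftrightarrow> (\<exists>D :: 3 list \<Rightarrow> real^3 \<Rightarrow> real. D [] = \<phi> \<and>
     (\<forall>js x. (D js has_derivative (\<lambda>w. \<Sum>j\<in>UNIV. w $ j * D (j # js) x)) (at x)))"

definition test_functions :: "(real^3) set \<Rightarrow> (real^3 \<Rightarrow> real) set" where
  "test_functions \<Omega> = {\<phi>. smooth \<phi> \<and> compact (closure {x. \<phi> x \<noteq> 0}) \<and> closure {x. \<phi> x \<noteq> 0} \<subseteq> \<Omega>}"

definition has_weak_gradient ::
  "(real^3) set \<Rightarrow> (real^3 \<Rightarrow> real^3) \<Rightarrow> (real^3 \<Rightarrow> real^3^3) \<Rightarrow> bool" where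
  "has_weak_gradient \<Omega> u G \<longleftrightarrow>
     (\<forall>\<phi>\<in>test_functions \<Omega>. \<forall>i j.
        (LINT x|lebesgue_on \<Omega>. u x $ i * frechet_derivative \<phi> (at x) (axis j 1)) =
        - (LINT x|lebesgue_on \<Omega>. G x $ i $ j * \<phi> x))"

definition H1 :: "(real^3) set \<Rightarrow> (real^3 \<Rightarrow> real^3) set" where
  "H1 \<Omega> = {u \<in> L2 \<Omega>. \<exists>G\<in>L2 \<Omega>. has_weak_gradient \<Omega> u G}"

text \<open>The weak gradient is unique only up to null sets, hence the choice of a representative.\<close>

definition grad :: "(real^3) set \<Rightarrow> (real^3 \<Rightarrow> real^3) \<Rightarrow> real^3 \<Rightarrow> real^3^3" where
  "grad \<Omega> u = (SOME G. G \<in> L2 \<Omega> \<and> has_weak_gradient \<Omega> u G)"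

definition H1_norm :: "(real^3) set \<Rightarrow> (real^3 \<Rightarrow> real^3) \<Rightarrow> real" where
  "H1_norm \<Omega> u = sqrt ((L2_norm \<Omega> u)\<^sup>2 + (L2_norm \<Omega> (grad \<Omega> u))\<^sup>2)"

text \<open>The Hilbert space is a complete inner product type \<open>'h\<close> and the inclusion of
  \<open>H\<^sup>1(\<Omega>;\<real>\<^sup>3)\<close> into it is a linear map \<open>\<iota>\<close>, so that \<open>\<langle>u,v\<rangle>\<close> in the Hilbert space reads
  \<open>\<iota> u \<bullet> \<iota> v\<close>. The upper bound is the continuity of the inclusion (in particular on pairs of unit
  length fields), the lower bound makes it injective up to null sets.\<close>

definition hilbert_embedding ::
  "(real^3) set \<Rightarrow> real \<Rightarrow> ((real^3 \<Rightarrow> real^3) \<Rightarrow> 'h::{real_inner,complete_space}) \<Rightarrow> bool" where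
  "hilbert_embedding \<Omega> cH \<iota> \<longleftrightarrow>
     (\<forall>u\<in>H1 \<Omega>. \<forall>v\<in>H1 \<Omega>. \<iota> (\<lambda>x. u x + v x) = \<iota> u + \<iota> v) \<and>
     (\<forall>u\<in>H1 \<Omega>. \<forall>c. \<iota> (\<lambda>x. c *\<^sub>R u x) = c *\<^sub>R \<iota> u) \<and>
     (\<forall>u\<in>H1 \<Omega>. inverse cH * L2_norm \<Omega> u \<le> norm (\<iota> u) \<and> norm (\<iota> u) \<le> cH * H1_norm \<Omega> u)"

definition energy ::
  "(real^3) set \<Rightarrow> real \<Rightarrow> real \<Rightarrow> real \<Rightarrow> real \<Rightarrow> (real^3 \<Rightarrow> real^3) \<times> (real^3 \<Rightarrow> real^3) \<Rightarrow> real" where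
  "energy \<Omega> a11 a22 a12 a0 = (\<lambda>(m1, m2).
     1/2 * (a11 * (L2_norm \<Omega> (grad \<Omega> m1))\<^sup>2 + a22 * (L2_norm \<Omega> (grad \<Omega> m2))\<^sup>2)
     + a12 * L2_inner \<Omega> (grad \<Omega> m1) (grad \<Omega> m2) - a0 * L2_inner \<Omega> m1 m2)"

section \<open>Meshes and finite element spaces\<close>

definition tetrahedral_mesh :: "(real^3) set \<Rightarrow> (real^3) set set \<Rightarrow> bool" where
  "tetrahedral_mesh \<Omega> T \<longleftrightarrow> triangulation T \<and> (\<forall>K\<in>T. 3 simplex K) \<and> \<Union>T = closure \<Omega>"

definition mesh_size :: "(real^3) set set \<Rightarrow> real" where
  "mesh_size T = Max (diameter ` T)"

definition inball_diameter :: "(real^3) set \<Rightarrow> real" where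
  "inball_diameter K = (SUP r\<in>{r. \<exists>z. cball z r \<subseteq> K}. 2 * r)"

definition shape_regular :: "real \<Rightarrow> (real^3) set set \<Rightarrow> bool" where
  "shape_regular \<kappa> T \<longleftrightarrow> (\<forall>K\<in>T. diameter K \<le> \<kappa> * inball_diameter K)"

text \<open>The set \<open>I\<close> collects the mesh sizes that occur in the family. It cannot be all of
  \<open>{0<..}\<close>, as the diameter of \<open>\<Omega>\<close> bounds the mesh size.\<close>

definition shape_regular_family ::
  "real \<Rightarrow> (real^3) set \<Rightarrow> real set \<Rightarrow> (real \<Rightarrow> (real^3) set set) \<Rightarrow> bool" where
  "shape_regular_family \<kappa> \<Omega> I Th \<longleftrightarrow>
     I \<subseteq> {0<..} \<and>
     (\<forall>h\<in>I. tetrahedral_mesh \<Omega> (Th h) \<and> mesh_size (Th h) = h \<and> shape_regular \<kappa> (Th h))"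

definition nodes :: "(real^3) set set \<Rightarrow> (real^3) set" where
  "nodes T = {z. \<exists>K\<in>T. z extreme_point_of K}"

text \<open>Finite element functions live on \<open>\<Union>T\<close>, the closure of the domain. They are set to zero
  outside, so that equality of functions is equality of finite element functions.\<close>

definition S1 :: "(real^3) set set \<Rightarrow> (real^3 \<Rightarrow> real) set" where
  "S1 T = {u. continuous_on (\<Union>T) u \<and> (\<forall>K\<in>T. \<exists>a b. \<forall>x\<in>K. u x = a \<bullet> x + b) \<and>
              (\<forall>x. x \<notin> \<Union>T \<longrightarrow> u x = 0)}"

definition S1_vec :: "(real^3) set set \<Rightarrow> (real^3 \<Rightarrow> real^3) set" where
  "S1_vec T = {u. \<forall>i. (\<lambda>x. u x $ i) \<in> S1 T}"

definition nodal_interpolant :: "(real^3) set set \<Rightarrow> (real^3 \<Rightarrow> real) \<Rightarrow> real^3 \<Rightarrow> real" where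
  "nodal_interpolant T f = (THE u. u \<in> S1 T \<and> (\<forall>z\<in>nodes T. u z = f z))"

definition tangent_space ::
  "(real^3) set set \<Rightarrow> (real^3 \<Rightarrow> real^3) \<Rightarrow> (real^3 \<Rightarrow> real^3) set" where
  "tangent_space T m = {\<phi> \<in> S1_vec T. \<forall>z\<in>nodes T. m z \<bullet> \<phi> z = 0}"

section \<open>The decoupled discrete gradient flow\<close>

text \<open>In the equation for one component, \<open>m\<close> is the current value of this component, \<open>m'\<close> that of
  the other one, and \<open>a\<close> is the diagonal coefficient belonging to \<open>m\<close>.\<close>

definition component_equation ::
  "(real^3) set \<Rightarrow> ((real^3 \<Rightarrow> real^3) \<Rightarrow> 'h::{real_inner,complete_space}) \<Rightarrow>
   real \<Rightarrow> real \<Rightarrow> real \<Rightarrow> real \<Rightarrow>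
   (real^3 \<Rightarrow> real^3) \<Rightarrow> (real^3 \<Rightarrow> real^3) \<Rightarrow> (real^3 \<Rightarrow> real^3) \<Rightarrow> (real^3 \<Rightarrow> real^3) \<Rightarrow> bool" where
  "component_equation \<Omega> \<iota> a a12 a0 \<tau> m m' v \<phi> \<longleftrightarrow>
     \<iota> v \<bullet> \<iota> \<phi> + a * \<tau> * L2_inner \<Omega> (grad \<Omega> v) (grad \<Omega> \<phi>) =
     - a * L2_inner \<Omega> (grad \<Omega> m) (grad \<Omega> \<phi>)
     - a12 * L2_inner \<Omega> (grad \<Omega> m') (grad \<Omega> \<phi>)
     + a0 * L2_inner \<Omega> m' \<phi>"

definition dgf_solution ::
  "(real^3) set \<Rightarrow> (real^3) set set \<Rightarrow> ((real^3 \<Rightarrow> real^3) \<Rightarrow> 'h::{real_inner,complete_space}) \<Rightarrow>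
   real \<Rightarrow> real \<Rightarrow> real \<Rightarrow> real \<Rightarrow> real \<Rightarrow>
   (real^3 \<Rightarrow> real^3) \<times> (real^3 \<Rightarrow> real^3) \<Rightarrow> (real^3 \<Rightarrow> real^3) \<times> (real^3 \<Rightarrow> real^3) \<Rightarrow> bool" where
  "dgf_solution \<Omega> T \<iota> a11 a22 a12 a0 \<tau> = (\<lambda>(m1, m2) (v1, v2).
     v1 \<in> tangent_space T m1 \<and> v2 \<in> tangent_space T m2 \<and>
     (\<forall>\<phi>1\<in>tangent_space T m1. \<forall>\<phi>2\<in>tangent_space T m2.
        component_equation \<Omega> \<iota> a11 a12 a0 \<tau> m1 m2 v1 \<phi>1 \<and>
        component_equation \<Omega> \<iota> a22 a12 a0 \<tau> m2 m1 v2 \<phi>2))"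

definition dgf_update ::
  "(real^3) set \<Rightarrow> (real^3) set set \<Rightarrow> ((real^3 \<Rightarrow> real^3) \<Rightarrow> 'h::{real_inner,complete_space}) \<Rightarrow>
   real \<Rightarrow> real \<Rightarrow> real \<Rightarrow> real \<Rightarrow> real \<Rightarrow>
   (real^3 \<Rightarrow> real^3) \<times> (real^3 \<Rightarrow> real^3) \<Rightarrow> (real^3 \<Rightarrow> real^3) \<times> (real^3 \<Rightarrow> real^3)" where
  "dgf_update \<Omega> T \<iota> a11 a22 a12 a0 \<tau> m = (THE v. dgf_solution \<Omega> T \<iota> a11 a22 a12 a0 \<tau> m v)"

primrec dgf_iterate ::
  "(real^3) set \<Rightarrow> (real^3) set set \<Rightarrow> ((real^3 \<Rightarrow> real^3) \<Rightarrow> 'h::{real_inner,complete_space}) \<Rightarrow>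
   real \<Rightarrow> real \<Rightarrow> real \<Rightarrow> real \<Rightarrow> real \<Rightarrow>
   (real^3 \<Rightarrow> real^3) \<times> (real^3 \<Rightarrow> real^3) \<Rightarrow> nat \<Rightarrow> (real^3 \<Rightarrow> real^3) \<times> (real^3 \<Rightarrow> real^3)" where
  "dgf_iterate \<Omega> T \<iota> a11 a22 a12 a0 \<tau> m0 0 = m0"
| "dgf_iterate \<Omega> T \<iota> a11 a22 a12 a0 \<tau> m0 (Suc i) =
     (let m = dgf_iterate \<Omega> T \<iota> a11 a22 a12 a0 \<tau> m0 i;
          v = dgf_update \<Omega> T \<iota> a11 a22 a12 a0 \<tau> m
      in (\<lambda>x. fst m x + \<tau> *\<^sub>R fst v x, \<lambda>x. snd m x + \<tau> *\<^sub>R snd v x))"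

definition stopping_criterion ::
  "(real^3) set \<Rightarrow> ((real^3 \<Rightarrow> real^3) \<Rightarrow> 'h::{real_inner,complete_space}) \<Rightarrow> real \<Rightarrow> real \<Rightarrow>
   (real^3 \<Rightarrow> real^3) \<times> (real^3 \<Rightarrow> real^3) \<Rightarrow> bool" where
  "stopping_criterion \<Omega> \<iota> \<tau> \<epsilon> = (\<lambda>(v1, v2).
     max ((norm (\<iota> v1))\<^sup>2 + \<tau> * (L2_norm \<Omega> (grad \<Omega> v1))\<^sup>2)
         ((norm (\<iota> v2))\<^sup>2 + \<tau> * (L2_norm \<Omega> (grad \<Omega> v2))\<^sup>2)
     \<le> \<epsilon>\<^sup>2 * measure lebesgue \<Omega>)"

definition terminates_at ::
  "(real^3) set \<Rightarrow> (real^3) set set \<Rightarrow> ((real^3 \<Rightarrow> real^3) \<Rightarrow> 'h::{real_inner,complete_space}) \<Rightarrow>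
   real \<Rightarrow> real \<Rightarrow> real \<Rightarrow> real \<Rightarrow> real \<Rightarrow> real \<Rightarrow>
   (real^3 \<Rightarrow> real^3) \<times> (real^3 \<Rightarrow> real^3) \<Rightarrow> nat \<Rightarrow> bool" where
  "terminates_at \<Omega> T \<iota> a11 a22 a12 a0 \<tau> \<epsilon> m0 i \<longleftrightarrow>
     (let stop = (\<lambda>j. stopping_criterion \<Omega> \<iota> \<tau> \<epsilon>
                   (dgf_update \<Omega> T \<iota> a11 a22 a12 a0 \<tau> (dgf_iterate \<Omega> T \<iota> a11 a22 a12 a0 \<tau> m0 j)))
      in stop i \<and> (\<forall>j<i. \<not> stop j))"

definition approx_stationary_point ::
  "(real^3) set \<Rightarrow> (real^3) set set \<Rightarrow> ((real^3 \<Rightarrow> real^3) \<Rightarrow> 'h::{real_inner,complete_space}) \<Rightarrow>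
   real \<Rightarrow> real \<Rightarrow> real \<Rightarrow> real \<Rightarrow> real \<Rightarrow> real \<Rightarrow>
   (real^3 \<Rightarrow> real^3) \<times> (real^3 \<Rightarrow> real^3) \<Rightarrow> (real^3 \<Rightarrow> real^3) \<times> (real^3 \<Rightarrow> real^3) \<Rightarrow> bool" where
  "approx_stationary_point \<Omega> T \<iota> a11 a22 a12 a0 \<tau> \<epsilon> m0 m \<longleftrightarrow>
     (\<exists>i. terminates_at \<Omega> T \<iota> a11 a22 a12 a0 \<tau> \<epsilon> m0 i \<and> m = dgf_iterate \<Omega> T \<iota> a11 a22 a12 a0 \<tau> m0 i)"

text \<open>Dependence of constants. Let \<open>\<kappa>\<close> bound the shape regularity and let \<open>cH\<close> be the constant
  of the norm comparison. A constant \<open>cT\<close> in the step size restriction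
  \<open>cH * (cH / 2 + cT) * \<bar>a0\<bar> * \<tau> < 1\<close> that guarantees termination cannot be chosen independently of
  \<open>cH\<close>. For \<open>0 < \<delta> \<le> 1\<close> take the \<open>L\<^sup>2\<close> inner product scaled by \<open>\<delta>\<^sup>2\<close>, so that \<open>cH = 1 / \<delta>\<close>
  is admissible, \<open>a0 > 0\<close>, and spatially constant unit initial fields at angle \<open>\<theta>\<close> with
  \<open>cos \<theta> = 1 / s\<close>, \<open>s = \<tau> * a0 / \<delta>\<^sup>2 > 1\<close>. In each step both fields turn by \<open>\<theta>\<close> towards each
  other, thus exchange their directions, and their lengths are multiplied by \<open>s\<close>. The updates grow
  geometrically and the iteration never stops if \<open>\<epsilon>\<close> is small. The restriction reads
  \<open>s * (1 / 2 + cT / cH) < 1\<close> here, so it excludes this behaviour for all \<open>s > 1\<close> and all \<open>cH\<close>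
  only if \<open>cT\<close> grows at least like \<open>cH / 2\<close>. A growth \<open>cT \<le> k * cH\<close> with \<open>k\<close> depending only on
  \<open>\<kappa>\<close> is the dependence that is used.\<close>

end

theory Submission
  imports Defs
begin

text \<open>Since the updates are tangential at the nodes, the squared nodal lengths grow by
  \<open>\<tau>\<^sup>2 * \<bar>v\<bar>\<^sup>2\<close> in each step. Hence the lumped norm \<open>\<integral> I\<^sub>h[\<bar>m\<bar>\<^sup>2]\<close>, which dominates the \<open>L\<^sup>2\<close> norm
  and is dominated by 66 times its square, grows at most by \<open>66 * \<tau>\<^sup>2 * cH\<^sup>2\<close> times the accumulated
  squared updates. The energy is bounded below in terms of the \<open>L\<^sup>2\<close> norms, while each step dissipates
  \<open>\<tau>\<close> times the squared update up to terms of order \<open>\<bar>a0\<bar> * \<tau>\<^sup>2 * cH\<^sup>2\<close>. With \<open>cT = 67 * cH\<close> at most half of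
  the dissipation is lost, so the squared updates are summable with a sum of order \<open>1 / \<tau>\<close>. This forces
  termination, and inserting the sum into the growth of the lumped norm gives the length error of
  order \<open>\<tau>\<close>.\<close>

section \<open>Square integrable fields\<close>

text \<open>The number 66 is \<open>8 * 8 + 2\<close>, obtained from one homothety of a single
  element and therefore the same for every tetrahedron. With
  \<open>q = cH\<^sup>2 * \<bar>a0\<bar> * \<tau>\<close>, the mixed product of the updates costs
  the fraction \<open>q / 2\<close> of the dissipation and the growth of the lengths costs
  \<open>66 / 2 * q\<close>. Together this is at most one half when \<open>67 * q \<le> 1\<close>.
  One of the two factors \<open>cH\<close> in \<open>q\<close> stands in front of the step size
  restriction, the other one has to sit in \<open>cT\<close>. The obstacle is analytic. The energy
  uses an arbitrarily chosen weak gradient, so already its expansion along a step requires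
  uniqueness of weak gradients, hence the fundamental lemma of the calculus of variations with
  explicit smooth test functions. It also requires that continuous piecewise affine functions are
  weakly differentiable. Finally, the mesh covers the closure of the domain. The Lipschitz boundary
  ensures that interiors of elements stay inside the domain, so that integrals over the domain and
  over the elements agree.\<close>

lemma L2_inner_commute: "L2_inner \<Omega> u v = L2_inner \<Omega> v u"
  by (simp add: L2_inner_def inner_commute)

lemma L2_measurable: "u \<in> L2 \<Omega> \<Longrightarrow> u \<in> borel_measurable (lebesgue_on \<Omega>)"
  by (simp add: L2_def)

lemma L2_integrable_inner:
  assumes "u \<in> L2 \<Omega>" "v \<in> L2 \<Omega>"
  shows "integrable (lebesgue_on \<Omega>) (\<lambda>x. u x \<bullet> v x)"
proof (rule Bochner_Integration.integrable_bound)
  show "integrable (lebesgue_on \<Omega>) (\<lambda>x. (norm (u x))\<^sup>2 + (norm (v x))\<^sup>2)"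
    using assms by (auto simp: L2_def)
  show "(\<lambda>x. u x \<bullet> v x) \<in> borel_measurable (lebesgue_on \<Omega>)"
    using assms by (auto simp: L2_def)
  have "\<bar>a \<bullet> b\<bar> \<le> (norm a)\<^sup>2 + (norm b)\<^sup>2" for a b :: 'a
    using Cauchy_Schwarz_ineq2[of a b] sum_squares_bound[of "norm a" "norm b"]
      mult_nonneg_nonneg[of "norm a" "norm b", OF norm_ge_zero norm_ge_zero] by linarith
  then show "AE x in lebesgue_on \<Omega>. norm (u x \<bullet> v x) \<le> norm ((norm (u x))\<^sup>2 + (norm (v x))\<^sup>2)"
    by (intro AE_I2) (smt (verit) real_norm_def zero_le_power2)
qed

lemma L2_add:
  assumes "u \<in> L2 \<Omega>" "v \<in> L2 \<Omega>"
  shows "(\<lambda>x. u x + v x) \<in> L2 \<Omega>"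
proof -
  have "integrable (lebesgue_on \<Omega>) (\<lambda>x. (norm (u x))\<^sup>2 + 2 * (u x \<bullet> v x) + (norm (v x))\<^sup>2)"
    using assms L2_integrable_inner[OF assms] by (auto simp: L2_def)
  also have "(\<lambda>x. (norm (u x))\<^sup>2 + 2 * (u x \<bullet> v x) + (norm (v x))\<^sup>2) = (\<lambda>x. (norm (u x + v x))\<^sup>2)"
    by (simp add: power2_norm_eq_inner inner_add inner_commute algebra_simps)
  finally show ?thesis using assms by (auto simp: L2_def)
qed

lemma L2_scale: "u \<in> L2 \<Omega> \<Longrightarrow> (\<lambda>x. c *\<^sub>R u x) \<in> L2 \<Omega>"
  by (auto simp: L2_def power_mult_distrib)

lemma L2_inner_add_left:
  assumes "u \<in> L2 \<Omega>" "v \<in> L2 \<Omega>" "w \<in> L2 \<Omega>"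
  shows "L2_inner \<Omega> (\<lambda>x. u x + v x) w = L2_inner \<Omega> u w + L2_inner \<Omega> v w"
  using assms by (simp add: L2_inner_def inner_add_left L2_integrable_inner)

lemma L2_inner_scale_left: "L2_inner \<Omega> (\<lambda>x. c *\<^sub>R u x) w = c * L2_inner \<Omega> u w"
  by (simp add: L2_inner_def)

lemma L2_inner_add_right:
  assumes "u \<in> L2 \<Omega>" "v \<in> L2 \<Omega>" "w \<in> L2 \<Omega>"
  shows "L2_inner \<Omega> w (\<lambda>x. u x + v x) = L2_inner \<Omega> w u + L2_inner \<Omega> w v"
  using L2_inner_add_left[OF assms] by (simp add: L2_inner_commute)

lemma L2_inner_scale_right: "L2_inner \<Omega> w (\<lambda>x. c *\<^sub>R u x) = c * L2_inner \<Omega> w u"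
  using L2_inner_scale_left by (simp add: L2_inner_commute)

lemma L2_inner_self_nonneg [simp]: "0 \<le> L2_inner \<Omega> u u"
  by (simp add: L2_inner_def)

lemma L2_norm_nonneg [simp]: "0 \<le> L2_norm \<Omega> u"
  by (simp add: L2_norm_def)

lemma L2_norm_power2: "(L2_norm \<Omega> u)\<^sup>2 = L2_inner \<Omega> u u"
  by (simp add: L2_norm_def)

lemma L2_norm_lincomb:
  assumes "u \<in> L2 \<Omega>" "v \<in> L2 \<Omega>"
  shows "(L2_norm \<Omega> (\<lambda>x. a *\<^sub>R u x + b *\<^sub>R v x))\<^sup>2 =
    a\<^sup>2 * (L2_norm \<Omega> u)\<^sup>2 + 2 * a * b * L2_inner \<Omega> u v + b\<^sup>2 * (L2_norm \<Omega> v)\<^sup>2"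
  unfolding L2_norm_power2 using assms
  by (simp add: L2_inner_add_left L2_inner_add_right L2_inner_scale_left
      L2_inner_scale_right L2_add L2_scale L2_inner_commute[of \<Omega> v u] power2_eq_square algebra_simps)

text \<open>Both signs come from the nonnegative squared norms of \<open>u + v\<close> and
  \<open>u - v\<close>; the variable \<open>c\<close> in the proof is the sign.\<close>

lemma L2_young:
  assumes "u \<in> L2 \<Omega>" "v \<in> L2 \<Omega>"
  shows "\<bar>L2_inner \<Omega> u v\<bar> \<le> ((L2_norm \<Omega> u)\<^sup>2 + (L2_norm \<Omega> v)\<^sup>2) / 2"
proof -
  have "0 \<le> (L2_norm \<Omega> u)\<^sup>2 + 2 * c * L2_inner \<Omega> u v + (L2_norm \<Omega> v)\<^sup>2" if "c\<^sup>2 = 1" for c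
    using L2_norm_lincomb[OF assms, of 1 c] zero_le_power2[of "L2_norm \<Omega> (\<lambda>x. 1 *\<^sub>R u x + c *\<^sub>R v x)"]
    by (simp add: that)
  from this[of 1] this[of "-1"] show ?thesis by simp
qed

text \<open>The value of \<open>\<mu>\<close> is the determinant divided by the trace, a lower bound for the smaller
  eigenvalue.\<close>

lemma L2_form_coercive:
  assumes tr: "a11 + a22 > 0" and det: "a11 * a22 > a12\<^sup>2"
    and u: "u \<in> L2 \<Omega>" "v \<in> L2 \<Omega>"
  defines "\<mu> \<equiv> (a11 * a22 - a12\<^sup>2) / (a11 + a22)"
  shows "a11 * (L2_norm \<Omega> u)\<^sup>2 + a22 * (L2_norm \<Omega> v)\<^sup>2 + 2 * a12 * L2_inner \<Omega> u v
    \<ge> \<mu> * ((L2_norm \<Omega> u)\<^sup>2 + (L2_norm \<Omega> v)\<^sup>2)"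
proof -
  define A B P S R where "A = a11 - \<mu>" and "B = a22 - \<mu>" and "P = (L2_norm \<Omega> u)\<^sup>2"
    and "S = (L2_norm \<Omega> v)\<^sup>2" and "R = L2_inner \<Omega> u v"
  have "\<mu> * (a11 + a22) = a11 * a22 - a12\<^sup>2"
    using tr by (simp add: \<mu>_def)
  then have AB: "A * B = a12\<^sup>2 + \<mu>\<^sup>2"
    by (simp add: A_def B_def algebra_simps power2_eq_square)
  have lam: "\<mu> > 0" using assms by (simp add: \<mu>_def)
  \<comment> \<open>The right-hand side is a sum of squares, so \<open>A + B\<close> is nonnegative;
    together with the positive product this fixes the sign of \<open>A\<close>.\<close>
  have "(A + B) * (a11 + a22) = a11\<^sup>2 + a22\<^sup>2 + 2 * a12\<^sup>2"
    using \<open>\<mu> * (a11 + a22) = a11 * a22 - a12\<^sup>2\<close>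
    by (simp add: A_def B_def algebra_simps power2_eq_square)
  then have "A + B \<ge> 0"
    by (smt (verit) mult_neg_pos tr zero_le_power2)
  moreover have "A * B > 0" using AB lam by (simp add: add_nonneg_pos)
  ultimately have A: "A > 0"
    by (smt (verit) mult_nonneg_nonpos zero_less_mult_iff)
  \<comment> \<open>Completing the square: \<open>A\<close> times the shifted form equals this
    squared norm plus \<open>\<mu>\<^sup>2 * S\<close>.\<close>
  have "0 \<le> (L2_norm \<Omega> (\<lambda>x. A *\<^sub>R u x + a12 *\<^sub>R v x))\<^sup>2" by simp
  also have "\<dots> = A\<^sup>2 * P + 2 * A * a12 * R + a12\<^sup>2 * S"
    by (simp add: L2_norm_lincomb[OF u] P_def S_def R_def)
  also have "\<dots> \<le> A\<^sup>2 * P + 2 * A * a12 * R + (A * B) * S"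
    by (intro add_left_mono mult_right_mono) (auto simp: AB S_def)
  also have "\<dots> = A * (A * P + 2 * a12 * R + B * S)"
    by (simp add: algebra_simps power2_eq_square)
  finally have "0 \<le> A * P + 2 * a12 * R + B * S"
    using A by (simp add: zero_le_mult_iff)
  then show ?thesis
    by (simp add: A_def B_def P_def S_def R_def algebra_simps)
qed

lemma L2_bounded:
  fixes u :: "real^3 \<Rightarrow> 'b::euclidean_space"
  assumes \<Omega>: "\<Omega> \<in> lmeasurable" and u: "u \<in> borel_measurable (lebesgue_on \<Omega>)"
    and B: "\<And>x. x \<in> \<Omega> \<Longrightarrow> norm (u x) \<le> B"
  shows "u \<in> L2 \<Omega>"
proof -
  interpret finite_measure "lebesgue_on \<Omega>" by (rule finite_measure_lebesgue_on[OF \<Omega>])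
  have "integrable (lebesgue_on \<Omega>) (\<lambda>x. (norm (u x))\<^sup>2)"
    using u by (intro integrable_const_bound[where B="B\<^sup>2"] AE_I2)
      (auto intro!: power_mono B)
  then show ?thesis using u by (simp add: L2_def)
qed

lemma L2_integrable:
  assumes \<Omega>: "\<Omega> \<in> lmeasurable" and u: "u \<in> L2 \<Omega>"
  shows "integrable (lebesgue_on \<Omega>) u"
proof (rule Bochner_Integration.integrable_bound)
  interpret finite_measure "lebesgue_on \<Omega>" by (rule finite_measure_lebesgue_on[OF \<Omega>])
  show "integrable (lebesgue_on \<Omega>) (\<lambda>x. 1 + (norm (u x))\<^sup>2)"
    using u by (auto simp: L2_def)
  have "t \<le> 1 + t\<^sup>2" if "t \<ge> 0" for t :: real
    using sum_squares_bound[of t 1] that by simp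
  then show "AE x in lebesgue_on \<Omega>. norm (u x) \<le> norm (1 + (norm (u x))\<^sup>2)"
    by (intro AE_I2) (smt (verit) norm_ge_zero real_norm_def zero_le_power2)
  show "u \<in> borel_measurable (lebesgue_on \<Omega>)" using u by (rule L2_measurable)
qed

section \<open>Smooth bump functions\<close>

text \<open>Multiplication by \<open>X\<^sup>2\<close> reflects that the derivative of \<open>1 / t\<close> is \<open>- (1 / t)\<^sup>2\<close>.\<close>

definition exp_inv :: "real poly \<Rightarrow> real \<Rightarrow> real" where
  "exp_inv p t = (if t \<le> 0 then 0 else poly p (1 / t) * exp (- (1 / t)))"

definition exp_inv_deriv :: "real poly \<Rightarrow> real poly" where
  "exp_inv_deriv p = monom 1 2 * (p - pderiv p)"

lemma poly_times_exp_minus_tendsto_0: "((\<lambda>s::real. poly p s * exp (- s)) \<longlongrightarrow> 0) at_top"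
proof -
  have "((\<lambda>s::real. \<Sum>i\<le>degree p. coeff p i * (s ^ i / exp s)) \<longlongrightarrow> (\<Sum>i\<le>degree p. coeff p i * 0)) at_top"
    by (intro tendsto_intros tendsto_power_div_exp_0)
  then show ?thesis
    by (simp add: poly_altdef sum_distrib_right exp_minus divide_inverse mult.assoc)
qed

text \<open>Functions \<open>poly p (1 / t) * exp (- (1 / t))\<close>, continued by zero, form a
  class closed under differentiation, and \<open>exp_inv_deriv\<close> tracks the polynomial. A
  single first order statement thus yields derivatives of every order. The delicate point is
  \<open>t = 0\<close>, where the exponential beats every polynomial in
  \<open>1 / t\<close>.\<close>

lemma exp_inv_has_derivative:
  "(exp_inv p has_real_derivative exp_inv (exp_inv_deriv p) t) (at t)"
proof -
  consider "t < 0" | "t > 0" | "t = 0" by linarith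
  then show ?thesis
  proof cases
    case 1
    have "((\<lambda>_. 0) has_real_derivative 0) (at t)" by simp
    then have "(exp_inv p has_real_derivative 0) (at t)"
      by (rule has_field_derivative_transform_within_open[where S="{..<0}"])
         (use 1 in \<open>auto simp: exp_inv_def\<close>)
    then show ?thesis using 1 by (simp add: exp_inv_def)
  next
    case 2
    have "((\<lambda>t. poly p (1 / t) * exp (- (1 / t))) has_real_derivative
            exp_inv (exp_inv_deriv p) t) (at t)"
      using 2 by (auto intro!: derivative_eq_intros
        simp: exp_inv_def exp_inv_deriv_def poly_monom field_simps power2_eq_square)
    then show ?thesis
      by (rule has_field_derivative_transform_within_open[where S="{0<..}"])
         (use 2 in \<open>auto simp: exp_inv_def\<close>)
  next
    case 3
    have "((\<lambda>h. exp_inv p h / h) \<longlongrightarrow> 0) (at 0)"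
    proof (subst filterlim_at_split, intro conjI)
      show "((\<lambda>h. exp_inv p h / h) \<longlongrightarrow> 0) (at_left 0)"
        by (rule tendsto_eventually) (auto simp: exp_inv_def eventually_at_filter)
      \<comment> \<open>Dividing by \<open>h\<close> multiplies by \<open>1 / h\<close>, so the
        difference quotient at zero has the same form with the polynomial
        \<open>monom 1 1 * p\<close>. The substitution \<open>s = 1 / h\<close> moves the right-hand
        limit to infinity.\<close>
      have "((\<lambda>s. poly (monom 1 1 * p) s * exp (- s)) \<longlongrightarrow> 0) at_top"
        by (rule poly_times_exp_minus_tendsto_0)
      then have "((\<lambda>h. poly (monom 1 1 * p) (inverse h) * exp (- inverse h)) \<longlongrightarrow> 0) (at_right 0)"
        by (rule filterlim_compose[OF _ filterlim_inverse_at_top_right])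
      then show "((\<lambda>h. exp_inv p h / h) \<longlongrightarrow> 0) (at_right 0)"
        by (rule Lim_transform_eventually)
          (auto simp: eventually_at_filter exp_inv_def poly_monom field_simps)
    qed
    then show ?thesis
      using 3 by (simp add: DERIV_def exp_inv_def)
  qed
qed

text \<open>Turns infinite smoothness into a closure property: if every member of a set of functions
  has its first partial derivatives in the set, then all members are smooth. Products of atoms in
  the single coordinates give bumps supported in boxes.\<close>

inductive_set flat_algebra :: "(real^3 \<Rightarrow> real) set" where
  atom: "(\<lambda>x. exp_inv p (c * (x $ i) + d)) \<in> flat_algebra"
| const: "(\<lambda>x. c) \<in> flat_algebra"
| add: "f \<in> flat_algebra \<Longrightarrow> g \<in> flat_algebra \<Longrightarrow> (\<lambda>x. f x + g x) \<in> flat_algebra"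
| mult: "f \<in> flat_algebra \<Longrightarrow> g \<in> flat_algebra \<Longrightarrow> (\<lambda>x. f x * g x) \<in> flat_algebra"

lemma flat_algebra_partials:
  assumes "f \<in> flat_algebra"
  shows "\<exists>D. (\<forall>j::3. D j \<in> flat_algebra) \<and>
    (\<forall>x. (f has_derivative (\<lambda>w. \<Sum>j\<in>UNIV. w $ j * D j x)) (at x))"
  using assms
proof induction
  case (atom p c i d)
  define D where "D = (\<lambda>j::3. \<lambda>x::real^3. (if j = i then c else 0) * exp_inv (exp_inv_deriv p) (c * (x $ i) + d))"
  have "D j \<in> flat_algebra" for j
    unfolding D_def by (intro flat_algebra.intros)
  moreover have "((\<lambda>x. exp_inv p (c * (x $ i) + d)) has_derivative (\<lambda>w. \<Sum>j\<in>UNIV. w $ j * D j x)) (at x)" for x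
  proof -
    have "((\<lambda>x. c * (x $ i) + d) has_derivative (\<lambda>w. c * (w $ i))) (at x)"
      by (auto intro!: derivative_eq_intros bounded_linear_imp_has_derivative bounded_linear_vec_nth)
    then have "((\<lambda>x. exp_inv p (c * (x $ i) + d)) has_derivative
        (\<lambda>w. exp_inv (exp_inv_deriv p) (c * (x $ i) + d) * (c * (w $ i)))) (at x)"
      using exp_inv_has_derivative[unfolded has_field_derivative_def]
      by (rule has_derivative_compose[where g="exp_inv p"])
    moreover have "(\<lambda>w. \<Sum>j\<in>UNIV. w $ j * D j x) =
        (\<lambda>w. exp_inv (exp_inv_deriv p) (c * (x $ i) + d) * (c * (w $ i)))"
    proof
      fix w
      have "(\<Sum>j\<in>UNIV. w $ j * D j x) =
          (\<Sum>j\<in>UNIV. if j = i then w $ j * c * exp_inv (exp_inv_deriv p) (c * (x $ i) + d) else 0)"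
        by (intro sum.cong) (auto simp: D_def)
      also have "\<dots> = exp_inv (exp_inv_deriv p) (c * (x $ i) + d) * (c * (w $ i))"
        by (simp add: sum.delta')
      finally show "(\<Sum>j\<in>UNIV. w $ j * D j x) = exp_inv (exp_inv_deriv p) (c * (x $ i) + d) * (c * (w $ i))" .
    qed
    ultimately show ?thesis by simp
  qed
  ultimately show ?case by blast
next
  case (const c)
  show ?case
    by (rule exI[of _ "\<lambda>_ _. 0"]) (auto intro: flat_algebra.intros)
next
  case (add f g)
  from add.IH(1) obtain D where D: "\<And>j. D j \<in> flat_algebra"
    "\<And>x. (f has_derivative (\<lambda>w. \<Sum>j\<in>UNIV. w $ j * D j x)) (at x)" by blast
  from add.IH(2) obtain E where E: "\<And>j. E j \<in> flat_algebra"
    "\<And>x. (g has_derivative (\<lambda>w. \<Sum>j\<in>UNIV. w $ j * E j x)) (at x)" by blast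
  note * = D(1) E(1) D(2) E(2)
  show ?case
  proof (rule exI[of _ "\<lambda>j x. D j x + E j x"], intro conjI allI)
    show "(\<lambda>x. D j x + E j x) \<in> flat_algebra" for j
      using * by (intro flat_algebra.intros)
    show "((\<lambda>x. f x + g x) has_derivative (\<lambda>w. \<Sum>j\<in>UNIV. w $ j * (D j x + E j x))) (at x)" for x
      using has_derivative_add[OF *(3) *(4)] by (simp add: distrib_left sum.distrib)
  qed
next
  case (mult f g)
  from mult.IH(1) obtain D where D: "\<And>j. D j \<in> flat_algebra"
    "\<And>x. (f has_derivative (\<lambda>w. \<Sum>j\<in>UNIV. w $ j * D j x)) (at x)" by blast
  from mult.IH(2) obtain E where E: "\<And>j. E j \<in> flat_algebra"
    "\<And>x. (g has_derivative (\<lambda>w. \<Sum>j\<in>UNIV. w $ j * E j x)) (at x)" by blast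
  note * = D(1) E(1) D(2) E(2)
  show ?case
  proof (rule exI[of _ "\<lambda>j x. f x * E j x + D j x * g x"], intro conjI allI)
    show "(\<lambda>x. f x * E j x + D j x * g x) \<in> flat_algebra" for j
      using * mult by (intro flat_algebra.intros)
    show "((\<lambda>x. f x * g x) has_derivative (\<lambda>w. \<Sum>j\<in>UNIV. w $ j * (f x * E j x + D j x * g x))) (at x)" for x
      using has_derivative_mult[OF *(3) *(4)]
      by (simp add: distrib_left sum.distrib sum_distrib_left sum_distrib_right algebra_simps)
  qed
qed

lemma flat_algebra_smooth:
  assumes "f \<in> flat_algebra"
  shows "smooth f"
proof -
  \<comment> \<open>A choice of partial derivatives made uniformly on the algebra can be iterated,
    since its values stay in the algebra.\<close>
  obtain P where P: "\<And>f j. f \<in> flat_algebra \<Longrightarrow> P f j \<in> flat_algebra"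
    "\<And>f x. f \<in> flat_algebra \<Longrightarrow> (f has_derivative (\<lambda>w. \<Sum>j\<in>UNIV. w $ j * P f j x)) (at x)"
    using bchoice[OF ballI, OF flat_algebra_partials, of flat_algebra "\<lambda>f. f"] by auto
  \<comment> \<open>\<open>foldr\<close> differentiates in the direction at the head of the list
    last, which is what \<open>smooth\<close> prescribes for \<open>j # js\<close>.\<close>
  define D where "D = (\<lambda>js. foldr (\<lambda>j g. P g j) js f)"
  have D: "D js \<in> flat_algebra" for js
    by (induction js) (auto simp: D_def assms P)
  have "D (j # js) = P (D js) j" for j js
    by (simp add: D_def)
  then show ?thesis
    unfolding smooth_def using P(2)[OF D]
    by (intro exI[of _ D]) (auto simp: D_def)
qed

lemma flat_algebra_prod:
  "finite I \<Longrightarrow> (\<And>i. i \<in> I \<Longrightarrow> f i \<in> flat_algebra) \<Longrightarrow> (\<lambda>x. \<Prod>i\<in>I. f i x) \<in> flat_algebra"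
  by (induction rule: finite_induct) (auto intro: flat_algebra.intros)

text \<open>Each factor evaluates \<open>exp (- (1 / t))\<close> at a scaled distance to a face of
  the box. Growing \<open>n\<close> pushes the values inside the box to 1, while those outside
  remain 0. The arguments are spelled out in the shape of the atoms of
  \<open>flat_algebra\<close>.\<close>

definition box_bump :: "real^3 \<Rightarrow> real^3 \<Rightarrow> nat \<Rightarrow> real^3 \<Rightarrow> real" where
  "box_bump a b n x = (\<Prod>i\<in>UNIV. exp_inv 1 (real (Suc n) * (x $ i) + (- real (Suc n) * (a $ i))) *
      exp_inv 1 (- real (Suc n) * (x $ i) + real (Suc n) * (b $ i)))"

lemma smooth_box_bump: "smooth (box_bump a b n)"
proof -
  have "(\<lambda>x. box_bump a b n x) \<in> flat_algebra"
    unfolding box_bump_def by (intro flat_algebra_prod flat_algebra.intros) auto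
  then show ?thesis by (intro flat_algebra_smooth) simp
qed

lemma exp_inv_1_bounds: "0 \<le> exp_inv 1 t" "exp_inv 1 t \<le> 1"
  by (auto simp: exp_inv_def)

lemma box_bump_bounds: "0 \<le> box_bump a b n x" "box_bump a b n x \<le> 1"
  unfolding box_bump_def
  by (auto intro!: prod_nonneg prod_le_1 mult_nonneg_nonneg mult_le_one exp_inv_1_bounds)

lemma box_bump_outside: "x \<notin> box a b \<Longrightarrow> box_bump a b n x = 0"
proof -
  assume "x \<notin> box a b"
  then obtain i where "x $ i \<le> a $ i \<or> b $ i \<le> x $ i"
    by (auto simp: mem_box_cart not_less)
  then have "exp_inv 1 (real (Suc n) * (x $ i) + (- real (Suc n) * (a $ i))) = 0 \<or>
     exp_inv 1 (- real (Suc n) * (x $ i) + real (Suc n) * (b $ i)) = 0"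
    by (auto simp: exp_inv_def mult_left_mono simp del: of_nat_Suc)
  then show ?thesis unfolding box_bump_def
    by (intro prod_zero) auto
qed

lemma exp_inv_1_tendsto: 
  assumes "t > 0"
  shows "(\<lambda>n. exp_inv 1 (real (Suc n) * t)) \<longlonglongrightarrow> 1"
proof -
  have "(\<lambda>n. exp (- (1 / t * (1 / real (Suc n))))) \<longlonglongrightarrow> exp (- (1 / t * 0))"
    by (intro tendsto_intros LIMSEQ_Suc[OF lim_1_over_n])
  moreover have "exp (- (1 / t * (1 / real (Suc n)))) = exp_inv 1 (real (Suc n) * t)" for n
  proof -
    have "real (Suc n) * t > 0" using assms by simp
    then show ?thesis by (simp add: exp_inv_def mult.commute del: of_nat_Suc)
  qed
  ultimately show ?thesis by simp
qed

lemma box_bump_tendsto: "(\<lambda>n. box_bump a b n x) \<longlonglongrightarrow> indicator (box a b) x"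
proof (cases "x \<in> box a b")
  case True
  have "(\<lambda>n. \<Prod>i\<in>UNIV. exp_inv 1 (real (Suc n) * (x $ i - a $ i)) *
      exp_inv 1 (real (Suc n) * (b $ i - x $ i))) \<longlonglongrightarrow> (\<Prod>i\<in>(UNIV::3 set). 1 * 1)"
    using True by (intro tendsto_intros exp_inv_1_tendsto) (auto simp: mem_box_cart)
  then show ?thesis using True
    by (simp add: box_bump_def right_diff_distrib algebra_simps del: of_nat_Suc)
next
  case False
  then show ?thesis by (simp add: box_bump_outside)
qed

lemma box_bump_test_function:
  assumes "cbox a b \<subseteq> \<Omega>"
  shows "box_bump a b n \<in> test_functions \<Omega>"
proof -
  have "closure {x. box_bump a b n x \<noteq> 0} \<subseteq> cbox a b"
    using box_bump_outside box_subset_cbox by (intro closure_minimal) blast+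
  moreover from this have "compact (closure {x. box_bump a b n x \<noteq> 0})"
    using bounded_subset[OF bounded_cbox] by (auto simp: compact_eq_bounded_closed)
  ultimately show ?thesis
    using assms smooth_box_bump unfolding test_functions_def by auto
qed

section \<open>Bounds for test functions and their partial derivatives\<close>

lemma test_function_partials:
  assumes "\<phi> \<in> test_functions \<Omega>"
  obtains D B where "\<And>x. (\<phi> has_derivative (\<lambda>w. \<Sum>j\<in>UNIV. w $ j * D j x)) (at x)"
    "\<And>j. continuous_on UNIV (D j)" "\<And>x j. x \<notin> closure {x. \<phi> x \<noteq> 0} \<Longrightarrow> D j x = 0"
    "\<And>x j. \<bar>D j x\<bar> \<le> B"
    "\<And>x j. frechet_derivative \<phi> (at x) (axis j 1) = D j x"
proof -
  let ?S = "closure {x. \<phi> x \<noteq> 0}"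
  obtain DD where DD: "DD [] = \<phi>"
    "\<And>js x. (DD js has_derivative (\<lambda>w. \<Sum>j\<in>UNIV. w $ j * DD (j # js) x)) (at x)"
    using assms by (auto simp: test_functions_def smooth_def)
  define D where "D = (\<lambda>j. DD [j])"
  have der: "(\<phi> has_derivative (\<lambda>w. \<Sum>j\<in>UNIV. w $ j * D j x)) (at x)" for x
    using DD(2)[of "[]" x] by (simp add: DD(1) D_def)
  have cont: "continuous_on UNIV (D j)" for j
    unfolding D_def using DD(2)[of "[j]"]
    by (meson continuous_at_imp_continuous_on has_derivative_continuous)
  have fre: "frechet_derivative \<phi> (at x) (axis j 1) = D j x" for x j
    using frechet_derivative_at[OF der[of x], symmetric]
    by (simp add: axis_def if_distrib[of "\<lambda>t. t * _"] sum.delta cong: if_cong)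
  have zero: "D j x = 0" if "x \<notin> ?S" for x j
  proof -
    have "((\<lambda>x. 0) has_derivative (\<lambda>w. 0)) (at x)" by simp
    then have "(\<phi> has_derivative (\<lambda>w. 0)) (at x)"
      by (rule has_derivative_transform_within_open[where s="- ?S"])
        (use that closure_subset[of "{x. \<phi> x \<noteq> 0}"] in auto)
    then have "(\<lambda>w. 0) = (\<lambda>w. \<Sum>j\<in>UNIV. w $ j * D j x)"
      using der has_derivative_unique by blast
    then have "frechet_derivative \<phi> (at x) (axis j 1) = 0"
      using frechet_derivative_at[OF der[of x], symmetric] by metis
    then show ?thesis by (simp add: fre)
  qed
  have "compact ?S" using assms by (auto simp: test_functions_def)
  have "\<exists>B. \<forall>x. \<bar>D j x\<bar> \<le> B" for j
  proof -
    have "bounded (D j ` ?S)"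
      by (intro compact_imp_bounded compact_continuous_image continuous_on_subset[OF cont]) (use \<open>compact ?S\<close> in auto)
    then obtain B where "\<And>x. x \<in> ?S \<Longrightarrow> \<bar>D j x\<bar> \<le> B"
      unfolding bounded_iff by auto
    then show ?thesis using zero by (intro exI[of _ "max B 0"]) (metis abs_zero max.coboundedI1 max.cobounded2)
  qed
  then obtain B where B: "\<And>j x. \<bar>D j x\<bar> \<le> B j" by metis
  have "\<bar>D j x\<bar> \<le> (\<Sum>j\<in>UNIV. \<bar>B j\<bar>)" for j x
    using B[of j x] member_le_sum[of j UNIV "\<lambda>j. \<bar>B j\<bar>"] by fastforce
  then show ?thesis using that der cont zero fre by blast
qed

lemma test_function_bounded:
  assumes "\<phi> \<in> test_functions \<Omega>"
  obtains B where "continuous_on UNIV \<phi>" "\<And>x. \<bar>\<phi> x\<bar> \<le> B"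
proof -
  let ?S = "closure {x. \<phi> x \<noteq> 0}"
  obtain D B where "\<And>x. (\<phi> has_derivative (\<lambda>w. \<Sum>j\<in>UNIV. w $ j * D j x)) (at x)"
    "\<And>j. continuous_on UNIV (D j)" "\<And>x j. x \<notin> ?S \<Longrightarrow> D j x = 0"
    "\<And>x j. \<bar>D j x\<bar> \<le> B" "\<And>x j. frechet_derivative \<phi> (at x) (axis j 1) = D j x"
    by (rule test_function_partials[OF assms], rule that, assumption+)
  then have c: "continuous_on UNIV \<phi>"
    by (meson continuous_at_imp_continuous_on has_derivative_continuous)
  have "compact ?S" using assms by (auto simp: test_functions_def)
  then have "bounded (\<phi> ` ?S)"
    by (intro compact_imp_bounded compact_continuous_image continuous_on_subset[OF c]) auto
  then obtain B where "\<And>x. x \<in> ?S \<Longrightarrow> \<bar>\<phi> x\<bar> \<le> B"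
    unfolding bounded_iff by auto
  then have "\<bar>\<phi> x\<bar> \<le> max B 0" for x
    using closure_subset[of "{x. \<phi> x \<noteq> 0}"] by (cases "\<phi> x = 0") (auto simp: le_max_iff_disj)
  then show ?thesis using that c by blast
qed

section \<open>Weak gradients\<close>

text \<open>Lebesgue differentiation: at almost every point the value is the limit of averages over
  small cubes having that point as lower corner, and inside the open set all these averages
  vanish.\<close>

lemma integral_boxes_zero_imp_AE_zero:
  fixes g :: "real^3 \<Rightarrow> real"
  assumes \<Omega>: "open \<Omega>" and g: "integrable (lebesgue_on \<Omega>) g"
    and zero: "\<And>a b. cbox a b \<subseteq> \<Omega> \<Longrightarrow> (LINT x|lebesgue_on \<Omega>. indicator (box a b) x * g x) = 0"
  shows "AE x in lebesgue_on \<Omega>. g x = 0"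
proof -
  have S: "\<Omega> \<in> sets lebesgue" using \<Omega> by simp
  \<comment> \<open>Extension by zero gives a function integrable over every box of the whole space,
    as the differentiation theorem expects.\<close>
  define f where "f = (\<lambda>x. if x \<in> \<Omega> then g x else 0)"
  have "f absolutely_integrable_on UNIV"
    using Lebesgue_Measure.integrable_restrict_UNIV[OF S, of g] g by (simp add: f_def set_integrable_def)
  then have int: "f integrable_on cbox a b" for a b
    by (meson integrable_on_subcbox set_lebesgue_integral_eq_integral(1) subset_UNIV)
  then obtain N where N: "negligible N"
    "\<And>x e. x \<notin> N \<Longrightarrow> 0 < e \<Longrightarrow> \<exists>d>0. \<forall>h. 0 < h \<and> h < d \<longrightarrow>
       norm (integral (cbox x (x + h *\<^sub>R One)) f /\<^sub>R h ^ DIM(real^3) - f x) < e"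
    using integrable_ccontinuous_explicit[of f] by blast
  have box0: "integral (cbox a b) f = 0" if ab: "cbox a b \<subseteq> \<Omega>" for a b
  proof -
    have "integral (cbox a b) f = integral (box a b) f"
      by (simp add: integral_open_interval)
    also have "\<dots> = integral (box a b) g"
      using ab box_subset_cbox by (intro integral_cong) (auto simp: f_def)
    also have "\<dots> = integral \<Omega> (\<lambda>x. if x \<in> box a b then g x else 0)"
      using ab box_subset_cbox[of a b]
      by (subst Henstock_Kurzweil_Integration.integral_restrict_Int) (metis inf.absorb1 order_trans)
    also have "(\<lambda>x. if x \<in> box a b then g x else 0) = (\<lambda>x. indicator (box a b) x * g x)"
      by (auto simp: indicator_def)
    also have "integral \<Omega> \<dots> = (LINT x|lebesgue_on \<Omega>. indicator (box a b) x * g x)"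
    proof (rule lebesgue_integral_eq_integral[symmetric, OF _ S])
      show "integrable (lebesgue_on \<Omega>) (\<lambda>x. indicator (box a b) x * g x)"
      proof (rule Bochner_Integration.integrable_bound[OF g])
        have "(\<lambda>x. indicator (box a b) x :: real) \<in> borel_measurable (lebesgue_on \<Omega>)"
          by (intro measurable_restrict_space1 borel_measurable_indicator) simp
        then show "(\<lambda>x. indicator (box a b) x * g x) \<in> borel_measurable (lebesgue_on \<Omega>)"
          using g by measurable
      qed (auto simp: indicator_def)
    qed
    finally show ?thesis using zero[OF ab] by simp
  qed
  have "f x = 0" if x: "x \<in> \<Omega>" "x \<notin> N" for x
  proof (rule ccontr)
    assume "f x \<noteq> 0"
    then have "0 < \<bar>f x\<bar>" by simp
    from N(2)[OF \<open>x \<notin> N\<close> this] obtain d where d: "d > 0"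
      "\<forall>h. 0 < h \<and> h < d \<longrightarrow> norm (integral (cbox x (x + h *\<^sub>R One)) f /\<^sub>R h ^ DIM(real^3) - f x) < \<bar>f x\<bar>"
      by (elim exE conjE) (rule that)
    obtain r where r: "r > 0" "ball x r \<subseteq> \<Omega>"
      using \<Omega> x(1) open_contains_ball by blast
    \<comment> \<open>A point of the cube differs from the corner by at most \<open>h\<close> in
      each of three coordinates, so by at most \<open>3 * h\<close> in norm; \<open>r / 6\<close>
      makes this smaller than \<open>r\<close>.\<close>
    define h where "h = min (d / 2) (r / 6)"
    have h: "h > 0" "h < d" "h * 3 < r" using d r by (auto simp: h_def)
    have "cbox x (x + h *\<^sub>R One) \<subseteq> ball x r"
    proof
      fix y assume y: "y \<in> cbox x (x + h *\<^sub>R One)"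
      have "norm (y - x) \<le> (\<Sum>b\<in>Basis. \<bar>(y - x) \<bullet> b\<bar>)"
        by (rule norm_le_l1)
      also have "\<dots> \<le> (\<Sum>b\<in>(Basis::(real^3) set). h)"
        using y by (intro sum_mono) (auto simp: mem_box inner_diff_left inner_add_left)
      also have "\<dots> < r" using h by simp
      finally show "y \<in> ball x r" by (simp add: dist_norm norm_minus_commute)
    qed
    then have "integral (cbox x (x + h *\<^sub>R One)) f = 0" using r box0 by blast
    with d(2)[rule_format, of h] h show False by simp
  qed
  then have "{x \<in> \<Omega>. g x \<noteq> 0} \<subseteq> N" by (auto simp: f_def)
  then have "{x \<in> \<Omega>. g x \<noteq> 0} \<in> null_sets lebesgue"
    using N(1) negligible_subset negligible_iff_null_sets by blast
  then have "AE x in lebesgue. x \<notin> {x \<in> \<Omega>. g x \<noteq> 0}" by (rule AE_not_in)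
  then show ?thesis
    by (subst AE_restrict_space_iff) (use S in auto)
qed

text \<open>The fundamental lemma of the calculus of variations. The bumps of a box converge
  pointwise to its indicator and stay between 0 and 1, so dominated convergence with majorant
  \<open>\<bar>g x\<bar>\<close> passes from test functions to boxes.\<close>

lemma test_functions_orthogonal_imp_AE_zero:
  fixes g :: "real^3 \<Rightarrow> real"
  assumes \<Omega>: "open \<Omega>" and g: "integrable (lebesgue_on \<Omega>) g"
    and zero: "\<And>\<phi>. \<phi> \<in> test_functions \<Omega> \<Longrightarrow> (LINT x|lebesgue_on \<Omega>. g x * \<phi> x) = 0"
  shows "AE x in lebesgue_on \<Omega>. g x = 0"
proof (rule integral_boxes_zero_imp_AE_zero[OF \<Omega> g])
  fix a b :: "real^3" assume ab: "cbox a b \<subseteq> \<Omega>"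
  have S: "\<Omega> \<in> sets lebesgue" using \<Omega> by simp
  have meas: "(\<lambda>x. box_bump a b n x) \<in> borel_measurable (lebesgue_on \<Omega>)" for n
    using test_function_bounded[OF box_bump_test_function[OF ab, of n]]
      continuous_imp_measurable_on_sets_lebesgue[OF _ S] continuous_on_subset by blast
  have "(\<lambda>n. LINT x|lebesgue_on \<Omega>. box_bump a b n x * g x) \<longlonglongrightarrow>
      (LINT x|lebesgue_on \<Omega>. indicator (box a b) x * g x)"
  proof (rule integral_dominated_convergence[where w="\<lambda>x. \<bar>g x\<bar>"])
    show "(\<lambda>x. box_bump a b n x * g x) \<in> borel_measurable (lebesgue_on \<Omega>)" for n
      using meas g by measurable
    have "(\<lambda>x. indicator (box a b) x :: real) \<in> borel_measurable (lebesgue_on \<Omega>)"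
      by (intro borel_measurable_LIMSEQ_metric[OF meas box_bump_tendsto])
    then show "(\<lambda>x. indicator (box a b) x * g x) \<in> borel_measurable (lebesgue_on \<Omega>)"
      using g by measurable
    show "integrable (lebesgue_on \<Omega>) (\<lambda>x. \<bar>g x\<bar>)" using g by simp
    show "AE x in lebesgue_on \<Omega>. (\<lambda>n. box_bump a b n x * g x) \<longlonglongrightarrow> indicator (box a b) x * g x"
      by (intro AE_I2 tendsto_intros box_bump_tendsto)
    show "AE x in lebesgue_on \<Omega>. norm (box_bump a b n x * g x) \<le> \<bar>g x\<bar>" for n
      using box_bump_bounds by (intro AE_I2) (simp add: abs_mult mult_left_le_one_le)
  qed
  moreover have "(LINT x|lebesgue_on \<Omega>. box_bump a b n x * g x) = 0" for n
    using zero[OF box_bump_test_function[OF ab, of n]] by (simp add: mult.commute)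
  ultimately show "(LINT x|lebesgue_on \<Omega>. indicator (box a b) x * g x) = 0"
    using LIMSEQ_unique[OF _ tendsto_const] by simp
qed

lemma integrable_mult_bounded_continuous:
  fixes g \<psi> :: "real^3 \<Rightarrow> real"
  assumes "\<Omega> \<in> sets lebesgue" "integrable (lebesgue_on \<Omega>) g"
    "continuous_on UNIV \<psi>" "\<And>x. \<bar>\<psi> x\<bar> \<le> B"
  shows "integrable (lebesgue_on \<Omega>) (\<lambda>x. g x * \<psi> x)"
proof (rule Bochner_Integration.integrable_bound)
  show "integrable (lebesgue_on \<Omega>) (\<lambda>x. B * g x)" using assms by simp
  have "\<psi> \<in> borel_measurable (lebesgue_on \<Omega>)"
    using assms by (meson continuous_imp_measurable_on_sets_lebesgue continuous_on_subset subset_UNIV)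
  then show "(\<lambda>x. g x * \<psi> x) \<in> borel_measurable (lebesgue_on \<Omega>)" using assms by measurable
  have "B \<ge> 0" using assms(4)[of undefined] by linarith
  then have "norm (g x * \<psi> x) \<le> norm (B * g x)" for x
    using mult_left_mono[OF assms(4)[of x], of "\<bar>g x\<bar>"] by (simp add: abs_mult mult.commute)
  then show "AE x in lebesgue_on \<Omega>. norm (g x * \<psi> x) \<le> norm (B * g x)"
    by simp
qed

lemma test_function_integrable:
  fixes g :: "real^3 \<Rightarrow> real"
  assumes "\<Omega> \<in> sets lebesgue" "integrable (lebesgue_on \<Omega>) g" "\<phi> \<in> test_functions \<Omega>"
  shows "integrable (lebesgue_on \<Omega>) (\<lambda>x. g x * \<phi> x)"
    and "integrable (lebesgue_on \<Omega>) (\<lambda>x. g x * frechet_derivative \<phi> (at x) (axis j 1))"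
proof -
  show "integrable (lebesgue_on \<Omega>) (\<lambda>x. g x * \<phi> x)"
    using test_function_bounded[OF assms(3)] integrable_mult_bounded_continuous[OF assms(1,2)] by blast
  show "integrable (lebesgue_on \<Omega>) (\<lambda>x. g x * frechet_derivative \<phi> (at x) (axis j 1))"
    by (rule test_function_partials[OF assms(3)])
      (simp, rule integrable_mult_bounded_continuous[OF assms(1,2)], assumption+)
qed

section \<open>Uniqueness and linearity of the weak gradient\<close>

lemma L2_component_integrable:
  fixes u :: "real^3 \<Rightarrow> real^3" and G :: "real^3 \<Rightarrow> real^3^3"
  assumes "\<Omega> \<in> lmeasurable"
  shows "u \<in> L2 \<Omega> \<Longrightarrow> integrable (lebesgue_on \<Omega>) (\<lambda>x. u x $ i)"
    and "G \<in> L2 \<Omega> \<Longrightarrow> integrable (lebesgue_on \<Omega>) (\<lambda>x. G x $ i $ j)"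
proof -
  show "integrable (lebesgue_on \<Omega>) (\<lambda>x. u x $ i)" if "u \<in> L2 \<Omega>"
    using integrable_bounded_linear[OF bounded_linear_vec_nth L2_integrable[OF assms that]] .
  show "integrable (lebesgue_on \<Omega>) (\<lambda>x. G x $ i $ j)" if "G \<in> L2 \<Omega>"
    using integrable_bounded_linear[OF bounded_linear_vec_nth
        integrable_bounded_linear[OF bounded_linear_vec_nth L2_integrable[OF assms that]]] .
qed

lemma has_weak_gradientD:
  "has_weak_gradient \<Omega> u G \<Longrightarrow> \<phi> \<in> test_functions \<Omega> \<Longrightarrow>
    (LINT x|lebesgue_on \<Omega>. u x $ i * frechet_derivative \<phi> (at x) (axis j 1)) =
    - (LINT x|lebesgue_on \<Omega>. G x $ i $ j * \<phi> x)"
  by (simp add: has_weak_gradient_def)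

text \<open>Each entry of the difference is orthogonal to all test functions, and the finitely many
  exceptional null sets are merged. This gives access to \<open>grad\<close>, which is only some
  representative.\<close>

lemma weak_gradient_unique:
  assumes \<Omega>: "open \<Omega>" "bounded \<Omega>"
    and G: "G \<in> L2 \<Omega>" "has_weak_gradient \<Omega> u G" and H: "H \<in> L2 \<Omega>" "has_weak_gradient \<Omega> u H"
  shows "AE x in lebesgue_on \<Omega>. G x = H x"
proof -
  have lm: "\<Omega> \<in> lmeasurable" using \<Omega> by (simp add: lmeasurable_open)
  have S: "\<Omega> \<in> sets lebesgue" using \<Omega> by simp
  have "AE x in lebesgue_on \<Omega>. G x $ i $ j - H x $ i $ j = 0" for i j
  proof (rule test_functions_orthogonal_imp_AE_zero[OF \<Omega>(1)])
    note I = L2_component_integrable(2)[OF lm G(1), of i j] L2_component_integrable(2)[OF lm H(1), of i j]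
    then show "integrable (lebesgue_on \<Omega>) (\<lambda>x. G x $ i $ j - H x $ i $ j)" by simp
    fix \<phi> assume \<phi>: "\<phi> \<in> test_functions \<Omega>"
    have "(LINT x|lebesgue_on \<Omega>. (G x $ i $ j - H x $ i $ j) * \<phi> x) =
      (LINT x|lebesgue_on \<Omega>. G x $ i $ j * \<phi> x) - (LINT x|lebesgue_on \<Omega>. H x $ i $ j * \<phi> x)"
      using test_function_integrable(1)[OF S _ \<phi>] I by (simp add: left_diff_distrib)
    also have "\<dots> = 0"
      using has_weak_gradientD[OF G(2) \<phi>, of i j] has_weak_gradientD[OF H(2) \<phi>, of i j] by simp
    finally show "(LINT x|lebesgue_on \<Omega>. (G x $ i $ j - H x $ i $ j) * \<phi> x) = 0" .
  qed
  then have "AE x in lebesgue_on \<Omega>. \<forall>i j. G x $ i $ j - H x $ i $ j = 0"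
    by (intro eventually_all_finite)
  then show ?thesis by eventually_elim (simp add: vec_eq_iff)
qed

lemma has_weak_gradient_lincomb:
  assumes lm: "\<Omega> \<in> lmeasurable" and u: "u \<in> L2 \<Omega>" "v \<in> L2 \<Omega>" and GH: "G \<in> L2 \<Omega>" "H \<in> L2 \<Omega>"
    and w: "has_weak_gradient \<Omega> u G" "has_weak_gradient \<Omega> v H"
  shows "has_weak_gradient \<Omega> (\<lambda>x. u x + c *\<^sub>R v x) (\<lambda>x. G x + c *\<^sub>R H x)"
  unfolding has_weak_gradient_def
proof (intro ballI allI)
  fix \<phi> i j assume \<phi>: "\<phi> \<in> test_functions \<Omega>"
  have S: "\<Omega> \<in> sets lebesgue" using lm by blast
  let ?d = "\<lambda>x. frechet_derivative \<phi> (at x) (axis j 1)"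
  note I = test_function_integrable(2)[OF S L2_component_integrable(1)[OF lm u(1)] \<phi>, of i j]
     test_function_integrable(2)[OF S L2_component_integrable(1)[OF lm u(2)] \<phi>, of i j]
     test_function_integrable(1)[OF S L2_component_integrable(2)[OF lm GH(1)] \<phi>, of i j]
     test_function_integrable(1)[OF S L2_component_integrable(2)[OF lm GH(2)] \<phi>, of i j]
  have "(LINT x|lebesgue_on \<Omega>. (u x + c *\<^sub>R v x) $ i * ?d x) =
     (LINT x|lebesgue_on \<Omega>. u x $ i * ?d x) + c * (LINT x|lebesgue_on \<Omega>. v x $ i * ?d x)"
    using I(1,2) by (simp add: distrib_right mult.assoc)
  also have "\<dots> = - ((LINT x|lebesgue_on \<Omega>. G x $ i $ j * \<phi> x) + c * (LINT x|lebesgue_on \<Omega>. H x $ i $ j * \<phi> x))"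
    using w[THEN has_weak_gradientD, OF \<phi>] by simp
  also have "(LINT x|lebesgue_on \<Omega>. G x $ i $ j * \<phi> x) + c * (LINT x|lebesgue_on \<Omega>. H x $ i $ j * \<phi> x)
     = (LINT x|lebesgue_on \<Omega>. (G x + c *\<^sub>R H x) $ i $ j * \<phi> x)"
    using I(3,4) by (simp add: distrib_right mult.assoc)
  finally show "(LINT x|lebesgue_on \<Omega>. (u x + c *\<^sub>R v x) $ i * ?d x) =
     - (LINT x|lebesgue_on \<Omega>. (G x + c *\<^sub>R H x) $ i $ j * \<phi> x)" .
qed

lemma grad_spec:
  assumes "u \<in> H1 \<Omega>"
  shows "grad \<Omega> u \<in> L2 \<Omega>" "has_weak_gradient \<Omega> u (grad \<Omega> u)"
proof -
  have "\<exists>G. G \<in> L2 \<Omega> \<and> has_weak_gradient \<Omega> u G"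
    using assms by (auto simp: H1_def)
  then have "grad \<Omega> u \<in> L2 \<Omega> \<and> has_weak_gradient \<Omega> u (grad \<Omega> u)"
    unfolding grad_def by (rule someI_ex)
  then show "grad \<Omega> u \<in> L2 \<Omega>" "has_weak_gradient \<Omega> u (grad \<Omega> u)" by auto
qed

lemma H1_imp_L2: "u \<in> H1 \<Omega> \<Longrightarrow> u \<in> L2 \<Omega>"
  by (simp add: H1_def)

lemma H1_lincomb:
  assumes "\<Omega> \<in> lmeasurable" "u \<in> H1 \<Omega>" "v \<in> H1 \<Omega>"
  shows "(\<lambda>x. u x + c *\<^sub>R v x) \<in> H1 \<Omega>"
proof -
  note g = assms(2,3)[THEN H1_imp_L2] assms(2,3)[THEN grad_spec(1)]
  have "(\<lambda>x. u x + c *\<^sub>R v x) \<in> L2 \<Omega>" "(\<lambda>x. grad \<Omega> u x + c *\<^sub>R grad \<Omega> v x) \<in> L2 \<Omega>"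
    using g by (auto intro: L2_add L2_scale)
  moreover have "has_weak_gradient \<Omega> (\<lambda>x. u x + c *\<^sub>R v x) (\<lambda>x. grad \<Omega> u x + c *\<^sub>R grad \<Omega> v x)"
    using assms(2,3)[THEN grad_spec(2)] by (rule has_weak_gradient_lincomb[OF assms(1) g])
  ultimately show ?thesis unfolding H1_def by blast
qed

text \<open>\<open>grad\<close> chooses a representative for each function separately, so linearity
  is not built in. Both sides are weak gradients of the same function, and uniqueness identifies
  them up to a null set.\<close>

lemma grad_lincomb:
  assumes \<Omega>: "open \<Omega>" "bounded \<Omega>" and u: "u \<in> H1 \<Omega>" "v \<in> H1 \<Omega>"
  shows "AE x in lebesgue_on \<Omega>. grad \<Omega> (\<lambda>x. u x + c *\<^sub>R v x) x = grad \<Omega> u x + c *\<^sub>R grad \<Omega> v x"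
proof -
  have lm: "\<Omega> \<in> lmeasurable" using \<Omega> by (simp add: lmeasurable_open)
  show ?thesis
    by (rule weak_gradient_unique[OF \<Omega> grad_spec[OF H1_lincomb[OF lm u]]
      L2_add[OF grad_spec(1)[OF u(1)] L2_scale[OF grad_spec(1)[OF u(2)]]]
      has_weak_gradient_lincomb[OF lm u[THEN H1_imp_L2] u[THEN grad_spec(1)] u[THEN grad_spec(2)]]])
qed

text \<open>Integrals ignore null sets, so linearity of \<open>grad\<close> almost everywhere
  becomes exact here. All expansions of the energy rest on this.\<close>

lemma L2_inner_grad_lincomb:
  assumes \<Omega>: "open \<Omega>" "bounded \<Omega>" and u: "u \<in> H1 \<Omega>" "v \<in> H1 \<Omega>" "w \<in> H1 \<Omega>"
  shows "L2_inner \<Omega> (grad \<Omega> (\<lambda>x. u x + c *\<^sub>R v x)) (grad \<Omega> w) =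
    L2_inner \<Omega> (grad \<Omega> u) (grad \<Omega> w) + c * L2_inner \<Omega> (grad \<Omega> v) (grad \<Omega> w)"
proof -
  have lm: "\<Omega> \<in> lmeasurable" using \<Omega> by (simp add: lmeasurable_open)
  note g = u[THEN grad_spec(1)] grad_spec(1)[OF H1_lincomb[OF lm u(1,2)], of c]
  have "L2_inner \<Omega> (grad \<Omega> (\<lambda>x. u x + c *\<^sub>R v x)) (grad \<Omega> w) =
     L2_inner \<Omega> (\<lambda>x. grad \<Omega> u x + c *\<^sub>R grad \<Omega> v x) (grad \<Omega> w)"
    unfolding L2_inner_def
  proof (rule integral_cong_AE)
    show "AE x in lebesgue_on \<Omega>. grad \<Omega> (\<lambda>x. u x + c *\<^sub>R v x) x \<bullet> grad \<Omega> w x =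
        (grad \<Omega> u x + c *\<^sub>R grad \<Omega> v x) \<bullet> grad \<Omega> w x"
      using grad_lincomb[OF \<Omega> u(1,2), of c] by eventually_elim simp
  qed (use g in \<open>auto dest!: L2_measurable\<close>)
  then show ?thesis
    using g by (simp add: L2_inner_add_left L2_inner_scale_left L2_scale)
qed

section \<open>Meshes and nodal interpolation\<close>

text \<open>Translating one point to the origin turns affine into linear independence, and values
  prescribed on a linearly independent set extend to a linear functional.\<close>

lemma affine_interpolation:
  fixes C :: "'a::euclidean_space set"
  assumes C: "\<not> affine_dependent C"
  shows "\<exists>a b. \<forall>z\<in>C. a \<bullet> z + b = (f z :: real)"
proof (cases "C = {}")
  case False
  then obtain c where c: "c \<in> C" by blast
  have "independent ((\<lambda>x. - c + x) ` (C - {c}))"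
    using C affine_dependent_iff_dependent2[OF c] by blast
  then obtain g :: "'a \<Rightarrow> real" where g: "linear g" "\<forall>x\<in>(\<lambda>x. - c + x) ` (C - {c}). g x = f (c + x) - f c"
    using linear_independent_extend[of _ "\<lambda>x. f (c + x) - f c"] by blast
  \<comment> \<open>\<open>adjoint g 1\<close> is the vector representing the functional
    \<open>g\<close>, that is, the gradient of the interpolating affine function.\<close>
  have ga: "adjoint g 1 \<bullet> x = g x" for x
    using adjoint_works[OF g(1), of x 1] by (simp add: inner_commute)
  have "adjoint g 1 \<bullet> z + (f c - g c) = f z" if "z \<in> C" for z
  proof (cases "z = c")
    case False
    then have "g (z - c) = f z - f c" using g(2) that by auto
    then show ?thesis using linear_diff[OF g(1)] by (simp add: ga)
  qed (simp add: ga)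
  then show ?thesis by blast
qed simp

locale mesh =
  fixes \<Omega> :: "(real^3) set" and T :: "(real^3) set set"
  assumes domain: "lipschitz_polyhedral_domain \<Omega>" and mesh: "tetrahedral_mesh \<Omega> T"
begin

definition vertices :: "(real^3) set \<Rightarrow> (real^3) set" where
  "vertices K = {z. z extreme_point_of K}"

lemma open_\<Omega>: "open \<Omega>" and bounded_\<Omega>: "bounded \<Omega>" and \<Omega>_nonempty: "\<Omega> \<noteq> {}"
  using domain by (auto simp: lipschitz_polyhedral_domain_def)

lemma lmeasurable_\<Omega>: "\<Omega> \<in> lmeasurable"
  by (simp add: lmeasurable_open open_\<Omega> bounded_\<Omega>)

lemma sets_\<Omega>: "\<Omega> \<in> sets lebesgue"
  using open_\<Omega> by simp

lemma finite_T: "finite T" and simplex_T: "K \<in> T \<Longrightarrow> 3 simplex K" and Union_T: "\<Union>T = closure \<Omega>"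
  and face_T: "K \<in> T \<Longrightarrow> K' \<in> T \<Longrightarrow> (K \<inter> K') face_of K"
  using mesh by (auto simp: tetrahedral_mesh_def triangulation_def)

lemma compact_T: "K \<in> T \<Longrightarrow> compact K" and convex_T: "K \<in> T \<Longrightarrow> convex K"
  using simplex_T compact_simplex convex_simplex by blast+

lemma compact_Union_T: "compact (\<Union>T)"
  using bounded_\<Omega> by (simp add: Union_T)

lemma \<Omega>_subset: "\<Omega> \<subseteq> \<Union>T"
  by (simp add: Union_T closure_subset)

lemma vertices_T:
  assumes "K \<in> T"
  shows "finite (vertices K)" "\<not> affine_dependent (vertices K)" "K = convex hull (vertices K)"
    "vertices K \<noteq> {}" "vertices K \<subseteq> K"
proof -
  obtain C where C: "\<not> affine_dependent C" "int (card C) = 3 + 1" "K = convex hull C"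
    using simplex_T[OF assms] by (auto simp: simplex_def)
  have "vertices K = C"
    using C extreme_point_of_convex_hull_affine_independent by (auto simp: vertices_def)
  then show "finite (vertices K)" "\<not> affine_dependent (vertices K)" "K = convex hull (vertices K)"
    "vertices K \<noteq> {}" "vertices K \<subseteq> K"
    using C aff_independent_finite by (auto intro: hull_inc)
qed

lemma vertices_nodes: "K \<in> T \<Longrightarrow> vertices K \<subseteq> nodes T"
  by (auto simp: vertices_def nodes_def)

lemma nodes_eq: "nodes T = (\<Union>K\<in>T. vertices K)"
  by (auto simp: vertices_def nodes_def)

lemma finite_nodes: "finite (nodes T)"
  using finite_T vertices_T(1) by (simp add: nodes_eq)

lemma nodes_subset: "nodes T \<subseteq> \<Union>T"
  using vertices_T(5) by (auto simp: nodes_eq)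

lemma S1_affine: "u \<in> S1 T \<Longrightarrow> K \<in> T \<Longrightarrow> \<exists>a b. \<forall>x\<in>K. u x = a \<bullet> x + b"
  by (simp add: S1_def)

text \<open>The weights depend on the point alone: affine functions commute with convex
  combinations, so one set of barycentric coordinates evaluates every finite element function.
  Pointwise bounds on an element thereby reduce to its vertices.\<close>

lemma barycentric:
  assumes K: "K \<in> T" and x: "x \<in> K"
  shows "\<exists>c. (\<forall>z\<in>vertices K. 0 \<le> c z) \<and> sum c (vertices K) = 1 \<and>
    (\<forall>u\<in>S1 T. u x = (\<Sum>z\<in>vertices K. c z * u z))"
proof -
  have "x \<in> convex hull (vertices K)" using x vertices_T(3)[OF K] by simp
  then obtain c where c: "\<forall>z\<in>vertices K. 0 \<le> c z" "sum c (vertices K) = 1"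
    "(\<Sum>z\<in>vertices K. c z *\<^sub>R z) = x"
    unfolding convex_hull_finite[OF vertices_T(1)[OF K]] by blast
  have "u x = (\<Sum>z\<in>vertices K. c z * u z)" if u: "u \<in> S1 T" for u
  proof -
    obtain a b where ab: "\<And>y. y \<in> K \<Longrightarrow> u y = a \<bullet> y + b"
      using S1_affine[OF u K] by blast
    have "(\<Sum>z\<in>vertices K. c z * u z) = (\<Sum>z\<in>vertices K. a \<bullet> (c z *\<^sub>R z) + c z * b)"
      using vertices_T(5)[OF K] by (intro sum.cong) (auto simp: ab algebra_simps)
    also have "\<dots> = a \<bullet> (\<Sum>z\<in>vertices K. c z *\<^sub>R z) + (\<Sum>z\<in>vertices K. c z) * b"
      unfolding sum.distrib inner_sum_right sum_distrib_right ..
    finally show ?thesis using ab x c by simp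
  qed
  with c show ?thesis by blast
qed

lemma S1_eqI:
  assumes "u \<in> S1 T" "v \<in> S1 T" "\<And>z. z \<in> nodes T \<Longrightarrow> u z = v z"
  shows "u = v"
proof
  fix x
  show "u x = v x"
  proof (cases "x \<in> \<Union>T")
    case True
    then obtain K where K: "K \<in> T" "x \<in> K" by blast
    obtain c where c: "\<forall>z\<in>vertices K. 0 \<le> c z" "sum c (vertices K) = 1"
    "\<forall>u\<in>S1 T. u x = (\<Sum>z\<in>vertices K. c z * u z)"
    using barycentric[OF K] by blast
    have "(\<Sum>z\<in>vertices K. c z * u z) = (\<Sum>z\<in>vertices K. c z * v z)"
      using assms(3) vertices_nodes[OF K(1)] by (intro sum.cong) auto
    then show ?thesis
      using assms(1,2) c(3) by simp
  next
    case False
    then show ?thesis using assms by (simp add: S1_def)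
  qed
qed

lemma S1_lincomb:
  assumes "u \<in> S1 T" "v \<in> S1 T"
  shows "(\<lambda>x. u x + c * v x) \<in> S1 T"
  unfolding S1_def
proof (intro CollectI conjI ballI allI impI)
  show "continuous_on (\<Union>T) (\<lambda>x. u x + c * v x)"
    using assms by (auto simp: S1_def intro!: continuous_intros)
  show "u x + c * v x = 0" if "x \<notin> \<Union>T" for x
    using assms that by (simp add: S1_def)
  fix K assume "K \<in> T"
  from S1_affine[OF assms(1) this] obtain a b where "\<forall>x\<in>K. u x = a \<bullet> x + b" by blast
  moreover from S1_affine[OF assms(2) \<open>K \<in> T\<close>] obtain a' b' where "\<forall>x\<in>K. v x = a' \<bullet> x + b'" by blast
  ultimately show "\<exists>a b. \<forall>x\<in>K. u x + c * v x = a \<bullet> x + b"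
    by (intro exI[of _ "a + c *\<^sub>R a'"] exI[of _ "b + c * b'"]) (simp add: algebra_simps)
qed

lemma S1_zero: "(\<lambda>x. 0) \<in> S1 T"
  unfolding S1_def by (auto intro!: exI[of _ 0])

text \<open>By Krein-Milman the intersection is the hull of its extreme points; being a face of both
  elements, it has only extreme points that are vertices of both. Agreement at common vertices will
  thus imply agreement on the whole overlap.\<close>

lemma vertices_common_face:
  assumes K: "K \<in> T" "K' \<in> T"
  shows "K \<inter> K' = convex hull (vertices K \<inter> vertices K')"
proof
  have f: "(K \<inter> K') face_of K" "(K \<inter> K') face_of K'"
    using face_T[OF K] face_T[OF K(2,1)] by (simp_all add: Int_commute)
  have "K \<inter> K' = convex hull {x. x extreme_point_of (K \<inter> K')}"
    using compact_T convex_T K by (intro Krein_Milman_Minkowski compact_Int convex_Int) auto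
  moreover have "{x. x extreme_point_of (K \<inter> K')} \<subseteq> vertices K \<inter> vertices K'"
    using extreme_point_of_face[OF f(1)] extreme_point_of_face[OF f(2)] by (auto simp: vertices_def)
  ultimately show "K \<inter> K' \<subseteq> convex hull (vertices K \<inter> vertices K')"
    using hull_mono by blast
  show "convex hull (vertices K \<inter> vertices K') \<subseteq> K \<inter> K'"
    using vertices_T(5) convex_T K by (intro hull_minimal convex_Int) auto
qed

text \<open>Every element has its own affine interpolant. Two of them coincide at the common
  vertices, hence on the overlap of the elements, so that the pieces glue to a continuous
  function.\<close>

lemma interpolation_exists: "\<exists>u\<in>S1 T. \<forall>z\<in>nodes T. u z = f z"
proof -
  have "\<forall>K\<in>T. \<exists>ab. \<forall>z\<in>vertices K. fst ab \<bullet> z + snd ab = f z"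
  proof
    fix K assume "K \<in> T"
    then obtain a b where "\<forall>z\<in>vertices K. a \<bullet> z + b = f z"
      using affine_interpolation[of "vertices K" f] vertices_T(2) by blast
    then show "\<exists>ab. \<forall>z\<in>vertices K. fst ab \<bullet> z + snd ab = f z" by (intro exI[of _ "(a, b)"]) simp
  qed
  from bchoice[OF this] obtain ab where ab: "\<And>K z. K \<in> T \<Longrightarrow> z \<in> vertices K \<Longrightarrow> fst (ab K) \<bullet> z + snd (ab K) = f z"
    by blast
  define g where "g = (\<lambda>K x. fst (ab K) \<bullet> x + snd (ab K))"
  have agree: "g K x = g K' x" if K: "K \<in> T" "K' \<in> T" "x \<in> K" "x \<in> K'" for K K' x
  proof -
    let ?C = "vertices K \<inter> vertices K'"
    have "x \<in> convex hull ?C"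
      using vertices_common_face[OF K(1,2)] K by blast
    \<comment> \<open>The set on which two affine functions agree is convex, so it contains the hull
      of the common vertices.\<close>
    also have "\<dots> \<subseteq> {x. (fst (ab K) - fst (ab K')) \<bullet> x = snd (ab K') - snd (ab K)}"
    proof (rule hull_minimal)
      show "?C \<subseteq> {x. (fst (ab K) - fst (ab K')) \<bullet> x = snd (ab K') - snd (ab K)}"
        using ab[OF K(1)] ab[OF K(2)] by (force simp: inner_diff_left algebra_simps)
      show "convex {x. (fst (ab K) - fst (ab K')) \<bullet> x = snd (ab K') - snd (ab K)}"
        by (rule convex_hyperplane)
    qed
    finally show ?thesis by (simp add: g_def inner_diff_left)
  qed
  \<comment> \<open>Which of the elements containing \<open>x\<close> is selected is immaterial by
    \<open>agree\<close>.\<close>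
  define u where "u = (\<lambda>x. if x \<in> \<Union>T then g (SOME K. K \<in> T \<and> x \<in> K) x else 0)"
  have u: "u x = g K x" if "K \<in> T" "x \<in> K" for K x
  proof -
    let ?K = "SOME K. K \<in> T \<and> x \<in> K"
    have "?K \<in> T \<and> x \<in> ?K"
      using that by (intro someI[of "\<lambda>K. K \<in> T \<and> x \<in> K"]) simp
    then have "g ?K x = g K x" using that by (intro agree) auto
    moreover have "x \<in> \<Union>T" using that by blast
    ultimately show ?thesis by (simp add: u_def)
  qed
  have "u \<in> S1 T"
    unfolding S1_def
  proof (intro CollectI conjI ballI allI impI)
    have "continuous_on (\<Union>K\<in>T. K) u"
    proof (rule continuous_on_closed_Union[OF finite_T])
      fix K assume K: "K \<in> T"
      show "closed K" using compact_T[OF K] by (rule compact_imp_closed)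
      have "continuous_on K (g K)" unfolding g_def by (intro continuous_intros)
      then show "continuous_on K u"
        by (rule continuous_on_eq) (simp add: u[OF K])
    qed
    then show "continuous_on (\<Union>T) u" by simp
    show "\<exists>a b. \<forall>x\<in>K. u x = a \<bullet> x + b" if "K \<in> T" for K
      using u[OF that] by (auto simp: g_def)
    show "u x = 0" if "x \<notin> \<Union>T" for x using that by (simp add: u_def)
  qed
  moreover have "u z = f z" if "z \<in> nodes T" for z
  proof -
    from that obtain K where K: "K \<in> T" "z \<in> vertices K" by (auto simp: nodes_eq)
    then have "u z = g K z" using vertices_T(5) by (intro u) auto
    then show ?thesis using ab[OF K] by (simp add: g_def)
  qed
  ultimately show ?thesis by blast
qed

lemma nodal_interpolant:
  shows nodal_interpolant_S1: "nodal_interpolant T f \<in> S1 T"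
    and nodal_interpolant_node: "z \<in> nodes T \<Longrightarrow> nodal_interpolant T f z = f z"
proof -
  obtain w where "w \<in> S1 T" "\<forall>z\<in>nodes T. w z = f z"
    using interpolation_exists by blast
  then have "\<exists>!u. u \<in> S1 T \<and> (\<forall>z\<in>nodes T. u z = f z)"
    by (intro ex1I[of _ w]) (auto intro: S1_eqI)
  then have *: "nodal_interpolant T f \<in> S1 T \<and> (\<forall>z\<in>nodes T. nodal_interpolant T f z = f z)"
    unfolding nodal_interpolant_def by (rule theI')
  then show "nodal_interpolant T f \<in> S1 T" "z \<in> nodes T \<Longrightarrow> nodal_interpolant T f z = f z" by auto
qed

lemma nodal_interpolant_lincomb:
  "nodal_interpolant T (\<lambda>x. f x + c * g x) = (\<lambda>x. nodal_interpolant T f x + c * nodal_interpolant T g x)"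
  by (intro S1_eqI S1_lincomb nodal_interpolant_S1) (simp add: nodal_interpolant_node)

lemma nodal_interpolant_cong:
  "(\<And>z. z \<in> nodes T \<Longrightarrow> f z = g z) \<Longrightarrow> nodal_interpolant T f = nodal_interpolant T g"
  by (intro S1_eqI nodal_interpolant_S1) (simp add: nodal_interpolant_node)

lemma nodal_interpolant_nonneg:
  assumes "\<And>z. z \<in> nodes T \<Longrightarrow> 0 \<le> f z"
  shows "0 \<le> nodal_interpolant T f x"
proof (cases "x \<in> \<Union>T")
  case True
  then obtain K where K: "K \<in> T" "x \<in> K" by blast
  obtain c where c: "\<forall>z\<in>vertices K. 0 \<le> c z" "sum c (vertices K) = 1"
    "\<forall>u\<in>S1 T. u x = (\<Sum>z\<in>vertices K. c z * u z)"
    using barycentric[OF K] by blast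
  have "0 \<le> (\<Sum>z\<in>vertices K. c z * nodal_interpolant T f z)"
    using vertices_nodes[OF K(1)] c(1) assms
    by (intro sum_nonneg mult_nonneg_nonneg) (auto simp: nodal_interpolant_node subset_iff)
  then show ?thesis using c(3)[rule_format, OF nodal_interpolant_S1[of f]] by simp
next
  case False
  then show ?thesis using nodal_interpolant_S1[of f] by (simp add: S1_def)
qed

lemma nodal_interpolant_le_vertices:
  assumes K: "K \<in> T" "x \<in> K" and B: "\<And>z. z \<in> vertices K \<Longrightarrow> f z \<le> B"
  shows "nodal_interpolant T f x \<le> B"
proof -
  obtain c where c: "\<forall>z\<in>vertices K. 0 \<le> c z" "sum c (vertices K) = 1"
    "\<forall>u\<in>S1 T. u x = (\<Sum>z\<in>vertices K. c z * u z)"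
    using barycentric[OF K] by blast
  have "nodal_interpolant T f x = (\<Sum>z\<in>vertices K. c z * f z)"
    using vertices_nodes[OF K(1)] c(3)[rule_format, OF nodal_interpolant_S1[of f]]
    by (auto simp: nodal_interpolant_node subset_iff intro!: sum.cong)
  also have "\<dots> \<le> (\<Sum>z\<in>vertices K. c z * B)"
    using c(1) B by (intro sum_mono mult_left_mono) auto
  also have "\<dots> = B" using c(2) by (simp flip: sum_distrib_right)
  finally show ?thesis .
qed

lemma nodal_interpolant_1: "x \<in> \<Union>T \<Longrightarrow> nodal_interpolant T (\<lambda>_. 1) x = 1"
proof -
  assume "x \<in> \<Union>T"
  then obtain K where K: "K \<in> T" "x \<in> K" by blast
  obtain c where c: "\<forall>z\<in>vertices K. 0 \<le> c z" "sum c (vertices K) = 1"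
    "\<forall>u\<in>S1 T. u x = (\<Sum>z\<in>vertices K. c z * u z)"
    using barycentric[OF K] by blast
  have "(\<Sum>z\<in>vertices K. c z * nodal_interpolant T (\<lambda>_. 1) z) = sum c (vertices K)"
    using vertices_nodes[OF K(1)] by (intro sum.cong) (auto simp: nodal_interpolant_node)
  then show ?thesis using c(2) c(3)[rule_format, OF nodal_interpolant_S1[of "\<lambda>_. 1"]] by simp
qed

section \<open>Vector-valued finite element functions\<close>

lemma S1_vec_lincomb:
  assumes "u \<in> S1_vec T" "v \<in> S1_vec T"
  shows "(\<lambda>x. u x + c *\<^sub>R v x) \<in> S1_vec T"
  using assms S1_lincomb by (auto simp: S1_vec_def)

lemma S1_vec_zero: "(\<lambda>x. 0) \<in> S1_vec T"
  using S1_zero by (simp add: S1_vec_def)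

lemma S1_vec_eqI:
  assumes "u \<in> S1_vec T" "v \<in> S1_vec T" "\<And>z. z \<in> nodes T \<Longrightarrow> u z = v z"
  shows "u = v"
proof -
  have "(\<lambda>x. u x $ i) = (\<lambda>x. v x $ i)" for i
    using assms by (intro S1_eqI) (auto simp: S1_vec_def)
  then show ?thesis by (intro ext) (metis vec_eq_iff)
qed

lemma S1_vec_continuous: "u \<in> S1_vec T \<Longrightarrow> continuous_on (\<Union>T) u"
  by (subst continuous_on_componentwise)
    (auto simp: S1_vec_def S1_def cart_eq_inner_axis Basis_vec_def)

text \<open>Jensen's inequality for the squared norm: \<open>u x\<close> is the barycentric average
  of the vertex values, and the interpolant averages their squared lengths with the same
  weights.\<close>

lemma S1_vec_norm_le_interpolant:
  assumes u: "u \<in> S1_vec T" and x: "x \<in> \<Union>T"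
  shows "(norm (u x))\<^sup>2 \<le> nodal_interpolant T (\<lambda>y. (norm (u y))\<^sup>2) x"
proof -
  obtain K where K: "K \<in> T" "x \<in> K" using x by blast
  obtain c where c: "\<forall>z\<in>vertices K. 0 \<le> c z" "sum c (vertices K) = 1"
    "\<forall>u\<in>S1 T. u x = (\<Sum>z\<in>vertices K. c z * u z)"
    using barycentric[OF K] by blast
  have "u x = (\<Sum>z\<in>vertices K. c z *\<^sub>R u z)"
    using c(3) u by (auto simp: vec_eq_iff S1_vec_def)
  then have "norm (u x) \<le> (\<Sum>z\<in>vertices K. c z * norm (u z))"
    using c(1) by (auto intro!: sum_norm_le simp: abs_of_nonneg)
  moreover have "(\<Sum>z\<in>vertices K. c z * norm (u z))\<^sup>2 \<le> (\<Sum>z\<in>vertices K. c z * (norm (u z))\<^sup>2)"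
  proof -
    \<comment> \<open>\<open>s\<close> is the weighted mean of the vertex lengths; nonnegativity of
      the weighted variance about \<open>s\<close> is the claim.\<close>
    define s where "s = (\<Sum>z\<in>vertices K. c z * norm (u z))"
    have "0 \<le> (\<Sum>z\<in>vertices K. c z * (norm (u z) - s)\<^sup>2)"
      using c(1) by (intro sum_nonneg mult_nonneg_nonneg) auto
    also have "\<dots> = (\<Sum>z\<in>vertices K. c z * (norm (u z))\<^sup>2 + (- 2 * s) * (c z * norm (u z)) + s\<^sup>2 * c z)"
      by (intro sum.cong) (auto simp: power2_eq_square algebra_simps)
    also have "\<dots> = (\<Sum>z\<in>vertices K. c z * (norm (u z))\<^sup>2) + (- 2 * s) * s + s\<^sup>2"
      using c(2) by (simp only: sum.distrib flip: sum_distrib_left s_def)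
    finally show ?thesis by (simp add: s_def power2_eq_square)
  qed
  moreover have "(\<Sum>z\<in>vertices K. c z * (norm (u z))\<^sup>2) = nodal_interpolant T (\<lambda>y. (norm (u y))\<^sup>2) x"
    using vertices_nodes[OF K(1)] c(3)[rule_format, OF nodal_interpolant_S1[of "\<lambda>y. (norm (u y))\<^sup>2"]]
    by (auto simp: nodal_interpolant_node subset_iff intro!: sum.cong)
  ultimately show ?thesis
    using power_mono[of "norm (u x)" _ 2] by fastforce
qed

text \<open>A Lipschitz domain lies on one side of its boundary, so it has no slits.\<close>

lemma interior_closure_\<Omega>: "interior (closure \<Omega>) \<subseteq> \<Omega>"
proof
  fix p assume p: "p \<in> interior (closure \<Omega>)"
  show "p \<in> \<Omega>"
  proof (rule ccontr)
    assume np: "p \<notin> \<Omega>"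
    then have "p \<in> frontier \<Omega>"
      using p open_\<Omega> interior_subset by (auto simp: frontier_def interior_open)
    then obtain n r L \<gamma> where n: "norm n = 1" "r > 0" "L-lipschitz_on {y. y \<bullet> n = 0} \<gamma>"
      "\<Omega> \<inter> ball p r = {x \<in> ball p r. x \<bullet> n < \<gamma> (x - (x \<bullet> n) *\<^sub>R n)}"
      using domain unfolding lipschitz_polyhedral_domain_def lipschitz_boundary_def by blast
    have nn: "n \<bullet> n = 1" using n(1) by (simp add: norm_eq_1)
    \<comment> \<open>The strict supergraph inside the ball. It is open and misses the domain, hence
      also its closure; yet a short move from \<open>p\<close> along \<open>n\<close> enters it
      without leaving the closure.\<close>
    define V where "V = ball p r \<inter> {x. \<gamma> (x - (x \<bullet> n) *\<^sub>R n) < x \<bullet> n}"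
    have "continuous_on {y. y \<bullet> n = 0} \<gamma>" using n(3) by (rule lipschitz_on_continuous_on)
    then have "continuous_on UNIV (\<lambda>x. \<gamma> (x - (x \<bullet> n) *\<^sub>R n))"
      by (rule continuous_on_compose2) (auto intro!: continuous_intros simp: inner_diff_left nn)
    then have "open V"
      unfolding V_def by (intro open_Int open_ball open_Collect_less continuous_intros)
    moreover have "V \<inter> \<Omega> = {}"
    proof -
      have "x \<in> \<Omega> \<inter> ball p r \<longleftrightarrow> x \<in> ball p r \<and> x \<bullet> n < \<gamma> (x - (x \<bullet> n) *\<^sub>R n)" for x
        unfolding n(4) by simp
      then have "\<not> \<gamma> (x - (x \<bullet> n) *\<^sub>R n) < x \<bullet> n" if "x \<in> \<Omega>" "x \<in> ball p r" for x
        using that by (meson IntI order.asym)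
      then show ?thesis unfolding V_def by blast
    qed
    ultimately have V: "V \<inter> closure \<Omega> = {}"
      using open_Int_closure_eq_empty by blast
    obtain e where e: "e > 0" "ball p e \<subseteq> closure \<Omega>"
      using p by (meson mem_interior)
    define s where "s = min e r / 2"
    have s: "s > 0" "s < e" "s < r" using e(1) n(2) by (auto simp: s_def)
    have "\<gamma> (p - (p \<bullet> n) *\<^sub>R n) \<le> p \<bullet> n"
      using np n(2,4) by (auto simp: set_eq_iff not_less dest!: spec[of _ p])
    then have "p + s *\<^sub>R n \<in> V"
      using s n(1) by (auto simp: V_def dist_norm inner_add_left nn algebra_simps)
    moreover have "p + s *\<^sub>R n \<in> closure \<Omega>"
      using s n(1) by (intro subsetD[OF e(2)]) (simp add: dist_norm)
    ultimately show False using V by blast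
  qed
qed

section \<open>Elements and their overlaps up to null sets\<close>

lemma interior_T: "K \<in> T \<Longrightarrow> interior K \<subseteq> \<Omega>"
  using interior_mono[of K "closure \<Omega>"] interior_closure_\<Omega> Union_T by blast

text \<open>The intersection is a face of both three-dimensional elements. If they are distinct, it
  is a proper face of at least one of them, so its dimension drops.\<close>

lemma negligible_overlap:
  assumes "K \<in> T" "K' \<in> T" "K \<noteq> K'"
  shows "negligible (K \<inter> K')"
proof -
  have face: "(K \<inter> K') face_of K" "(K \<inter> K') face_of K'"
    using face_T[OF assms(1,2)] face_T[OF assms(2,1)] by (simp_all add: Int_commute)
  have dim: "aff_dim K = 3" "aff_dim K' = 3"
    using assms simplex_T aff_dim_simplex by blast+
  have "aff_dim (K \<inter> K') < 3"
    using face_of_aff_dim_lt[OF convex_T[OF assms(1)] face(1)]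
      face_of_aff_dim_lt[OF convex_T[OF assms(2)] face(2)] dim assms(3) by auto
  then have "interior (K \<inter> K') = {}"
    by (intro low_dim_interior) simp
  then show ?thesis
    using assms convex_T by (subst negligible_convex_interior) (auto intro: convex_Int)
qed

lemma interior_disjoint:
  assumes "K \<in> T" "K' \<in> T" "K \<noteq> K'"
  shows "interior K \<inter> interior K' = {}"
proof -
  have "negligible (interior K \<inter> interior K')"
    using negligible_overlap[OF assms] interior_subset by (meson Int_mono negligible_subset)
  then show ?thesis
    using open_not_negligible[of "interior K \<inter> interior K'"] by blast
qed

text \<open>Frontiers of convex sets are null sets. Pointwise claims up to null sets can therefore
  be checked in the interior of a single element.\<close>

lemma AE_interior: "AE x in lebesgue_on \<Omega>. \<exists>K\<in>T. x \<in> interior K"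
proof -
  have "negligible (\<Union>(frontier ` T))"
    using finite_T convex_T negligible_convex_frontier by blast
  then have "AE x in lebesgue. x \<notin> \<Union>(frontier ` T)"
    by (intro AE_not_in) (simp add: negligible_iff_null_sets)
  moreover have "\<exists>K\<in>T. x \<in> interior K" if x: "x \<in> \<Omega>" "x \<notin> \<Union>(frontier ` T)" for x
  proof -
    obtain K where K: "K \<in> T" "x \<in> K" using x(1) \<Omega>_subset by blast
    then show ?thesis using x(2) compact_T[OF K(1)]
      by (auto simp: frontier_def compact_imp_closed closure_closed)
  qed
  ultimately show ?thesis
    by (subst AE_restrict_space_iff) (use sets_\<Omega> in auto)
qed

end

section \<open>Mass lumping\<close>

lemma continuous_compact_integrable:
  fixes f :: "real^3 \<Rightarrow> 'b::euclidean_space"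
  assumes K: "compact K" and f: "continuous_on K f" and S: "S \<subseteq> K" "S \<in> sets lebesgue"
  shows "integrable (lebesgue_on S) f"
proof -
  have "bounded S" using K S compact_imp_bounded bounded_subset by blast
  then have lm: "S \<in> lmeasurable" using S(2) by (simp add: bounded_set_imp_lmeasurable)
  interpret finite_measure "lebesgue_on S" by (rule finite_measure_lebesgue_on[OF lm])
  have "bounded (f ` K)" using K f by (intro compact_imp_bounded compact_continuous_image)
  then obtain B where B: "\<And>x. x \<in> K \<Longrightarrow> norm (f x) \<le> B" by (auto simp: bounded_iff)
  show ?thesis
  proof (rule integrable_const_bound[where B=B])
    show "AE x in lebesgue_on S. norm (f x) \<le> B" using B S by (intro AE_I2) auto
    show "f \<in> borel_measurable (lebesgue_on S)"
      using f S by (intro continuous_imp_measurable_on_sets_lebesgue) (auto intro: continuous_on_subset)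
  qed
qed

lemma lborel_integral_affine:
  fixes g :: "real^3 \<Rightarrow> real"
  assumes c: "c \<noteq> 0" and g: "g \<in> borel_measurable borel"
  shows "integral\<^sup>L lborel g = \<bar>c\<bar> ^ 3 * integral\<^sup>L lborel (\<lambda>x. g (t + c *\<^sub>R x))"
proof -
  have m: "(\<lambda>x. t + c *\<^sub>R x) \<in> measurable lborel (borel :: (real^3) measure)" by simp
  have "integral\<^sup>L lborel g = integral\<^sup>L (density (distr lborel borel (\<lambda>x. t + c *\<^sub>R x)) (\<lambda>_. \<bar>c\<bar> ^ DIM(real^3))) g"
    using lborel_affine[OF c, of t] by simp
  also have "\<dots> = integral\<^sup>L (distr lborel borel (\<lambda>x. t + c *\<^sub>R x)) (\<lambda>x. \<bar>c\<bar> ^ DIM(real^3) *\<^sub>R g x)"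
    using g by (intro integral_density) auto
  also have "\<dots> = integral\<^sup>L lborel (\<lambda>x. \<bar>c\<bar> ^ DIM(real^3) *\<^sub>R g (t + c *\<^sub>R x))"
    using g by (intro integral_distr m) auto
  finally show ?thesis by simp
qed

text \<open>Integrals over elements are taken in the completed measure, whereas the affine change of
  variables is stated for \<open>lborel\<close>; this passes from one to the other.\<close>

lemma lebesgue_on_closed_integral:
  fixes g :: "real^3 \<Rightarrow> real"
  assumes K: "closed K" and g: "continuous_on K g"
  shows "(LINT x|lebesgue_on K. g x) = (LINT x|lborel. indicator K x * g x)"
proof -
  have "K \<in> sets borel" using K by simp
  then have b: "(\<lambda>x. indicator K x *\<^sub>R g x) \<in> borel_measurable borel"
    using g by (rule borel_measurable_continuous_on_indicator)
  have "(LINT x|lebesgue_on K. g x) = (LINT x|lebesgue. indicator K x *\<^sub>R g x)"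
    using K by (intro integral_restrict_space) simp
  also have "\<dots> = (LINT x|lborel. indicator K x *\<^sub>R g x)"
    using b by (intro integral_completion) simp
  finally show ?thesis by simp
qed

text \<open>For an affine function \<open>f z = 2 * f ((z + y) / 2) - f y\<close>. Averaging over \<open>y\<close> bounds the value
  at \<open>z\<close> by integrals over the body and over its image under the homothety with centre \<open>z\<close> and
  ratio \<open>1 / 2\<close>.\<close>

lemma vertex_value_bound:
  fixes f :: "real^3 \<Rightarrow> real^3"
  assumes K: "compact K" "convex K" "z \<in> K" and f: "continuous_on K f"
    and affine: "\<And>y. y \<in> K \<Longrightarrow> f z = 2 *\<^sub>R f ((1/2) *\<^sub>R z + (1/2) *\<^sub>R y) - f y"
  shows "measure lebesgue K * (norm (f z))\<^sup>2 \<le> 66 * (LINT x|lebesgue_on K. (norm (f x))\<^sup>2)"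
proof -
  define h where "h = (\<lambda>y. (1/2) *\<^sub>R z + (1/2) *\<^sub>R y)"
  define K' where "K' = h ` K"
  have hK: "h y \<in> K" if "y \<in> K" for y
    unfolding h_def using K that by (intro convexD) auto
  then have K'K: "K' \<subseteq> K" by (auto simp: K'_def)
  have inj: "h x = h y \<Longrightarrow> x = y" for x y by (simp add: h_def)
  have cK': "compact K'" unfolding K'_def h_def using K
    by (intro compact_continuous_image continuous_intros)
  define F where "F = (\<lambda>x. (norm (f x))\<^sup>2)"
  have F: "continuous_on K F" unfolding F_def using f by (intro continuous_intros)
  have Fh: "continuous_on K (\<lambda>y. F (h y))"
    using hK by (intro continuous_on_compose2[OF F]) (auto simp: h_def intro!: continuous_intros)
  have pt: "F z \<le> 8 * F (h y) + 2 * F y" if y: "y \<in> K" for y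
  proof -
    have "norm (f z) \<le> 2 * norm (f (h y)) + norm (f y)"
      using norm_triangle_ineq4[of "2 *\<^sub>R f (h y)" "f y"] affine[OF y] by (simp add: h_def)
    then have "F z \<le> (2 * norm (f (h y)) + norm (f y))\<^sup>2"
      unfolding F_def by (rule power_mono) simp
    \<comment> \<open>The difference of the two sides is the square of
      \<open>2 * norm (f (h y)) - norm (f y)\<close>.\<close>
    also have "\<dots> \<le> 8 * F (h y) + 2 * F y"
      using zero_le_power2[of "2 * norm (f (h y)) - norm (f y)"]
      by (simp add: F_def power2_eq_square algebra_simps)
    finally show ?thesis .
  qed
  have lmK: "K \<in> lmeasurable" "K \<in> sets lebesgue" using K lmeasurable_compact by blast+
  have iF: "integrable (lebesgue_on K) F" and iFh: "integrable (lebesgue_on K) (\<lambda>y. F (h y))"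
    using K F Fh lmK by (auto intro: continuous_compact_integrable)
  interpret finite_measure "lebesgue_on K" by (rule finite_measure_lebesgue_on[OF lmK(1)])
  have "measure lebesgue K * F z = (LINT y|lebesgue_on K. F z)"
    using lmK by (simp add: measure_restrict_space)
  also have "\<dots> \<le> (LINT y|lebesgue_on K. 8 * F (h y) + 2 * F y)"
    using iF iFh pt by (intro integral_mono) auto
  also have "\<dots> = 8 * (LINT y|lebesgue_on K. F (h y)) + 2 * (LINT y|lebesgue_on K. F y)"
    using iF iFh by simp
  \<comment> \<open>The homothety divides volumes by \<open>2 ^ 3\<close>, which produces a second
    factor 8; with the pointwise factors the total is \<open>8 * 8 + 2 = 66\<close>.\<close>
  also have "(LINT y|lebesgue_on K. F (h y)) = 8 * (LINT y|lebesgue_on K'. F y)"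
  proof -
    have b: "(\<lambda>x. indicator K' x * F x) \<in> borel_measurable borel"
      using borel_measurable_continuous_on_indicator[of K' F] cK' continuous_on_subset[OF F K'K]
      by (simp add: compact_imp_closed)
    have "(LINT y|lebesgue_on K'. F y) = (LINT x|lborel. indicator K' x * F x)"
      using cK' continuous_on_subset[OF F K'K] by (intro lebesgue_on_closed_integral compact_imp_closed)
    also have "\<dots> = \<bar>1/2\<bar> ^ 3 * (LINT y|lborel. indicator K' (h y) * F (h y))"
      unfolding h_def by (rule lborel_integral_affine[OF _ b]) simp
    also have "(\<lambda>y. indicator K' (h y) * F (h y)) = (\<lambda>y. indicator K y * F (h y))"
    proof
      fix y
      have "h y \<in> K' \<longleftrightarrow> y \<in> K" using inj by (auto simp: K'_def)
      then show "indicator K' (h y) * F (h y) = indicator K y * F (h y)" by (simp add: indicator_def)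
    qed
    also have "(LINT y|lborel. indicator K y * F (h y)) = (LINT y|lebesgue_on K. F (h y))"
      using K Fh by (intro lebesgue_on_closed_integral[symmetric] compact_imp_closed)
    finally show ?thesis by (simp add: power3_eq_cube)
  qed
  also have "(LINT y|lebesgue_on K'. F y) \<le> (LINT y|lebesgue_on K. F y)"
    using iF K'K cK' lmK by (intro integral_mono_lebesgue_on_AE) (auto simp: F_def compact_imp_closed)
  finally show ?thesis by (simp add: F_def)
qed

context mesh
begin

text \<open>Overlaps of elements are null sets, and the union of the elements, being the closure,
  exceeds the domain by a null set only.\<close>

lemma integral_mesh:
  fixes f :: "real^3 \<Rightarrow> real"
  assumes f: "continuous_on (\<Union>T) f"
  shows "(LINT x|lebesgue_on \<Omega>. f x) = (\<Sum>K\<in>T. LINT x|lebesgue_on K. f x)"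
proof -
  have i\<Omega>: "integrable (lebesgue_on \<Omega>) f"
    by (rule continuous_compact_integrable[OF compact_Union_T f \<Omega>_subset sets_\<Omega>])
  have "(f has_integral (LINT x|lebesgue_on K. f x)) K" if K: "K \<in> T" for K
  proof (rule has_integral_integral_lebesgue_on)
    show s: "K \<in> sets lebesgue" using compact_T[OF K] by (simp add: compact_imp_closed)
    show "integrable (lebesgue_on K) f"
      using K by (intro continuous_compact_integrable[OF compact_Union_T f _ s]) auto
  qed
  then have "(f has_integral (\<Sum>K\<in>T. LINT x|lebesgue_on K. f x)) (\<Union>T)"
    using negligible_overlap by (intro has_integral_Union finite_T) (auto simp: pairwise_def)
  moreover have "(f has_integral y) \<Omega> \<longleftrightarrow> (f has_integral y) (\<Union>T)" for y
  proof (rule has_integral_spike_set_eq)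
    show "negligible {x \<in> \<Omega> - \<Union>T. f x \<noteq> 0}"
      using \<Omega>_subset by (auto intro: negligible_subset[OF negligible_empty])
    have "negligible (\<Union>(frontier ` T))"
      using finite_T convex_T negligible_convex_frontier by blast
    \<comment> \<open>Interiors of elements lie in the domain, so a point of an element outside the
      domain lies on the frontier of that element.\<close>
    moreover have "\<Union>T - \<Omega> \<subseteq> \<Union>(frontier ` T)"
      using interior_T compact_T by (force simp: frontier_def compact_imp_closed)
    ultimately show "negligible {x \<in> \<Union>T - \<Omega>. f x \<noteq> 0}"
      by (rule negligible_subset[OF negligible_subset]) auto
  qed
  ultimately have "(f has_integral (\<Sum>K\<in>T. LINT x|lebesgue_on K. f x)) \<Omega>" by simp
  moreover have "(f has_integral (LINT x|lebesgue_on \<Omega>. f x)) \<Omega>"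
    by (rule has_integral_integral_lebesgue_on[OF i\<Omega> sets_\<Omega>])
  ultimately show ?thesis using has_integral_unique by blast
qed

lemma S1_vec_affine:
  assumes u: "u \<in> S1_vec T" and K: "K \<in> T"
  shows "\<exists>A b. linear A \<and> (\<forall>x\<in>K. u x = A x + (b::real^3))"
proof -
  have "\<forall>i. \<exists>ab. \<forall>x\<in>K. u x $ i = fst ab \<bullet> x + snd ab"
  proof
    fix i
    have "(\<lambda>x. u x $ i) \<in> S1 T" using u by (simp add: S1_vec_def)
    from S1_affine[OF this K] obtain a b where "\<forall>x\<in>K. u x $ i = a \<bullet> x + b" by blast
    then show "\<exists>ab. \<forall>x\<in>K. u x $ i = fst ab \<bullet> x + snd ab" by (intro exI[of _ "(a, b)"]) simp
  qed
  from choice[OF this] obtain ab where ab: "\<forall>i. \<forall>x\<in>K. u x $ i = fst (ab i) \<bullet> x + snd (ab i)"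
    by blast
  have "linear (\<lambda>x. \<chi> i. fst (ab i) \<bullet> x)"
    by (rule linearI) (simp_all add: vec_eq_iff inner_add_right)
  moreover have "\<forall>x\<in>K. u x = (\<chi> i. fst (ab i) \<bullet> x) + (\<chi> i. snd (ab i))"
    using ab by (simp add: vec_eq_iff)
  ultimately show ?thesis by blast
qed

text \<open>Vertex quadrature of the squared norm, known as mass lumping. Only nodal values enter,
  so orthogonality at the nodes yields an exact Pythagoras identity, which the \<open>L2\<close>
  norm would not provide.\<close>

definition lumped :: "(real^3 \<Rightarrow> real^3) \<Rightarrow> real" where
  "lumped u = (LINT x|lebesgue_on \<Omega>. nodal_interpolant T (\<lambda>y. (norm (u y))\<^sup>2) x)"

lemma S1_continuous: "u \<in> S1 T \<Longrightarrow> continuous_on (\<Union>T) u"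
  by (simp add: S1_def)

lemma S1_integrable: "u \<in> S1 T \<Longrightarrow> integrable (lebesgue_on \<Omega>) u"
  by (intro continuous_compact_integrable[OF compact_Union_T _ \<Omega>_subset sets_\<Omega>] S1_continuous)

lemma S1_vec_L2:
  assumes "u \<in> S1_vec T"
  shows "u \<in> L2 \<Omega>"
proof -
  have c: "continuous_on (\<Union>T) u" by (rule S1_vec_continuous[OF assms])
  have "integrable (lebesgue_on \<Omega>) (\<lambda>x. (norm (u x))\<^sup>2)"
    using c by (intro continuous_compact_integrable[OF compact_Union_T _ \<Omega>_subset sets_\<Omega>] continuous_intros)
  moreover have "u \<in> borel_measurable (lebesgue_on \<Omega>)"
    using continuous_on_subset[OF c \<Omega>_subset] sets_\<Omega> by (rule continuous_imp_measurable_on_sets_lebesgue)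
  ultimately show ?thesis by (simp add: L2_def)
qed

lemma L2_norm_power2_integral: "(L2_norm \<Omega> u)\<^sup>2 = (LINT x|lebesgue_on \<Omega>. (norm (u x))\<^sup>2)"
  by (simp add: L2_norm_power2 L2_inner_def power2_norm_eq_inner)

lemma L2_norm_le_lumped:
  assumes "u \<in> S1_vec T"
  shows "(L2_norm \<Omega> u)\<^sup>2 \<le> lumped u"
  unfolding L2_norm_power2_integral lumped_def
proof (rule integral_mono)
  show "integrable (lebesgue_on \<Omega>) (\<lambda>x. (norm (u x))\<^sup>2)"
    using S1_vec_L2[OF assms] by (simp add: L2_def)
  show "integrable (lebesgue_on \<Omega>) (nodal_interpolant T (\<lambda>y. (norm (u y))\<^sup>2))"
    by (rule S1_integrable[OF nodal_interpolant_S1])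
  show "(norm (u x))\<^sup>2 \<le> nodal_interpolant T (\<lambda>y. (norm (u y))\<^sup>2) x"
    if "x \<in> space (lebesgue_on \<Omega>)" for x
    using that \<Omega>_subset by (intro S1_vec_norm_le_interpolant[OF assms]) auto
qed

text \<open>On an element the interpolant stays below the largest vertex value, which
  \<open>vertex_value_bound\<close> controls by the integral over the element. The elementwise
  bounds add up through \<open>integral_mesh\<close>.\<close>

lemma lumped_le_L2_norm:
  assumes u: "u \<in> S1_vec T"
  shows "lumped u \<le> 66 * (L2_norm \<Omega> u)\<^sup>2"
proof -
  let ?I = "nodal_interpolant T (\<lambda>y. (norm (u y))\<^sup>2)"
  have c: "continuous_on (\<Union>T) u" by (rule S1_vec_continuous[OF u])
  have "(LINT x|lebesgue_on K. ?I x) \<le> 66 * (LINT x|lebesgue_on K. (norm (u x))\<^sup>2)" if K: "K \<in> T" for K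
  proof -
    have lm: "K \<in> lmeasurable" "K \<in> sets lebesgue" using compact_T[OF K] lmeasurable_compact by blast+
    interpret finite_measure "lebesgue_on K" by (rule finite_measure_lebesgue_on[OF lm(1)])
    \<comment> \<open>Selects a vertex \<open>z\<close> of the element at which \<open>u\<close> is
      longest among the vertices.\<close>
    have "Max ((\<lambda>z. (norm (u z))\<^sup>2) ` vertices K) \<in> (\<lambda>z. (norm (u z))\<^sup>2) ` vertices K"
      using vertices_T[OF K] by (intro Max_in) auto
    then obtain z where z: "z \<in> vertices K" "Max ((\<lambda>z. (norm (u z))\<^sup>2) ` vertices K) = (norm (u z))\<^sup>2"
      by blast
    have max: "(norm (u y))\<^sup>2 \<le> (norm (u z))\<^sup>2" if "y \<in> vertices K" for y
      using that vertices_T(1)[OF K] unfolding z(2)[symmetric] by (intro Max_ge) auto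
    obtain A b where A: "linear A" "\<forall>x\<in>K. u x = A x + b"
      using S1_vec_affine[OF u K] by blast
    have zK: "z \<in> K" using z vertices_T(5)[OF K] by blast
    have "(LINT x|lebesgue_on K. ?I x) \<le> (LINT x|lebesgue_on K. (norm (u z))\<^sup>2)"
    proof (rule integral_mono)
      show "integrable (lebesgue_on K) ?I"
        using K S1_continuous[OF nodal_interpolant_S1] lm
        by (intro continuous_compact_integrable[OF compact_Union_T]) auto
      show "?I x \<le> (norm (u z))\<^sup>2" if "x \<in> space (lebesgue_on K)" for x
        using that by (intro nodal_interpolant_le_vertices[OF K] max) auto
    qed simp
    also have "\<dots> = measure lebesgue K * (norm (u z))\<^sup>2"
      using lm by (simp add: measure_restrict_space)
    also have "\<dots> \<le> 66 * (LINT x|lebesgue_on K. (norm (u x))\<^sup>2)"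
    proof (rule vertex_value_bound[OF compact_T[OF K] convex_T[OF K] zK])
      show "continuous_on K u" using c K by (auto intro: continuous_on_subset)
      fix y assume y: "y \<in> K"
      have "(1/2) *\<^sub>R z + (1/2) *\<^sub>R y \<in> K"
        using convex_T[OF K] zK y by (intro convexD) auto
      then have "u ((1/2) *\<^sub>R z + (1/2) *\<^sub>R y) = (1/2) *\<^sub>R A z + (1/2) *\<^sub>R A y + b"
        using A(2) by (simp add: linear_add[OF A(1)] linear_cmul[OF A(1)])
      then show "u z = 2 *\<^sub>R u ((1/2) *\<^sub>R z + (1/2) *\<^sub>R y) - u y"
        using A(2) zK y by (simp add: algebra_simps) (simp add: scaleR_2)
    qed
    finally show ?thesis .
  qed
  then have "(\<Sum>K\<in>T. LINT x|lebesgue_on K. ?I x) \<le> (\<Sum>K\<in>T. 66 * (LINT x|lebesgue_on K. (norm (u x))\<^sup>2))"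
    by (rule sum_mono)
  also have "\<dots> = 66 * (\<Sum>K\<in>T. LINT x|lebesgue_on K. (norm (u x))\<^sup>2)"
    by (simp add: sum_distrib_left)
  also have "(\<Sum>K\<in>T. LINT x|lebesgue_on K. (norm (u x))\<^sup>2) = (LINT x|lebesgue_on \<Omega>. (norm (u x))\<^sup>2)"
    by (rule integral_mesh[symmetric]) (intro continuous_intros c)
  finally show ?thesis
    unfolding lumped_def L2_norm_power2_integral
    by (simp add: integral_mesh[OF S1_continuous[OF nodal_interpolant_S1]])
qed

lemma lumped_orthogonal_step:
  assumes "\<And>z. z \<in> nodes T \<Longrightarrow> u z \<bullet> v z = 0"
  shows "lumped (\<lambda>x. u x + c *\<^sub>R v x) = lumped u + c\<^sup>2 * lumped v"
proof -
  have "nodal_interpolant T (\<lambda>y. (norm (u y + c *\<^sub>R v y))\<^sup>2) =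
      nodal_interpolant T (\<lambda>y. (norm (u y))\<^sup>2 + c\<^sup>2 * (norm (v y))\<^sup>2)"
    using assms by (intro nodal_interpolant_cong)
      (simp add: power2_norm_eq_inner inner_add inner_commute power_mult_distrib power2_eq_square[of c])
  then show ?thesis
    using S1_integrable[OF nodal_interpolant_S1]
    by (simp add: lumped_def nodal_interpolant_lincomb)
qed

lemma lumped_unit:
  assumes "\<And>z. z \<in> nodes T \<Longrightarrow> norm (u z) = 1"
  shows "lumped u = measure lebesgue \<Omega>"
proof -
  have "nodal_interpolant T (\<lambda>y. (norm (u y))\<^sup>2) = nodal_interpolant T (\<lambda>_. 1)"
    using assms by (intro nodal_interpolant_cong) simp
  then have "lumped u = (LINT x|lebesgue_on \<Omega>. 1)"
    unfolding lumped_def using \<Omega>_subset by (intro Bochner_Integration.integral_cong) (auto simp: nodal_interpolant_1 subset_iff)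
  then show ?thesis
    using lmeasurable_\<Omega> by (simp add: measure_restrict_space sets_\<Omega>)
qed

text \<open>Interpolation preserves nonnegativity; applied to the squared length minus one, this
  removes the absolute value. The length error becomes the excess of the lumped norm over the
  volume.\<close>

lemma L1_norm_interpolant:
  assumes "\<And>z. z \<in> nodes T \<Longrightarrow> 1 \<le> norm (u z)"
  shows "L1_norm \<Omega> (\<lambda>x. nodal_interpolant T (\<lambda>y. (norm (u y))\<^sup>2) x - 1) = lumped u - measure lebesgue \<Omega>"
proof -
  let ?I = "nodal_interpolant T (\<lambda>y. (norm (u y))\<^sup>2)"
  interpret finite_measure "lebesgue_on \<Omega>" by (rule finite_measure_lebesgue_on[OF lmeasurable_\<Omega>])
  have "1 \<le> ?I x" if "x \<in> \<Omega>" for x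
  proof -
    have "0 \<le> nodal_interpolant T (\<lambda>y. (norm (u y))\<^sup>2 + (-1) * 1) x"
      using assms by (intro nodal_interpolant_nonneg) simp
    then show ?thesis
      unfolding nodal_interpolant_lincomb using nodal_interpolant_1[of x] that \<Omega>_subset by (simp add: subset_iff)
  qed
  then have "L1_norm \<Omega> (\<lambda>x. ?I x - 1) = (LINT x|lebesgue_on \<Omega>. ?I x - 1)"
    unfolding L1_norm_def by (intro Bochner_Integration.integral_cong) auto
  also have "\<dots> = lumped u - measure lebesgue \<Omega>"
    using S1_integrable[OF nodal_interpolant_S1] lmeasurable_\<Omega>
    by (simp add: lumped_def measure_restrict_space sets_\<Omega>)
  finally show ?thesis .
qed

end

section \<open>Finite element functions are weakly differentiable\<close>

lemma integrable_bounded_compact_support: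
  fixes f :: "real^3 \<Rightarrow> real"
  assumes "compact A" "f \<in> borel_measurable borel" "\<And>x. \<bar>f x\<bar> \<le> B" "\<And>x. x \<notin> A \<Longrightarrow> f x = 0"
  shows "integrable lborel f"
proof (rule integrableI_bounded_set[where A=A and B=B])
  show "A \<in> sets lborel" using assms(1) by (simp add: compact_imp_closed)
  show "emeasure lborel A < \<infinity>"
    by (intro emeasure_bounded_finite compact_imp_bounded assms)
qed (use assms in auto)

context mesh
begin

lemma S1_borel_measurable: "u \<in> S1 T \<Longrightarrow> u \<in> borel_measurable borel"
proof -
  assume u: "u \<in> S1 T"
  have "(\<lambda>x. indicator (\<Union>T) x *\<^sub>R u x) \<in> borel_measurable borel"
    using compact_Union_T S1_continuous[OF u]
    by (intro borel_measurable_continuous_on_indicator) (auto simp: compact_imp_closed)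
  also have "(\<lambda>x. indicator (\<Union>T) x *\<^sub>R u x) = u"
    using u by (auto simp: S1_def indicator_def fun_eq_iff)
  finally show ?thesis .
qed

lemma S1_bounded:
  assumes "u \<in> S1 T"
  obtains B where "\<And>x. \<bar>u x\<bar> \<le> B"
proof -
  have "bounded (u ` \<Union>T)"
    by (intro compact_imp_bounded compact_continuous_image S1_continuous assms compact_Union_T)
  then obtain B where B: "\<And>x. x \<in> \<Union>T \<Longrightarrow> \<bar>u x\<bar> \<le> B" by (auto simp: bounded_iff)
  have "\<bar>u x\<bar> \<le> max B 0" for x
    using B[of x] assms by (cases "x \<in> \<Union>T") (auto simp: S1_def)
  then show ?thesis by (rule that)
qed

section \<open>The piecewise gradient\<close>

definition slope :: "(real^3 \<Rightarrow> real) \<Rightarrow> (real^3) set \<Rightarrow> real^3" where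
  "slope u K = (SOME a. \<exists>b. \<forall>x\<in>K. u x = a \<bullet> x + b)"

text \<open>At most one summand is nonzero, as interiors of distinct elements are disjoint. Points
  of the domain in no such interior form a null set. The form as a sum of indicators makes Borel
  measurability and boundedness immediate.\<close>

definition pw_gradient :: "(real^3 \<Rightarrow> real) \<Rightarrow> real^3 \<Rightarrow> real^3" where
  "pw_gradient u x = (\<Sum>K\<in>T. indicator (interior K) x *\<^sub>R slope u K)"

lemma slope_diff:
  assumes "u \<in> S1 T" "K \<in> T" "x \<in> K" "y \<in> K"
  shows "u x - u y = slope u K \<bullet> (x - y)"
proof -
  have "\<exists>b. \<forall>x\<in>K. u x = slope u K \<bullet> x + b"
    unfolding slope_def by (rule someI_ex) (rule S1_affine[OF assms(1,2)])
  then show ?thesis using assms by (auto simp: inner_diff_right)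
qed

lemma pw_gradient_interior:
  assumes K: "K \<in> T" "x \<in> interior K"
  shows "pw_gradient u x = slope u K"
proof -
  have "pw_gradient u x = (\<Sum>K'\<in>T. if K' = K then slope u K else 0)"
    unfolding pw_gradient_def
    using interior_disjoint[OF K(1)] K by (intro sum.cong) (auto simp: indicator_def)
  then show ?thesis using finite_T K by simp
qed

lemma pw_gradient_measurable [measurable]: "pw_gradient u \<in> borel_measurable borel"
  unfolding pw_gradient_def by measurable

lemma pw_gradient_component_measurable [measurable]:
  "(\<lambda>x. pw_gradient u x $ j) \<in> borel_measurable borel"
proof -
  have "(\<lambda>x. pw_gradient u x \<bullet> axis j 1) \<in> borel_measurable borel" by measurable
  then show ?thesis by (simp add: inner_axis)
qed

definition slope_bound :: "(real^3 \<Rightarrow> real) \<Rightarrow> real" where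
  "slope_bound u = (\<Sum>K\<in>T. norm (slope u K))"

lemma slope_bound_nonneg: "0 \<le> slope_bound u"
  unfolding slope_bound_def by (intro sum_nonneg) simp

lemma norm_slope_le: "K \<in> T \<Longrightarrow> norm (slope u K) \<le> slope_bound u"
  unfolding slope_bound_def using finite_T by (intro member_le_sum) auto

lemma norm_pw_gradient_le: "norm (pw_gradient u x) \<le> slope_bound u"
  unfolding pw_gradient_def slope_bound_def
  by (intro order_trans[OF norm_sum] sum_mono) (auto simp: indicator_def)

text \<open>Pulled back to the parameter interval, the elements form a finite closed cover. A
  function that is Lipschitz with the same constant on each piece is Lipschitz on the interval. This
  controls difference quotients across element boundaries.\<close>

lemma S1_lipschitz_segment:
  assumes u: "u \<in> S1 T" and seg: "closed_segment x y \<subseteq> \<Union>T"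
  shows "\<bar>u y - u x\<bar> \<le> slope_bound u * norm (y - x)"
proof -
  define M where "M = slope_bound u * norm (y - x)"
  define g where "g = (\<lambda>t. x + t *\<^sub>R (y - x))"
  have "M-lipschitz_on {0..1} (\<lambda>t. u (g t))"
  proof (rule lipschitz_on_closed_Union[where I=T and U="\<lambda>K. g -` K"])
    fix K assume K: "K \<in> T"
    show "M-lipschitz_on (g -` K) (\<lambda>t. u (g t))"
    proof (rule lipschitz_onI)
      fix s t assume st: "s \<in> g -` K" "t \<in> g -` K"
      have "\<bar>u (g s) - u (g t)\<bar> = \<bar>slope u K \<bullet> (g s - g t)\<bar>"
        using st by (subst slope_diff[OF u K]) auto
      also have "\<dots> \<le> norm (slope u K) * norm (g s - g t)" by (rule Cauchy_Schwarz_ineq2)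
      also have "g s - g t = (s - t) *\<^sub>R (y - x)" by (simp add: g_def algebra_simps)
      also have "norm (slope u K) * norm ((s - t) *\<^sub>R (y - x)) \<le> slope_bound u * norm ((s - t) *\<^sub>R (y - x))"
        by (intro mult_right_mono norm_slope_le K) simp
      finally show "dist (u (g s)) (u (g t)) \<le> M * dist s t"
        by (simp add: M_def dist_real_def mult_ac)
    qed (simp add: M_def slope_bound_nonneg)
    show "closed (g -` K)"
      unfolding g_def using compact_T[OF K] by (intro continuous_closed_vimage) (auto simp: compact_imp_closed)
  next
    show "{0..1} \<subseteq> (\<Union>K\<in>T. g -` K)"
    proof
      fix t :: real assume "t \<in> {0..1}"
      then have "g t \<in> closed_segment x y"
        by (auto simp: g_def closed_segment_def algebra_simps intro!: exI[of _ t])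
      then show "t \<in> (\<Union>K\<in>T. g -` K)" using seg by blast
    qed
  qed (auto simp: finite_T M_def slope_bound_nonneg)
  then have "dist (u (g 1)) (u (g 0)) \<le> M * dist 1 (0::real)"
    by (rule lipschitz_onD) auto
  then show ?thesis by (simp add: g_def M_def dist_real_def)
qed

lemma AE_lborel_interior: "AE x in lborel. x \<in> \<Omega> \<longrightarrow> (\<exists>K\<in>T. x \<in> interior K)"
  using AE_interior sets_\<Omega> by (subst (asm) AE_restrict_space_iff) (auto simp: AE_completion_iff)

lemma lborel_integral_supported:
  fixes g :: "real^3 \<Rightarrow> real"
  assumes "g \<in> borel_measurable borel" "\<And>x. x \<notin> \<Omega> \<Longrightarrow> g x = 0"
  shows "(LINT x|lebesgue_on \<Omega>. g x) = (LINT x|lborel. g x)"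
proof -
  have "(LINT x|lebesgue_on \<Omega>. g x) = (LINT x|lebesgue. indicator \<Omega> x *\<^sub>R g x)"
    using sets_\<Omega> by (intro integral_restrict_space) simp
  also have "(\<lambda>x. indicator \<Omega> x *\<^sub>R g x) = g"
    using assms(2) by (auto simp: indicator_def fun_eq_iff)
  also have "integral\<^sup>L lebesgue g = (LINT x|lborel. g x)"
    using assms(1) by (intro integral_completion) simp
  finally show ?thesis .
qed

text \<open>Discrete integration by parts: translation invariance moves the difference quotient from the
  test function to \<open>u\<close>, and both sides converge by dominated convergence. The Lipschitz bound for
  \<open>u\<close> along segments in \<open>\<Omega>\<close> provides the majorant.\<close>

lemma pw_gradient_weak:
  assumes u: "u \<in> S1 T" and \<phi>: "\<phi> \<in> test_functions \<Omega>"
  shows "(LINT x|lebesgue_on \<Omega>. u x * frechet_derivative \<phi> (at x) (axis j 1)) =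
    - (LINT x|lebesgue_on \<Omega>. pw_gradient u x $ j * \<phi> x)"
proof -
  let ?S = "closure {x. \<phi> x \<noteq> 0}"
  define e :: "real^3" where "e = axis j 1"
  have e: "norm e = 1" by (simp add: e_def)
  obtain D BD where D: "\<And>x. (\<phi> has_derivative (\<lambda>w. \<Sum>j\<in>UNIV. w $ j * D j x)) (at x)"
    "\<And>j. continuous_on UNIV (D j)" "\<And>x j. x \<notin> ?S \<Longrightarrow> D j x = 0"
    "\<And>x j. \<bar>D j x\<bar> \<le> BD" "\<And>x j. frechet_derivative \<phi> (at x) (axis j 1) = D j x"
    by (rule test_function_partials[OF \<phi>], rule that, assumption+)
  obtain B\<phi> where c\<phi>: "continuous_on UNIV \<phi>" and B\<phi>: "\<And>x. \<bar>\<phi> x\<bar> \<le> B\<phi>"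
    by (rule test_function_bounded[OF \<phi>], rule that, assumption+)
  obtain Bu where Bu: "\<And>x. \<bar>u x\<bar> \<le> Bu" using S1_bounded[OF u] by blast
  have S: "compact ?S" "?S \<subseteq> \<Omega>" using \<phi> by (auto simp: test_functions_def)
  have \<phi>S: "\<phi> x = 0" if "x \<notin> ?S" for x using that closure_subset[of "{x. \<phi> x \<noteq> 0}"] by blast
  have [measurable]: "u \<in> borel_measurable borel" by (rule S1_borel_measurable[OF u])
  have [measurable]: "\<phi> \<in> borel_measurable borel" "D i \<in> borel_measurable borel" for i
    using c\<phi> D(2) by (auto intro: borel_measurable_continuous_onI)
  have u0: "u x = 0" if "x \<notin> \<Union>T" for x using u that by (simp add: S1_def)
  have Bprod: "\<bar>a * b\<bar> \<le> A * B" if "\<bar>a\<bar> \<le> A" "\<bar>b\<bar> \<le> B" for a b A B :: real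
    using mult_mono[OF that] that by (simp add: abs_mult)
  have int_shift: "integrable lborel (\<lambda>x. u x * \<phi> (x + s *\<^sub>R e))" for s
  proof (rule integrable_bounded_compact_support[OF compact_Union_T, where B="Bu * B\<phi>"])
    show "\<bar>u x * \<phi> (x + s *\<^sub>R e)\<bar> \<le> Bu * B\<phi>" for x by (intro Bprod Bu B\<phi>)
  qed (auto simp: u0)
  have int_shift': "integrable lborel (\<lambda>x. u (x - s *\<^sub>R e) * \<phi> x)" for s
  proof (rule integrable_bounded_compact_support[OF S(1), where B="Bu * B\<phi>"])
    show "\<bar>u (x - s *\<^sub>R e) * \<phi> x\<bar> \<le> Bu * B\<phi>" for x by (intro Bprod Bu B\<phi>)
    show "u (x - s *\<^sub>R e) * \<phi> x = 0" if "x \<notin> ?S" for x using \<phi>S[OF that] by simp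
  qed measurable
  \<comment> \<open>Translations by less than \<open>\<delta>\<close> keep the segment starting at a
    point of the support inside the domain, where the Lipschitz bound for \<open>u\<close> is
    available.\<close>
  obtain \<delta> where \<delta>: "\<delta> > 0" "(\<Union>x\<in>?S. ball x \<delta>) \<subseteq> \<Omega>"
    by (rule compact_subset_open_imp_ball_epsilon_subset[OF S(1) open_\<Omega> S(2)], rule that, assumption+)
  define t where "t = (\<lambda>n. \<delta> / 2 * (1 / real (Suc n)))"
  have tpos: "t n > 0" for n using \<delta> by (simp add: t_def)
  have t\<delta>: "t n < \<delta>" for n
  proof -
    have "\<delta> / 2 * (1 / real (Suc n)) \<le> \<delta> / 2 * 1"
      using \<delta> by (intro mult_left_mono) auto
    also have "\<dots> < \<delta>" using \<delta> by simp
    finally show ?thesis by (simp only: t_def)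
  qed
  have "(\<lambda>n. \<delta> / 2 * (1 / real (Suc n))) \<longlonglongrightarrow> \<delta> / 2 * 0"
    by (intro tendsto_intros LIMSEQ_Suc[OF lim_1_over_n])
  then have t0: "t \<longlonglongrightarrow> 0" by (simp add: t_def)
  have AB: "(LINT x|lborel. u x * ((\<phi> (x + t n *\<^sub>R e) - \<phi> x) / t n)) =
      (LINT x|lborel. ((u (x - t n *\<^sub>R e) - u x) / t n) * \<phi> x)" for n
  proof -
    have "(LINT x|lborel. u (x - t n *\<^sub>R e) * \<phi> x) =
       (LINT x|lborel. u (t n *\<^sub>R e + 1 *\<^sub>R x - t n *\<^sub>R e) * \<phi> (t n *\<^sub>R e + 1 *\<^sub>R x))"
      by (subst lborel_integral_affine[of 1 _ "t n *\<^sub>R e"]) auto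
    then have eq: "(LINT x|lborel. u (x - t n *\<^sub>R e) * \<phi> x) = (LINT x|lborel. u x * \<phi> (x + t n *\<^sub>R e))"
      by (simp add: add.commute)
    \<comment> \<open>The unshifted term is written as a shift by zero, so that both integrands are
      instances of \<open>int_shift\<close>.\<close>
    have "(LINT x|lborel. u x * ((\<phi> (x + t n *\<^sub>R e) - \<phi> x) / t n)) =
       (LINT x|lborel. (u x * \<phi> (x + t n *\<^sub>R e) - u x * \<phi> (x + 0 *\<^sub>R e)) / t n)"
      by (simp add: right_diff_distrib)
    also have "\<dots> = ((LINT x|lborel. u x * \<phi> (x + t n *\<^sub>R e)) - (LINT x|lborel. u x * \<phi> (x + 0 *\<^sub>R e))) / t n"
      using int_shift by (simp del: scaleR_zero_left add_0_right)
    also have "\<dots> = ((LINT x|lborel. u (x - t n *\<^sub>R e) * \<phi> x) - (LINT x|lborel. u (x - 0 *\<^sub>R e) * \<phi> x)) / t n"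
      by (simp add: eq)
    also have "\<dots> = (LINT x|lborel. (u (x - t n *\<^sub>R e) * \<phi> x - u (x - 0 *\<^sub>R e) * \<phi> x) / t n)"
      using int_shift' by (simp del: scaleR_zero_left diff_0_right)
    also have "\<dots> = (LINT x|lborel. ((u (x - t n *\<^sub>R e) - u x) / t n) * \<phi> x)"
      by (simp add: left_diff_distrib)
    finally show ?thesis .
  qed
  have q: "((\<lambda>s. \<phi> (x + s *\<^sub>R e)) has_real_derivative D j (x + s *\<^sub>R e)) (at s)" for x s
  proof -
    have "((\<lambda>s. x + s *\<^sub>R e) has_derivative (\<lambda>h. h *\<^sub>R e)) (at s)"
      by (auto intro!: derivative_eq_intros)
    from has_derivative_compose[OF this D(1)]
    have "((\<lambda>s. \<phi> (x + s *\<^sub>R e)) has_derivative (\<lambda>h. \<Sum>i\<in>UNIV. (h *\<^sub>R e) $ i * D i (x + s *\<^sub>R e))) (at s)" .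
    also have "(\<lambda>h. \<Sum>i\<in>UNIV. (h *\<^sub>R e) $ i * D i (x + s *\<^sub>R e)) = (*) (D j (x + s *\<^sub>R e))"
    proof
      fix h
      have "(\<Sum>i\<in>UNIV. (h *\<^sub>R e) $ i * D i (x + s *\<^sub>R e)) = (\<Sum>i\<in>UNIV. if i = j then h * D j (x + s *\<^sub>R e) else 0)"
        by (intro sum.cong) (auto simp: e_def axis_def)
      then show "(\<Sum>i\<in>UNIV. (h *\<^sub>R e) $ i * D i (x + s *\<^sub>R e)) = D j (x + s *\<^sub>R e) * h" by simp
    qed
    finally show ?thesis by (simp add: has_field_derivative_def)
  qed
  have "(\<lambda>n. LINT x|lborel. u x * ((\<phi> (x + t n *\<^sub>R e) - \<phi> x) / t n)) \<longlonglongrightarrow> (LINT x|lborel. u x * D j x)"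
  proof (rule integral_dominated_convergence[where w="\<lambda>x. \<bar>u x\<bar> * BD"])
    show "integrable lborel (\<lambda>x. \<bar>u x\<bar> * BD)"
      by (intro integrable_mult_left integrable_abs
        integrable_bounded_compact_support[OF compact_Union_T, where B=Bu] Bu u0) measurable
    show "AE x in lborel. (\<lambda>n. u x * ((\<phi> (x + t n *\<^sub>R e) - \<phi> x) / t n)) \<longlonglongrightarrow> u x * D j x"
    proof (intro AE_I2 tendsto_mult tendsto_const)
      fix x
      have "((\<lambda>h. (\<phi> (x + (0 + h) *\<^sub>R e) - \<phi> (x + 0 *\<^sub>R e)) / h) \<longlongrightarrow> D j (x + 0 *\<^sub>R e)) (at 0)"
        using q[of x 0] unfolding DERIV_def .
      moreover have "filterlim t (at 0) sequentially"
        using t0 tpos by (auto simp: filterlim_at intro!: always_eventually less_imp_neq[symmetric])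
      ultimately have "(\<lambda>n. (\<phi> (x + (0 + t n) *\<^sub>R e) - \<phi> (x + 0 *\<^sub>R e)) / t n) \<longlonglongrightarrow> D j (x + 0 *\<^sub>R e)"
        by (rule filterlim_compose)
      then show "(\<lambda>n. (\<phi> (x + t n *\<^sub>R e) - \<phi> x) / t n) \<longlonglongrightarrow> D j x"
        by simp
    qed
    show "AE x in lborel. norm (u x * ((\<phi> (x + t n *\<^sub>R e) - \<phi> x) / t n)) \<le> \<bar>u x\<bar> * BD" for n
    proof (rule AE_I2)
      fix x
      \<comment> \<open>The mean value inequality along the line through \<open>x\<close> bounds the
        difference quotient by the bound \<open>BD\<close> for the partial derivatives.\<close>
      have "norm (\<phi> (x + t n *\<^sub>R e) - \<phi> (x + 0 *\<^sub>R e)) \<le> BD * norm (t n - 0)"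
        by (rule field_differentiable_bound[OF convex_UNIV, where f="\<lambda>s. \<phi> (x + s *\<^sub>R e)"
              and f'="\<lambda>s. D j (x + s *\<^sub>R e)"]) (auto simp: D(4) intro: q)
      then have "\<bar>(\<phi> (x + t n *\<^sub>R e) - \<phi> x) / t n\<bar> \<le> BD"
        using tpos[of n] by (simp add: field_simps)
      then show "norm (u x * ((\<phi> (x + t n *\<^sub>R e) - \<phi> x) / t n)) \<le> \<bar>u x\<bar> * BD"
        by (simp add: abs_mult mult_left_mono del: times_divide_eq_right)
    qed
  qed measurable
  moreover have "(\<lambda>n. LINT x|lborel. ((u (x - t n *\<^sub>R e) - u x) / t n) * \<phi> x) \<longlonglongrightarrow>
      (LINT x|lborel. (- (pw_gradient u x $ j)) * \<phi> x)"
  proof (rule integral_dominated_convergence[where w="\<lambda>x. slope_bound u * \<bar>\<phi> x\<bar>"])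
    show "integrable lborel (\<lambda>x. slope_bound u * \<bar>\<phi> x\<bar>)"
      by (intro integrable_mult_right integrable_abs
        integrable_bounded_compact_support[OF S(1), where B=B\<phi>] B\<phi> \<phi>S) measurable
    show "AE x in lborel. (\<lambda>n. ((u (x - t n *\<^sub>R e) - u x) / t n) * \<phi> x) \<longlonglongrightarrow> (- (pw_gradient u x $ j)) * \<phi> x"
      using AE_lborel_interior
    proof eventually_elim
      case (elim x)
      show ?case
      proof (cases "x \<in> ?S")
        case True
        then obtain K where K: "K \<in> T" "x \<in> interior K" using elim S by blast
        \<comment> \<open>Eventually both points lie in the same element, where \<open>u\<close> is
          affine, so the quotients are eventually constant.\<close>
        have "(\<lambda>n. x - t n *\<^sub>R e) \<longlonglongrightarrow> x - 0 *\<^sub>R e" by (intro tendsto_intros t0)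
        then have "\<forall>\<^sub>F n in sequentially. x - t n *\<^sub>R e \<in> interior K"
          using K by (intro topological_tendstoD) auto
        then have "\<forall>\<^sub>F n in sequentially. - (pw_gradient u x $ j) = (u (x - t n *\<^sub>R e) - u x) / t n"
        proof eventually_elim
          case (elim n)
          have "u (x - t n *\<^sub>R e) - u x = slope u K \<bullet> ((x - t n *\<^sub>R e) - x)"
            using elim K interior_subset by (intro slope_diff u) auto
          also have "\<dots> = - (t n * (slope u K $ j))"
            by (simp add: e_def inner_axis)
          finally show ?case using tpos[of n] by (simp add: pw_gradient_interior[OF K])
        qed
        then have "(\<lambda>n. (u (x - t n *\<^sub>R e) - u x) / t n) \<longlonglongrightarrow> - (pw_gradient u x $ j)"
          by (rule Lim_transform_eventually[OF tendsto_const])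
        then show ?thesis by (intro tendsto_intros)
      next
        case False
        then show ?thesis using \<phi>S[OF False] by simp
      qed
    qed
    show "AE x in lborel. norm (((u (x - t n *\<^sub>R e) - u x) / t n) * \<phi> x) \<le> slope_bound u * \<bar>\<phi> x\<bar>" for n
    proof (rule AE_I2)
      fix x
      show "norm (((u (x - t n *\<^sub>R e) - u x) / t n) * \<phi> x) \<le> slope_bound u * \<bar>\<phi> x\<bar>"
      proof (cases "x \<in> ?S")
        case True
        have "closed_segment x (x - t n *\<^sub>R e) \<subseteq> ball x \<delta>"
          using \<delta> tpos[of n] t\<delta>[of n] e by (intro closed_segment_subset convex_ball) (auto simp: dist_norm)
        also have "\<dots> \<subseteq> \<Union>T" using \<delta>(2) True \<Omega>_subset by blast
        finally have "\<bar>u (x - t n *\<^sub>R e) - u x\<bar> \<le> slope_bound u * norm (x - t n *\<^sub>R e - x)"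
          by (rule S1_lipschitz_segment[OF u])
        then have "\<bar>(u (x - t n *\<^sub>R e) - u x) / t n\<bar> \<le> slope_bound u"
          using tpos[of n] e by (simp add: field_simps)
        then have "\<bar>(u (x - t n *\<^sub>R e) - u x) / t n\<bar> * \<bar>\<phi> x\<bar> \<le> slope_bound u * \<bar>\<phi> x\<bar>"
          by (rule mult_right_mono) simp
        then show ?thesis by (simp only: abs_mult real_norm_def)
      next
        case False
        then show ?thesis using \<phi>S[OF False] by simp
      qed
    qed
  qed measurable
  ultimately have lim: "(LINT x|lborel. u x * D j x) = (LINT x|lborel. (- (pw_gradient u x $ j)) * \<phi> x)"
    unfolding AB by (rule LIMSEQ_unique)
  have "(LINT x|lebesgue_on \<Omega>. u x * frechet_derivative \<phi> (at x) (axis j 1)) = (LINT x|lebesgue_on \<Omega>. u x * D j x)"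
    by (simp add: D(5))
  also have "\<dots> = (LINT x|lborel. u x * D j x)"
  proof (rule lborel_integral_supported)
    show "u x * D j x = 0" if "x \<notin> \<Omega>" for x
      using D(3)[of x j] S(2) that by auto
  qed measurable
  also have "\<dots> = (LINT x|lebesgue_on \<Omega>. (- (pw_gradient u x $ j)) * \<phi> x)"
    unfolding lim
  proof (rule lborel_integral_supported[symmetric])
    show "- (pw_gradient u x $ j) * \<phi> x = 0" if "x \<notin> \<Omega>" for x
      using \<phi>S[of x] S(2) that by auto
  qed measurable
  finally show ?thesis by simp
qed

text \<open>The piecewise gradients of the components are the rows of a weak gradient; they are
  bounded, hence square integrable on a bounded domain.\<close>

lemma S1_vec_H1:
  assumes u: "u \<in> S1_vec T"
  shows "u \<in> H1 \<Omega>"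
proof -
  have ui: "(\<lambda>x. u x $ i) \<in> S1 T" for i using u by (simp add: S1_vec_def)
  define G :: "real^3 \<Rightarrow> real^3^3" where "G = (\<lambda>x. \<chi> i. pw_gradient (\<lambda>x. u x $ i) x)"
  have "G \<in> borel_measurable borel"
    unfolding borel_measurable_euclidean_space[of G]
    by (auto simp: G_def Basis_vec_def inner_axis)
  then have "G \<in> borel_measurable (lebesgue_on \<Omega>)"
    by (intro measurable_restrict_space1 measurable_completion) simp
  moreover have "norm (G x) \<le> (\<Sum>i\<in>UNIV. slope_bound (\<lambda>x. u x $ i))" for x
    unfolding norm_vec_def[of "G x"]
    by (rule order_trans[OF L2_set_le_sum]) (auto simp: G_def intro!: sum_mono norm_pw_gradient_le)
  ultimately have "G \<in> L2 \<Omega>" by (intro L2_bounded[OF lmeasurable_\<Omega>])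
  moreover have "has_weak_gradient \<Omega> u G"
    unfolding has_weak_gradient_def by (simp add: G_def pw_gradient_weak[OF ui])
  ultimately show ?thesis using S1_vec_L2[OF u] by (auto simp: H1_def)
qed

end

section \<open>One step of the gradient flow\<close>

text \<open>The separating functionals bound the dimension of \<open>V\<close>. Restricting to the kernel of one of
  them removes at most one dimension, and a vector orthogonal to this kernel recovers it.\<close>

lemma finite_dimensional_riesz:
  fixes V :: "('x \<Rightarrow> 'v::real_vector) set" and B :: "('x \<Rightarrow> 'v) \<Rightarrow> ('x \<Rightarrow> 'v) \<Rightarrow> real"
  assumes "finite L"
    and "(\<lambda>x. 0) \<in> V"
    and "\<And>u v c. u \<in> V \<Longrightarrow> v \<in> V \<Longrightarrow> (\<lambda>x. u x + c *\<^sub>R v x) \<in> V"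
    and "\<And>l u v c. l \<in> L \<Longrightarrow> u \<in> V \<Longrightarrow> v \<in> V \<Longrightarrow> l (\<lambda>x. u x + c *\<^sub>R v x) = l u + c * l v"
    and "\<And>u. u \<in> V \<Longrightarrow> \<forall>l\<in>L. l u = 0 \<Longrightarrow> u = (\<lambda>x. 0)"
    and "\<And>u v w c. u \<in> V \<Longrightarrow> v \<in> V \<Longrightarrow> w \<in> V \<Longrightarrow> B (\<lambda>x. u x + c *\<^sub>R v x) w = B u w + c * B v w"
    and "\<And>u v. u \<in> V \<Longrightarrow> v \<in> V \<Longrightarrow> B u v = B v u"
    and "\<And>u. u \<in> V \<Longrightarrow> B u u = 0 \<Longrightarrow> u = (\<lambda>x. 0)"
    and "\<And>u v c. u \<in> V \<Longrightarrow> v \<in> V \<Longrightarrow> F (\<lambda>x. u x + c *\<^sub>R v x) = F u + c * F v"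
  shows "\<exists>v\<in>V. \<forall>w\<in>V. B v w = F w"
  using assms
proof (induction L arbitrary: V F rule: finite_induct)
  case empty
  have "F (\<lambda>x. 0) = 0"
    using empty.prems(8)[OF empty.prems(1,1), of 1] by simp
  moreover have "B (\<lambda>x. 0) (\<lambda>x. 0) = 0"
    using empty.prems(5)[OF empty.prems(1,1,1), of 1] by simp
  moreover have "V = {\<lambda>x. 0}" using empty.prems(1,4) by blast
  ultimately show ?case by simp
next
  case (insert l L)
  note zero = insert.prems(1) and lin = insert.prems(2) and L_lin = insert.prems(3)
    and sep = insert.prems(4) and B_lin = insert.prems(5) and B_sym = insert.prems(6)
    and B_def = insert.prems(7) and F_lin = insert.prems(8)
  define W where "W = {u \<in> V. l u = 0}"
  have l0: "l (\<lambda>x. 0) = 0" using L_lin[OF insertI1 zero zero, of 1] by simp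
  \<comment> \<open>Stated for an arbitrary functional because it is used twice on the same
    \<open>W\<close>: for \<open>F\<close> and for \<open>B b\<close>.\<close>
  have IH: "\<exists>v\<in>W. \<forall>w\<in>W. B v w = F' w"
    if "\<And>u v c. u \<in> V \<Longrightarrow> v \<in> V \<Longrightarrow> F' (\<lambda>x. u x + c *\<^sub>R v x) = F' u + c * F' v" for F'
  proof (rule insert.IH)
    show "(\<lambda>x. 0) \<in> W" using zero l0 by (simp add: W_def)
    show "(\<lambda>x. u x + c *\<^sub>R v x) \<in> W" if "u \<in> W" "v \<in> W" for u v c
      using that lin L_lin[OF insertI1] by (simp add: W_def)
    show "u = (\<lambda>x. 0)" if "u \<in> W" "\<forall>l\<in>L. l u = 0" for u
      using that sep by (simp add: W_def)
  qed (use L_lin B_lin B_sym B_def that in \<open>auto simp: W_def\<close>)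
  have IHF: "\<exists>v\<in>W. \<forall>w\<in>W. B v w = F w" by (rule IH) (rule F_lin)
  have WV: "w \<in> V" if "w \<in> W" for w using that by (simp add: W_def)
  show ?case
  proof (cases "W = V")
    case True
    from IHF show ?thesis unfolding True .
  next
    case False
    then obtain b where b: "b \<in> V" "b \<notin> W" using WV by blast
    then have lb: "l b \<noteq> 0" by (simp add: W_def)
    have "\<exists>v\<in>W. \<forall>w\<in>W. B v w = B b w"
    proof (rule IH)
      fix u v c assume uv: "u \<in> V" "v \<in> V"
      show "B b (\<lambda>x. u x + c *\<^sub>R v x) = B b u + c * B b v"
        unfolding B_sym[OF b(1) lin[OF uv]] B_lin[OF uv b(1)] B_sym[OF uv(1) b(1)] B_sym[OF uv(2) b(1)] ..
    qed
    then obtain p where p: "p \<in> W" "\<And>w. w \<in> W \<Longrightarrow> B p w = B b w" by blast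
    obtain v0 where v0: "v0 \<in> W" "\<And>w. w \<in> W \<Longrightarrow> B v0 w = F w" using IHF by blast
    \<comment> \<open>\<open>p\<close> is the \<open>B\<close>-projection of \<open>b\<close> onto
      \<open>W\<close>, so \<open>e\<close> is \<open>B\<close>-orthogonal to \<open>W\<close> and
      spans the missing direction.\<close>
    define e where "e = (\<lambda>x. b x + (-1) *\<^sub>R p x)"
    have eV: "e \<in> V" unfolding e_def using b(1) WV[OF p(1)] by (rule lin)
    have "l e = l b + (-1) * l p"
      unfolding e_def using b(1) WV[OF p(1)] by (rule L_lin[OF insertI1])
    then have le: "l e \<noteq> 0" using p(1) lb by (simp add: W_def)
    then have Bee: "B e e \<noteq> 0" using B_def[OF eV] l0 by auto
    have Be: "B e w = 0" if "w \<in> W" for w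
      unfolding e_def B_lin[OF b(1) WV[OF p(1)] WV[OF that]] using p(2)[OF that] by simp
    \<comment> \<open>Chosen such that \<open>B v e = F e\<close>; tests from \<open>W\<close> do
      not see the added multiple of \<open>e\<close>.\<close>
    define c where "c = F e / B e e"
    define v where "v = (\<lambda>x. v0 x + c *\<^sub>R e x)"
    have vV: "v \<in> V" unfolding v_def by (rule lin[OF WV[OF v0(1)] eV])
    have Bv: "B v w = B v0 w + c * B e w" if "w \<in> V" for w
      unfolding v_def by (rule B_lin[OF WV[OF v0(1)] eV that])
    have "B v w = F w" if w: "w \<in> V" for w
    proof -
      \<comment> \<open>Removing this multiple of \<open>e\<close> makes \<open>l\<close> vanish,
        which splits \<open>w\<close> into a member of \<open>W\<close> and a multiple of
        \<open>e\<close>.\<close>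
      define w0 where "w0 = (\<lambda>x. w x + (- (l w / l e)) *\<^sub>R e x)"
      have w0: "w0 \<in> W"
        using lin[OF w eV, of "- (l w / l e)"] L_lin[OF insertI1 w eV, of "- (l w / l e)"] le
        by (simp add: W_def w0_def)
      have w_eq: "w = (\<lambda>x. w0 x + (l w / l e) *\<^sub>R e x)" by (simp add: w0_def)
      have "B v w = B w v" by (rule B_sym[OF vV w])
      also have "\<dots> = B w0 v + (l w / l e) * B e v"
        by (subst w_eq) (rule B_lin[OF WV[OF w0] eV vV])
      also have "B w0 v = F w0"
        using B_sym[OF WV[OF w0] vV] Bv[OF WV[OF w0]] Be[OF w0] v0(2)[OF w0] by simp
      also have "B e v = F e"
        using B_sym[OF eV vV] Bv[OF eV] B_sym[OF WV[OF v0(1)] eV] Be[OF v0(1)] Bee by (simp add: c_def)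
      also have "F w0 + (l w / l e) * F e = F w"
        by (subst (2) w_eq) (rule F_lin[OF WV[OF w0] eV, symmetric])
      finally show ?thesis .
    qed
    with vV show ?thesis by blast
  qed
qed

context mesh
begin

text \<open>A continuous function vanishing almost everywhere on an open set vanishes on it, and by
  continuity on the closure, which contains the nodes.\<close>

lemma S1_vec_L2_norm_zero:
  assumes u: "u \<in> S1_vec T" and zero: "L2_norm \<Omega> u = 0"
  shows "u = (\<lambda>x. 0)"
proof -
  have c: "continuous_on (closure \<Omega>) u" using S1_vec_continuous[OF u] by (simp add: Union_T)
  have "(LINT x|lebesgue_on \<Omega>. (norm (u x))\<^sup>2) = 0"
    using L2_norm_power2_integral[of u] zero by simp
  then have "AE x in lebesgue_on \<Omega>. (norm (u x))\<^sup>2 = 0"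
    using S1_vec_L2[OF u] by (subst (asm) integral_nonneg_eq_0_iff_AE) (auto simp: L2_def)
  then have ae: "AE x in lebesgue. x \<in> \<Omega> \<longrightarrow> u x = 0"
    using sets_\<Omega> by (subst (asm) AE_restrict_space_iff) auto
  define N where "N = \<Omega> \<inter> u -` (- {0})"
  have "open N" unfolding N_def
    by (rule continuous_open_preimage[OF continuous_on_subset[OF c closure_subset] open_\<Omega>]) auto
  moreover have "AE x in lebesgue. x \<notin> N"
    using ae by eventually_elim (simp add: N_def)
  then have "negligible N"
    using \<open>open N\<close> by (simp add: negligible_iff_null_sets AE_iff_null_sets)
  ultimately have "N = {}" using open_not_negligible by blast
  then have z: "u x = 0" if "x \<in> \<Omega>" for x using that by (auto simp: N_def)
  show ?thesis
  proof (rule S1_vec_eqI[OF u S1_vec_zero])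
    fix x assume "x \<in> nodes T"
    then have "x \<in> closure \<Omega>" using nodes_subset by (auto simp: Union_T)
    then show "u x = 0" using continuous_constant_on_closure[OF c z] by blast
  qed
qed

abbreviation grad_inner :: "(real^3 \<Rightarrow> real^3) \<Rightarrow> (real^3 \<Rightarrow> real^3) \<Rightarrow> real" where
  "grad_inner u v \<equiv> L2_inner \<Omega> (grad \<Omega> u) (grad \<Omega> v)"

lemma grad_inner_lincomb_left:
  assumes "u \<in> S1_vec T" "v \<in> S1_vec T" "w \<in> S1_vec T"
  shows "grad_inner (\<lambda>x. u x + c *\<^sub>R v x) w = grad_inner u w + c * grad_inner v w"
  by (rule L2_inner_grad_lincomb[OF open_\<Omega> bounded_\<Omega> assms[THEN S1_vec_H1]])

lemma grad_inner_lincomb_right: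
  assumes "u \<in> S1_vec T" "v \<in> S1_vec T" "w \<in> S1_vec T"
  shows "grad_inner w (\<lambda>x. u x + c *\<^sub>R v x) = grad_inner w u + c * grad_inner w v"
  using grad_inner_lincomb_left[OF assms] by (simp add: L2_inner_commute)

lemma L2_inner_lincomb_left:
  assumes "u \<in> S1_vec T" "v \<in> S1_vec T" "w \<in> S1_vec T"
  shows "L2_inner \<Omega> (\<lambda>x. u x + c *\<^sub>R v x) w = L2_inner \<Omega> u w + c * L2_inner \<Omega> v w"
  using assms[THEN S1_vec_L2] by (simp add: L2_inner_add_left L2_inner_scale_left L2_scale)

lemma L2_inner_lincomb_right:
  assumes "u \<in> S1_vec T" "v \<in> S1_vec T" "w \<in> S1_vec T"
  shows "L2_inner \<Omega> w (\<lambda>x. u x + c *\<^sub>R v x) = L2_inner \<Omega> w u + c * L2_inner \<Omega> w v"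
  using L2_inner_lincomb_left[OF assms] by (simp add: L2_inner_commute)

lemma grad_L2: "u \<in> S1_vec T \<Longrightarrow> grad \<Omega> u \<in> L2 \<Omega>"
  by (intro grad_spec S1_vec_H1)

lemma tangent_space_S1_vec: "\<phi> \<in> tangent_space T m \<Longrightarrow> \<phi> \<in> S1_vec T"
  by (simp add: tangent_space_def)

lemma tangent_space_lincomb:
  "u \<in> tangent_space T m \<Longrightarrow> v \<in> tangent_space T m \<Longrightarrow> (\<lambda>x. u x + c *\<^sub>R v x) \<in> tangent_space T m"
  by (simp add: tangent_space_def S1_vec_lincomb inner_add_right)

lemma tangent_space_zero: "(\<lambda>x. 0) \<in> tangent_space T m"
  by (simp add: tangent_space_def S1_vec_zero)

end

locale dgf = mesh +
  fixes \<iota> :: "(real^3 \<Rightarrow> real^3) \<Rightarrow> 'h::{real_inner,complete_space}"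
    and cH a11 a22 a12 a0 \<tau> :: real
  assumes embedding: "hilbert_embedding \<Omega> cH \<iota>" and cH: "1 \<le> cH"
    and trace: "0 < a11 + a22" and det: "a12\<^sup>2 < a11 * a22" and \<tau>: "0 < \<tau>"
begin

section \<open>Unique solvability of one step\<close>

lemma a11_pos: "0 < a11" and a22_pos: "0 < a22"
proof -
  have "0 < a11 * a22" using det by (meson le_less_trans zero_le_power2)
  then show "0 < a11" "0 < a22" using trace by (auto simp: zero_less_mult_iff)
qed

lemma iota_lincomb:
  assumes "u \<in> S1_vec T" "v \<in> S1_vec T"
  shows "\<iota> (\<lambda>x. u x + c *\<^sub>R v x) = \<iota> u + c *\<^sub>R \<iota> v"
proof -
  have H: "u \<in> H1 \<Omega>" "v \<in> H1 \<Omega>" "(\<lambda>x. c *\<^sub>R v x) \<in> H1 \<Omega>"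
    using assms S1_vec_lincomb[OF S1_vec_zero assms(2), of c] by (auto intro: S1_vec_H1)
  then show ?thesis using embedding by (simp add: hilbert_embedding_def)
qed

lemma L2_norm_le_iota:
  assumes "u \<in> S1_vec T"
  shows "(L2_norm \<Omega> u)\<^sup>2 \<le> cH\<^sup>2 * (norm (\<iota> u))\<^sup>2"
proof -
  have "inverse cH * L2_norm \<Omega> u \<le> norm (\<iota> u)"
    using embedding S1_vec_H1[OF assms] by (simp add: hilbert_embedding_def)
  then have "L2_norm \<Omega> u \<le> cH * norm (\<iota> u)"
    using cH by (simp add: field_simps)
  then have "(L2_norm \<Omega> u)\<^sup>2 \<le> (cH * norm (\<iota> u))\<^sup>2" by (rule power_mono) simp
  then show ?thesis by (simp add: power_mult_distrib)
qed

text \<open>The right-hand side contains only known iterates, so each component is a Riesz problem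
  on its tangent space. The form \<open>B\<close> is definite because the norm of
  \<open>\<iota> u\<close> controls the \<open>L2\<close> norm, which is definite on finite element
  functions.\<close>

lemma component_solution:
  assumes a: "0 < a" and m: "m \<in> S1_vec T" "m' \<in> S1_vec T"
  shows "\<exists>!v. v \<in> tangent_space T m \<and>
    (\<forall>\<phi>\<in>tangent_space T m. component_equation \<Omega> \<iota> a a12 a0 \<tau> m m' v \<phi>)"
proof -
  define V where "V = tangent_space T m"
  define B where "B = (\<lambda>u w. \<iota> u \<bullet> \<iota> w + a * \<tau> * grad_inner u w)"
  define F where "F = (\<lambda>\<phi>. - a * grad_inner m \<phi> - a12 * grad_inner m' \<phi> + a0 * L2_inner \<Omega> m' \<phi>)"
  \<comment> \<open>The nodal coordinates: finitely many linear functionals that separate finite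
    element functions.\<close>
  define L where "L = (\<lambda>(z, i). \<lambda>u::real^3 \<Rightarrow> real^3. u z $ i) ` (nodes T \<times> UNIV)"
  have VS: "u \<in> V \<Longrightarrow> u \<in> S1_vec T" for u by (simp add: V_def tangent_space_S1_vec)
  have B_lin: "B (\<lambda>x. u x + c *\<^sub>R v x) w = B u w + c * B v w" if "u \<in> V" "v \<in> V" "w \<in> V" for u v w c
    using that[THEN VS] by (simp add: B_def iota_lincomb grad_inner_lincomb_left inner_add_left algebra_simps)
  have B_definite: "u = (\<lambda>x. 0)" if u: "u \<in> V" "B u u = 0" for u
  proof -
    have "0 \<le> a * \<tau> * grad_inner u u" using a \<tau> by simp
    then have "\<iota> u \<bullet> \<iota> u = 0" using u(2) inner_ge_zero[of "\<iota> u"] unfolding B_def by linarith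
    then have "norm (\<iota> u) = 0" by simp
    then have "(L2_norm \<Omega> u)\<^sup>2 \<le> 0" using L2_norm_le_iota[OF VS[OF u(1)]] by simp
    then show ?thesis using S1_vec_L2_norm_zero[OF VS[OF u(1)]] by simp
  qed
  have "\<exists>v\<in>V. \<forall>w\<in>V. B v w = F w"
  proof (rule finite_dimensional_riesz[where L=L])
    show "finite L" unfolding L_def using finite_nodes by (intro finite_imageI finite_cartesian_product) auto
    show "(\<lambda>x. 0) \<in> V" by (simp add: V_def tangent_space_zero)
    show "(\<lambda>x. u x + c *\<^sub>R v x) \<in> V" if "u \<in> V" "v \<in> V" for u v c
      using that by (simp add: V_def tangent_space_lincomb)
    show "l (\<lambda>x. u x + c *\<^sub>R v x) = l u + c * l v" if "l \<in> L" for l u v c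
      using that by (auto simp: L_def)
    show "u = (\<lambda>x. 0)" if u: "u \<in> V" and 0: "\<forall>l\<in>L. l u = 0" for u
    proof (rule S1_vec_eqI[OF VS[OF u] S1_vec_zero])
      show "u z = 0" if "z \<in> nodes T" for z
        using 0 that by (simp add: L_def vec_eq_iff)
    qed
    show "B u v = B v u" for u v by (simp add: B_def inner_commute L2_inner_commute)
    show "F (\<lambda>x. u x + c *\<^sub>R v x) = F u + c * F v" if "u \<in> V" "v \<in> V" for u v c
      using that[THEN VS] m
      by (simp add: F_def grad_inner_lincomb_right L2_inner_lincomb_right algebra_simps)
  qed (rule B_lin B_definite; assumption)+
  then obtain v where v: "v \<in> V" "\<forall>w\<in>V. B v w = F w" by blast
  have eq: "component_equation \<Omega> \<iota> a a12 a0 \<tau> m m' v \<phi> \<longleftrightarrow> B v \<phi> = F \<phi>" for v \<phi>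
    by (simp add: component_equation_def B_def F_def)
  show ?thesis
  proof (rule ex1I[of _ v])
    show "v \<in> tangent_space T m \<and> (\<forall>\<phi>\<in>tangent_space T m. component_equation \<Omega> \<iota> a a12 a0 \<tau> m m' v \<phi>)"
      using v by (simp add: eq V_def)
    fix w assume w: "w \<in> tangent_space T m \<and> (\<forall>\<phi>\<in>tangent_space T m. component_equation \<Omega> \<iota> a a12 a0 \<tau> m m' w \<phi>)"
    define d where "d = (\<lambda>x. w x + (-1) *\<^sub>R v x)"
    have wV: "w \<in> V" using w by (simp add: V_def)
    have dV: "d \<in> V" using w v(1) tangent_space_lincomb unfolding d_def V_def by blast
    have "B d d = B w d + (-1) * B v d"
      using B_lin[OF wV v(1) dV, of "-1"] by (simp add: d_def)
    also have "\<dots> = 0" using w v(2) dV by (simp add: eq V_def)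
    finally have "d = (\<lambda>x. 0)" using B_definite[OF dV] by simp
    then show "w = v" by (simp add: d_def fun_eq_iff)
  qed
qed

text \<open>Both tangent spaces contain the zero field, so the quantification over test pairs can be
  specialised to either component and the system splits.\<close>

lemma dgf_solution_iff:
  "dgf_solution \<Omega> T \<iota> a11 a22 a12 a0 \<tau> (m1, m2) (v1, v2) \<longleftrightarrow>
    (v1 \<in> tangent_space T m1 \<and> (\<forall>\<phi>\<in>tangent_space T m1. component_equation \<Omega> \<iota> a11 a12 a0 \<tau> m1 m2 v1 \<phi>)) \<and>
    (v2 \<in> tangent_space T m2 \<and> (\<forall>\<phi>\<in>tangent_space T m2. component_equation \<Omega> \<iota> a22 a12 a0 \<tau> m2 m1 v2 \<phi>))"
  using tangent_space_zero[of m1] tangent_space_zero[of m2] unfolding dgf_solution_def by auto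

lemma dgf_solution_tangent:
  assumes "dgf_solution \<Omega> T \<iota> a11 a22 a12 a0 \<tau> (m1, m2) (v1, v2)"
  shows "v1 \<in> tangent_space T m1" "v2 \<in> tangent_space T m2"
  using assms by (auto simp: dgf_solution_iff)

lemma dgf_solution_unique:
  assumes "m1 \<in> S1_vec T" "m2 \<in> S1_vec T"
  shows "\<exists>!w. dgf_solution \<Omega> T \<iota> a11 a22 a12 a0 \<tau> (m1, m2) w"
proof -
  obtain v1 where v1: "v1 \<in> tangent_space T m1 \<and> (\<forall>\<phi>\<in>tangent_space T m1. component_equation \<Omega> \<iota> a11 a12 a0 \<tau> m1 m2 v1 \<phi>)"
    "\<And>w. w \<in> tangent_space T m1 \<and> (\<forall>\<phi>\<in>tangent_space T m1. component_equation \<Omega> \<iota> a11 a12 a0 \<tau> m1 m2 w \<phi>) \<Longrightarrow> w = v1"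
    using component_solution[OF a11_pos assms] by (rule ex1E) blast
  obtain v2 where v2: "v2 \<in> tangent_space T m2 \<and> (\<forall>\<phi>\<in>tangent_space T m2. component_equation \<Omega> \<iota> a22 a12 a0 \<tau> m2 m1 v2 \<phi>)"
    "\<And>w. w \<in> tangent_space T m2 \<and> (\<forall>\<phi>\<in>tangent_space T m2. component_equation \<Omega> \<iota> a22 a12 a0 \<tau> m2 m1 w \<phi>) \<Longrightarrow> w = v2"
    using component_solution[OF a22_pos assms(2,1)] by (rule ex1E) blast
  show ?thesis
  proof (rule ex1I[of _ "(v1, v2)"])
    show "dgf_solution \<Omega> T \<iota> a11 a22 a12 a0 \<tau> (m1, m2) (v1, v2)"
      unfolding dgf_solution_iff using v1(1) v2(1) by (rule conjI)
    fix w assume w: "dgf_solution \<Omega> T \<iota> a11 a22 a12 a0 \<tau> (m1, m2) w"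
    obtain w1 w2 where w12: "w = (w1, w2)" by (cases w)
    show "w = (v1, v2)"
      using w v1(2)[of w1] v2(2)[of w2] unfolding w12 dgf_solution_iff by simp
  qed
qed

lemma dgf_update_solution:
  assumes "m1 \<in> S1_vec T" "m2 \<in> S1_vec T"
  shows "dgf_solution \<Omega> T \<iota> a11 a22 a12 a0 \<tau> (m1, m2) (dgf_update \<Omega> T \<iota> a11 a22 a12 a0 \<tau> (m1, m2))"
  unfolding dgf_update_def by (rule theI'[OF dgf_solution_unique[OF assms]])

section \<open>Energy balance and energy bounds\<close>

lemma energy_step:
  assumes m: "m1 \<in> S1_vec T" "m2 \<in> S1_vec T"
    and sol: "dgf_solution \<Omega> T \<iota> a11 a22 a12 a0 \<tau> (m1, m2) (v1, v2)"
  shows "energy \<Omega> a11 a22 a12 a0 (\<lambda>x. m1 x + \<tau> *\<^sub>R v1 x, \<lambda>x. m2 x + \<tau> *\<^sub>R v2 x) - energy \<Omega> a11 a22 a12 a0 (m1, m2) =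
     - \<tau> * ((norm (\<iota> v1))\<^sup>2 + (norm (\<iota> v2))\<^sup>2)
     - \<tau>\<^sup>2 / 2 * (a11 * (L2_norm \<Omega> (grad \<Omega> v1))\<^sup>2 + a22 * (L2_norm \<Omega> (grad \<Omega> v2))\<^sup>2)
     + a12 * \<tau>\<^sup>2 * grad_inner v1 v2 - a0 * \<tau>\<^sup>2 * L2_inner \<Omega> v1 v2"
proof -
  note v = dgf_solution_tangent[OF sol, THEN tangent_space_S1_vec]
  have "component_equation \<Omega> \<iota> a11 a12 a0 \<tau> m1 m2 v1 v1" "component_equation \<Omega> \<iota> a22 a12 a0 \<tau> m2 m1 v2 v2"
    using sol by (auto simp: dgf_solution_iff)
  \<comment> \<open>Each equation is tested with its own solution. The implicit diagonal term
    contributes minus \<open>\<tau>\<^sup>2\<close> times the squared gradients and so turns the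
    plus one half of the energy expansion into minus one half. The coupling is explicit, so its
    products of \<open>v1\<close> and \<open>v2\<close> remain with the signs of the energy.\<close>
  then have eq: "(norm (\<iota> v1))\<^sup>2 = - a11 * \<tau> * grad_inner v1 v1 - a11 * grad_inner m1 v1 - a12 * grad_inner v1 m2 + a0 * L2_inner \<Omega> v1 m2"
    "(norm (\<iota> v2))\<^sup>2 = - a22 * \<tau> * grad_inner v2 v2 - a22 * grad_inner m2 v2 - a12 * grad_inner m1 v2 + a0 * L2_inner \<Omega> m1 v2"
    by (simp_all add: component_equation_def power2_norm_eq_inner L2_inner_commute[of \<Omega> "grad \<Omega> m2" "grad \<Omega> v1"]
        L2_inner_commute[of \<Omega> m2 v1])
  note mv = S1_vec_lincomb[OF m(1) v(1), of \<tau>] S1_vec_lincomb[OF m(2) v(2), of \<tau>]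
  show ?thesis
    unfolding energy_def L2_norm_power2 eq
    by (simp add: m v mv grad_inner_lincomb_left grad_inner_lincomb_right L2_inner_lincomb_left
        L2_inner_lincomb_right L2_inner_commute[of \<Omega> "grad \<Omega> v1" "grad \<Omega> m1"]
        L2_inner_commute[of \<Omega> "grad \<Omega> v2" "grad \<Omega> m2"] field_simps power2_eq_square)
qed

definition \<mu> :: real where "\<mu> = (a11 * a22 - a12\<^sup>2) / (a11 + a22)"

lemma \<mu>_pos: "0 < \<mu>"
  using trace det by (simp add: \<mu>_def)

lemma energy_decrease:
  assumes m: "m1 \<in> S1_vec T" "m2 \<in> S1_vec T"
    and sol: "dgf_solution \<Omega> T \<iota> a11 a22 a12 a0 \<tau> (m1, m2) (v1, v2)"
  shows "energy \<Omega> a11 a22 a12 a0 (\<lambda>x. m1 x + \<tau> *\<^sub>R v1 x, \<lambda>x. m2 x + \<tau> *\<^sub>R v2 x) \<le>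
    energy \<Omega> a11 a22 a12 a0 (m1, m2)
     - \<tau> * (1 - cH\<^sup>2 * \<bar>a0\<bar> * \<tau> / 2) * ((norm (\<iota> v1))\<^sup>2 + (norm (\<iota> v2))\<^sup>2)
     - \<tau>\<^sup>2 / 2 * \<mu> * ((L2_norm \<Omega> (grad \<Omega> v1))\<^sup>2 + (L2_norm \<Omega> (grad \<Omega> v2))\<^sup>2)"
proof -
  note v = dgf_solution_tangent[OF sol, THEN tangent_space_S1_vec]
  define g1 g2 n1 n2 where "g1 = (L2_norm \<Omega> (grad \<Omega> v1))\<^sup>2" and "g2 = (L2_norm \<Omega> (grad \<Omega> v2))\<^sup>2"
    and "n1 = (norm (\<iota> v1))\<^sup>2" and "n2 = (norm (\<iota> v2))\<^sup>2"
  \<comment> \<open>The mixed gradient term enters the balance with the sign opposite to the energy,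
    so coercivity is used with \<open>- a12\<close>, which has the same square.\<close>
  have "\<mu> * (g1 + g2) \<le> a11 * g1 + a22 * g2 + 2 * (- a12) * grad_inner v1 v2"
    using L2_form_coercive[of a11 a22 "- a12", OF trace _ grad_L2[OF v(1)] grad_L2[OF v(2)]] det
    by (simp add: \<mu>_def g1_def g2_def)
  then have "\<tau>\<^sup>2 / 2 * (\<mu> * (g1 + g2)) \<le> \<tau>\<^sup>2 / 2 * (a11 * g1 + a22 * g2 + 2 * (- a12) * grad_inner v1 v2)"
    by (rule mult_left_mono) simp
  moreover have "\<bar>L2_inner \<Omega> v1 v2\<bar> \<le> cH\<^sup>2 / 2 * (n1 + n2)"
    using L2_young[OF S1_vec_L2[OF v(1)] S1_vec_L2[OF v(2)]] L2_norm_le_iota[OF v(1)] L2_norm_le_iota[OF v(2)]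
    by (simp add: n1_def n2_def algebra_simps)
  then have "\<bar>a0 * \<tau>\<^sup>2 * L2_inner \<Omega> v1 v2\<bar> \<le> \<bar>a0\<bar> * \<tau>\<^sup>2 * (cH\<^sup>2 / 2 * (n1 + n2))"
    unfolding abs_mult by (intro mult_mono) auto
  then have "- (a0 * \<tau>\<^sup>2 * L2_inner \<Omega> v1 v2) \<le> \<bar>a0\<bar> * \<tau>\<^sup>2 * (cH\<^sup>2 / 2 * (n1 + n2))"
    by linarith
  moreover have "\<tau> * (1 - cH\<^sup>2 * \<bar>a0\<bar> * \<tau> / 2) * (n1 + n2) = \<tau> * (n1 + n2) - \<bar>a0\<bar> * \<tau>\<^sup>2 * (cH\<^sup>2 / 2 * (n1 + n2))"
    by (simp add: algebra_simps power2_eq_square)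
  moreover have "\<tau>\<^sup>2 / 2 * (a11 * g1 + a22 * g2 + 2 * (- a12) * grad_inner v1 v2) =
      \<tau>\<^sup>2 / 2 * (a11 * g1 + a22 * g2) - a12 * \<tau>\<^sup>2 * grad_inner v1 v2"
    by (simp add: algebra_simps)
  moreover have "\<tau>\<^sup>2 / 2 * \<mu> * (g1 + g2) = \<tau>\<^sup>2 / 2 * (\<mu> * (g1 + g2))" "- \<tau> * (n1 + n2) = - (\<tau> * (n1 + n2))"
    by simp_all
  ultimately show ?thesis
    using energy_step[OF m sol] unfolding g1_def[symmetric] g2_def[symmetric] n1_def[symmetric] n2_def[symmetric]
    by linarith
qed

text \<open>The gradient part is nonnegative by coercivity, so only the term with \<open>a0\<close>
  can pull the energy down. The iterates may leave the unit sphere at the nodes, so their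
  \<open>L2\<close> norms stay in the bound.\<close>

lemma energy_lower_bound:
  assumes m: "m1 \<in> S1_vec T" "m2 \<in> S1_vec T"
  shows "- (\<bar>a0\<bar> / 2 * ((L2_norm \<Omega> m1)\<^sup>2 + (L2_norm \<Omega> m2)\<^sup>2)) \<le> energy \<Omega> a11 a22 a12 a0 (m1, m2)"
proof -
  define g where "g = (L2_norm \<Omega> (grad \<Omega> m1))\<^sup>2 + (L2_norm \<Omega> (grad \<Omega> m2))\<^sup>2"
  have "0 \<le> \<mu> * g" using \<mu>_pos by (simp add: g_def)
  also have "\<mu> * g \<le> a11 * (L2_norm \<Omega> (grad \<Omega> m1))\<^sup>2 + a22 * (L2_norm \<Omega> (grad \<Omega> m2))\<^sup>2 + 2 * a12 * grad_inner m1 m2"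
    using L2_form_coercive[OF trace det grad_L2[OF m(1)] grad_L2[OF m(2)]] by (simp add: \<mu>_def g_def)
  finally have "0 \<le> \<dots>" .
  moreover have "\<bar>a0 * L2_inner \<Omega> m1 m2\<bar> \<le> \<bar>a0\<bar> * (((L2_norm \<Omega> m1)\<^sup>2 + (L2_norm \<Omega> m2)\<^sup>2) / 2)"
    unfolding abs_mult using L2_young[OF S1_vec_L2[OF m(1)] S1_vec_L2[OF m(2)]] by (intro mult_left_mono) auto
  then have "a0 * L2_inner \<Omega> m1 m2 \<le> \<bar>a0\<bar> / 2 * ((L2_norm \<Omega> m1)\<^sup>2 + (L2_norm \<Omega> m2)\<^sup>2)" by simp
  moreover have "energy \<Omega> a11 a22 a12 a0 (m1, m2) = 1 / 2 * (a11 * (L2_norm \<Omega> (grad \<Omega> m1))\<^sup>2 +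
      a22 * (L2_norm \<Omega> (grad \<Omega> m2))\<^sup>2 + 2 * a12 * grad_inner m1 m2) - a0 * L2_inner \<Omega> m1 m2"
    by (simp add: energy_def field_simps)
  moreover have "- r \<le> e" if "0 \<le> t" "q \<le> r" "e = 1 / 2 * t - q" for e q r t :: real
    using that by simp
  ultimately show ?thesis by blast
qed

lemma energy_upper_bound:
  assumes m: "m1 \<in> S1_vec T" "m2 \<in> S1_vec T"
  shows "energy \<Omega> a11 a22 a12 a0 (m1, m2) \<le>
    (a11 + a22 + \<bar>a12\<bar> + \<bar>a0\<bar>) / 2 * ((H1_norm \<Omega> m1)\<^sup>2 + (H1_norm \<Omega> m2)\<^sup>2)"
proof -
  define P S p s where "P = (L2_norm \<Omega> (grad \<Omega> m1))\<^sup>2" and "S = (L2_norm \<Omega> (grad \<Omega> m2))\<^sup>2"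
    and "p = (L2_norm \<Omega> m1)\<^sup>2" and "s = (L2_norm \<Omega> m2)\<^sup>2"
  have nonneg: "0 \<le> P" "0 \<le> S" "0 \<le> p" "0 \<le> s" by (auto simp: P_def S_def p_def s_def)
  have H: "(H1_norm \<Omega> m1)\<^sup>2 = p + P" "(H1_norm \<Omega> m2)\<^sup>2 = s + S"
    by (simp_all add: H1_norm_def P_def S_def p_def s_def)
  have "\<bar>a12 * grad_inner m1 m2\<bar> \<le> \<bar>a12\<bar> * ((P + S) / 2)"
    unfolding abs_mult P_def S_def using L2_young[OF grad_L2[OF m(1)] grad_L2[OF m(2)]] by (intro mult_left_mono) auto
  moreover have "\<bar>a0 * L2_inner \<Omega> m1 m2\<bar> \<le> \<bar>a0\<bar> * ((p + s) / 2)"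
    unfolding abs_mult p_def s_def using L2_young[OF S1_vec_L2[OF m(1)] S1_vec_L2[OF m(2)]] by (intro mult_left_mono) auto
  moreover have "energy \<Omega> a11 a22 a12 a0 (m1, m2) = (a11 * P + a22 * S) / 2 + a12 * grad_inner m1 m2 - a0 * L2_inner \<Omega> m1 m2"
    by (simp add: energy_def P_def S_def)
  moreover have "e \<le> t / 2 + r + r'" if "\<bar>q\<bar> \<le> r" "\<bar>q'\<bar> \<le> r'" "e = t / 2 + q - q'" for e q q' r r' t :: real
    using that by linarith
  ultimately have "energy \<Omega> a11 a22 a12 a0 (m1, m2) \<le> (a11 * P + a22 * S) / 2 + \<bar>a12\<bar> * ((P + S) / 2) + \<bar>a0\<bar> * ((p + s) / 2)"
    by blast
  also have "\<dots> = (a11 * P + a22 * S + \<bar>a12\<bar> * (P + S) + \<bar>a0\<bar> * (p + s)) / 2"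
    by (simp add: field_simps)
  also have "\<dots> \<le> (a11 + a22 + \<bar>a12\<bar> + \<bar>a0\<bar>) * ((p + P) + (s + S)) / 2"
    using a11_pos a22_pos nonneg by (simp add: algebra_simps add_nonneg_nonneg)
  finally show ?thesis unfolding H by simp
qed

end

section \<open>The iteration\<close>

locale dgf_run = dgf +
  fixes m1_0 m2_0 :: "real^3 \<Rightarrow> real^3"
  assumes m0: "m1_0 \<in> S1_vec T" "m2_0 \<in> S1_vec T"
    and unit: "\<And>z. z \<in> nodes T \<Longrightarrow> norm (m1_0 z) = 1" "\<And>z. z \<in> nodes T \<Longrightarrow> norm (m2_0 z) = 1"
begin

definition m :: "nat \<Rightarrow> (real^3 \<Rightarrow> real^3) \<times> (real^3 \<Rightarrow> real^3)" where
  "m = dgf_iterate \<Omega> T \<iota> a11 a22 a12 a0 \<tau> (m1_0, m2_0)"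

definition v :: "nat \<Rightarrow> (real^3 \<Rightarrow> real^3) \<times> (real^3 \<Rightarrow> real^3)" where
  "v i = dgf_update \<Omega> T \<iota> a11 a22 a12 a0 \<tau> (m i)"

abbreviation "m1 i \<equiv> fst (m i)"
abbreviation "m2 i \<equiv> snd (m i)"
abbreviation "v1 i \<equiv> fst (v i)"
abbreviation "v2 i \<equiv> snd (v i)"

lemma m_Suc: "m (Suc i) = (\<lambda>x. m1 i x + \<tau> *\<^sub>R v1 i x, \<lambda>x. m2 i x + \<tau> *\<^sub>R v2 i x)"
  by (simp add: m_def v_def Let_def)

lemma m_S1: "m1 i \<in> S1_vec T \<and> m2 i \<in> S1_vec T"
proof (induction i)
  case 0
  show ?case using m0 by (simp add: m_def)
next
  case (Suc i)
  have "dgf_solution \<Omega> T \<iota> a11 a22 a12 a0 \<tau> (m1 i, m2 i) (v1 i, v2 i)"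
    using dgf_update_solution[of "m1 i" "m2 i"] Suc by (simp add: v_def)
  note dgf_solution_tangent[OF this, THEN tangent_space_S1_vec]
  then show ?case using Suc by (simp add: m_Suc S1_vec_lincomb)
qed

lemma v_solution: "dgf_solution \<Omega> T \<iota> a11 a22 a12 a0 \<tau> (m1 i, m2 i) (v1 i, v2 i)"
  using dgf_update_solution[of "m1 i" "m2 i"] m_S1[of i] by (simp add: v_def)

lemma v_S1: "v1 i \<in> S1_vec T" "v2 i \<in> S1_vec T"
  by (rule dgf_solution_tangent[OF v_solution, THEN tangent_space_S1_vec])+

lemma v_tangent: "z \<in> nodes T \<Longrightarrow> m1 i z \<bullet> v1 i z = 0" "z \<in> nodes T \<Longrightarrow> m2 i z \<bullet> v2 i z = 0"
  using dgf_solution_tangent[OF v_solution[of i]] by (auto simp: tangent_space_def)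

definition S :: "nat \<Rightarrow> real" where
  "S n = (\<Sum>i<n. (norm (\<iota> (v1 i)))\<^sup>2 + (norm (\<iota> (v2 i)))\<^sup>2)"

text \<open>The stopping test contains \<open>\<tau>\<close> times the squared gradients of the
  updates, so the gradient part of the dissipation is accumulated alongside
  \<open>S\<close>.\<close>

definition G :: "nat \<Rightarrow> real" where
  "G n = (\<Sum>i<n. (L2_norm \<Omega> (grad \<Omega> (v1 i)))\<^sup>2 + (L2_norm \<Omega> (grad \<Omega> (v2 i)))\<^sup>2)"

abbreviation E :: "nat \<Rightarrow> real" where
  "E i \<equiv> energy \<Omega> a11 a22 a12 a0 (m i)"

lemma S_nonneg: "0 \<le> S n" and G_nonneg: "0 \<le> G n"
  by (auto simp: S_def G_def intro!: sum_nonneg add_nonneg_nonneg)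

text \<open>Tangential updates never shorten nodal vectors, by Pythagoras. This fixes the sign of
  the length error for \<open>L1_norm_interpolant\<close>.\<close>

lemma node_norm_ge_1: "z \<in> nodes T \<Longrightarrow> 1 \<le> norm (m1 n z) \<and> 1 \<le> norm (m2 n z)"
proof (induction n)
  case 0
  then show ?case using unit by (simp add: m_def)
next
  case (Suc n)
  have "1 \<le> norm (p + \<tau> *\<^sub>R q)" if "1 \<le> norm p" "p \<bullet> q = 0" for p q :: "real^3"
  proof -
    have "(norm (p + \<tau> *\<^sub>R q))\<^sup>2 = (norm p)\<^sup>2 + \<tau>\<^sup>2 * (norm q)\<^sup>2"
      using that(2) by (simp add: power2_norm_eq_inner inner_add inner_commute power2_eq_square[of \<tau>])
    also have "\<dots> \<ge> 1" using that(1) by (simp add: one_le_power add_increasing2)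
    finally show ?thesis by (simp add: power2_le_imp_le[of 1 "norm (p + \<tau> *\<^sub>R q)"])
  qed
  then show ?case using Suc v_tangent by (simp add: m_Suc)
qed

lemma lumped_growth:
  "lumped (m1 n) \<le> measure lebesgue \<Omega> + 66 * \<tau>\<^sup>2 * cH\<^sup>2 * (\<Sum>i<n. (norm (\<iota> (v1 i)))\<^sup>2)"
  "lumped (m2 n) \<le> measure lebesgue \<Omega> + 66 * \<tau>\<^sup>2 * cH\<^sup>2 * (\<Sum>i<n. (norm (\<iota> (v2 i)))\<^sup>2)"
proof -
  have v: "lumped u \<le> 66 * (cH\<^sup>2 * (norm (\<iota> u))\<^sup>2)" if "u \<in> S1_vec T" for u
    using lumped_le_L2_norm[OF that] L2_norm_le_iota[OF that] by linarith
  have "lumped (m1 n) \<le> measure lebesgue \<Omega> + 66 * \<tau>\<^sup>2 * cH\<^sup>2 * (\<Sum>i<n. (norm (\<iota> (v1 i)))\<^sup>2) \<and>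
    lumped (m2 n) \<le> measure lebesgue \<Omega> + 66 * \<tau>\<^sup>2 * cH\<^sup>2 * (\<Sum>i<n. (norm (\<iota> (v2 i)))\<^sup>2)"
  proof (induction n)
    case 0
    show ?case using unit by (simp add: m_def lumped_unit)
  next
    case (Suc n)
    have "\<tau>\<^sup>2 * lumped (v1 n) \<le> \<tau>\<^sup>2 * (66 * (cH\<^sup>2 * (norm (\<iota> (v1 n)))\<^sup>2))"
      "\<tau>\<^sup>2 * lumped (v2 n) \<le> \<tau>\<^sup>2 * (66 * (cH\<^sup>2 * (norm (\<iota> (v2 n)))\<^sup>2))"
      by (intro mult_left_mono v v_S1; simp)+
    then show ?case using Suc v_tangent
      by (simp add: m_Suc lumped_orthogonal_step algebra_simps)
  qed
  then show "lumped (m1 n) \<le> measure lebesgue \<Omega> + 66 * \<tau>\<^sup>2 * cH\<^sup>2 * (\<Sum>i<n. (norm (\<iota> (v1 i)))\<^sup>2)"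
    "lumped (m2 n) \<le> measure lebesgue \<Omega> + 66 * \<tau>\<^sup>2 * cH\<^sup>2 * (\<Sum>i<n. (norm (\<iota> (v2 i)))\<^sup>2)" by auto
qed

lemma energy_sum:
  "E n \<le> E 0 - \<tau> * (1 - cH\<^sup>2 * \<bar>a0\<bar> * \<tau> / 2) * S n - \<tau>\<^sup>2 / 2 * \<mu> * G n"
proof (induction n)
  case 0
  show ?case by (simp add: S_def G_def)
next
  case (Suc n)
  have "E (Suc n) \<le> E n
     - \<tau> * (1 - cH\<^sup>2 * \<bar>a0\<bar> * \<tau> / 2) * ((norm (\<iota> (v1 n)))\<^sup>2 + (norm (\<iota> (v2 n)))\<^sup>2)
     - \<tau>\<^sup>2 / 2 * \<mu> * ((L2_norm \<Omega> (grad \<Omega> (v1 n)))\<^sup>2 + (L2_norm \<Omega> (grad \<Omega> (v2 n)))\<^sup>2)"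
    using energy_decrease[of "m1 n" "m2 n" "v1 n" "v2 n"] m_S1[of n] v_solution[of n]
    by (simp add: m_Suc)
  moreover have "c * S (Suc n) = c * S n + c * ((norm (\<iota> (v1 n)))\<^sup>2 + (norm (\<iota> (v2 n)))\<^sup>2)" for c
    by (simp add: S_def algebra_simps)
  moreover have "c * G (Suc n) = c * G n + c * ((L2_norm \<Omega> (grad \<Omega> (v1 n)))\<^sup>2 + (L2_norm \<Omega> (grad \<Omega> (v2 n)))\<^sup>2)" for c
    by (simp add: G_def algebra_simps)
  ultimately show ?case using Suc by (smt (verit))
qed

text \<open>The growth of the lengths enters the energy bound with the factor \<open>33 * cH\<^sup>2 * \<bar>a0\<bar> * \<tau>\<close>. The
  restriction on \<open>\<tau>\<close> leaves at least half of the dissipation.\<close>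

lemma dissipation_bound:
  assumes small: "cH * (cH / 2 + 67 * cH) * \<bar>a0\<bar> * \<tau> < 1"
  shows "\<tau> / 2 * S n + \<tau>\<^sup>2 / 2 * \<mu> * G n \<le> E 0 + \<bar>a0\<bar> * measure lebesgue \<Omega>"
proof -
  define q where "q = cH\<^sup>2 * \<bar>a0\<bar> * \<tau>"
  have q: "67.5 * q < 1" using small by (simp add: q_def algebra_simps power2_eq_square)
  have "(L2_norm \<Omega> (m1 n))\<^sup>2 + (L2_norm \<Omega> (m2 n))\<^sup>2 \<le> lumped (m1 n) + lumped (m2 n)"
    using m_S1[of n] by (intro add_mono L2_norm_le_lumped) auto
  also have "\<dots> \<le> 2 * measure lebesgue \<Omega> + 66 * \<tau>\<^sup>2 * cH\<^sup>2 * S n"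
    using add_mono[OF lumped_growth(1)[of n] lumped_growth(2)[of n]]
    by (simp add: S_def sum.distrib algebra_simps)
  finally have "\<bar>a0\<bar> / 2 * ((L2_norm \<Omega> (m1 n))\<^sup>2 + (L2_norm \<Omega> (m2 n))\<^sup>2) \<le>
      \<bar>a0\<bar> / 2 * (2 * measure lebesgue \<Omega> + 66 * \<tau>\<^sup>2 * cH\<^sup>2 * S n)"
    by (rule mult_left_mono) simp
  also have "\<dots> = \<bar>a0\<bar> * measure lebesgue \<Omega> + 33 * (q * (\<tau> * S n))"
    by (simp add: q_def algebra_simps power2_eq_square)
  finally have "- (\<bar>a0\<bar> * measure lebesgue \<Omega> + 33 * (q * (\<tau> * S n))) \<le> E n"
    using energy_lower_bound[of "m1 n" "m2 n"] m_S1[of n] by simp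
  moreover have "E n \<le> E 0 - (\<tau> * S n - q * (\<tau> * S n) / 2) - \<tau>\<^sup>2 / 2 * \<mu> * G n"
    using energy_sum[of n] by (simp add: q_def algebra_simps)
  \<comment> \<open>The losses amount to \<open>33 + 1 / 2\<close> times
    \<open>q * (\<tau> * S n)\<close>, which is at most half of \<open>\<tau> * S n\<close> since
    \<open>67 * q \<le> 1\<close>.\<close>
  moreover have "67 * q * (\<tau> * S n) \<le> 1 * (\<tau> * S n)"
    using q \<tau> S_nonneg[of n] by (intro mult_right_mono) auto
  moreover have "x / 2 + g \<le> e + b"
    if "- (b + 33 * y) \<le> e'" "e' \<le> e - (x - y / 2) - g" "67 * y \<le> x" for b e e' g x y :: real
    using that by linarith
  ultimately have "\<tau> * S n / 2 + \<tau>\<^sup>2 / 2 * \<mu> * G n \<le> E 0 + \<bar>a0\<bar> * measure lebesgue \<Omega>"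
    by (simp only: mult.assoc mult_1)
  then show ?thesis by simp
qed

section \<open>Termination and the length error\<close>

lemma measure_\<Omega>_pos: "0 < measure lebesgue \<Omega>"
proof -
  have "measure lebesgue \<Omega> \<noteq> 0"
    using open_not_negligible[OF open_\<Omega> \<Omega>_nonempty] negligible_iff_measure0[OF lmeasurable_\<Omega>] by simp
  then show ?thesis by (simp add: less_le)
qed

lemma stops:
  assumes small: "cH * (cH / 2 + 67 * cH) * \<bar>a0\<bar> * \<tau> < 1" and \<epsilon>: "0 < \<epsilon>"
  shows "\<exists>i. stopping_criterion \<Omega> \<iota> \<tau> \<epsilon> (v i)"
proof (rule ccontr)
  assume never: "\<nexists>i. stopping_criterion \<Omega> \<iota> \<tau> \<epsilon> (v i)"
  define \<eta> where "\<eta> = \<epsilon>\<^sup>2 * measure lebesgue \<Omega>"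
  \<comment> \<open>A single factor for which \<open>(S n + \<tau> * G n) * \<beta>\<close> is at
    most the left-hand side of \<open>dissipation_bound\<close>.\<close>
  define \<beta> where "\<beta> = min (\<tau> / 2) (\<tau> / 2 * \<mu>)"
  have \<eta>: "0 < \<eta>" using \<epsilon> measure_\<Omega>_pos by (simp add: \<eta>_def)
  have \<beta>: "0 < \<beta>" "\<beta> \<le> \<tau> / 2" "\<beta> \<le> \<tau> / 2 * \<mu>" using \<tau> \<mu>_pos by (auto simp: \<beta>_def)
  \<comment> \<open>A failed stopping test puts one argument of the maximum above
    \<open>\<eta>\<close>; the other is nonnegative, so their sum is at least \<open>\<eta>\<close>
    too.\<close>
  have large: "\<eta> \<le> (norm (\<iota> (v1 i)))\<^sup>2 + (norm (\<iota> (v2 i)))\<^sup>2 +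
      \<tau> * ((L2_norm \<Omega> (grad \<Omega> (v1 i)))\<^sup>2 + (L2_norm \<Omega> (grad \<Omega> (v2 i)))\<^sup>2)" for i
  proof -
    have "\<not> stopping_criterion \<Omega> \<iota> \<tau> \<epsilon> (v1 i, v2 i)" using never by simp
    then have "\<eta> < (norm (\<iota> (v1 i)))\<^sup>2 + \<tau> * (L2_norm \<Omega> (grad \<Omega> (v1 i)))\<^sup>2 \<or>
        \<eta> < (norm (\<iota> (v2 i)))\<^sup>2 + \<tau> * (L2_norm \<Omega> (grad \<Omega> (v2 i)))\<^sup>2"
      by (auto simp: stopping_criterion_def \<eta>_def)
    moreover have "0 \<le> \<tau> * (L2_norm \<Omega> (grad \<Omega> u))\<^sup>2" "0 \<le> (norm (\<iota> u))\<^sup>2" for u using \<tau> by auto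
    ultimately show ?thesis unfolding distrib_left by (smt (verit))
  qed
  have "real n * \<eta> * \<beta> \<le> E 0 + \<bar>a0\<bar> * measure lebesgue \<Omega>" for n
  proof -
    have "real n * \<eta> \<le> S n + \<tau> * G n"
    proof -
      have "(\<Sum>i<n. \<eta>) \<le> (\<Sum>i<n. (norm (\<iota> (v1 i)))\<^sup>2 + (norm (\<iota> (v2 i)))\<^sup>2 +
          \<tau> * ((L2_norm \<Omega> (grad \<Omega> (v1 i)))\<^sup>2 + (L2_norm \<Omega> (grad \<Omega> (v2 i)))\<^sup>2))"
        by (intro sum_mono large)
      also have "\<dots> = S n + \<tau> * G n"
        unfolding S_def G_def sum_distrib_left by (rule sum.distrib)
      finally show ?thesis by simp
    qed
    then have "real n * \<eta> * \<beta> \<le> (S n + \<tau> * G n) * \<beta>"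
      using \<beta> by (intro mult_right_mono) auto
    also have "\<dots> = S n * \<beta> + (\<tau> * G n) * \<beta>" by (rule distrib_right)
    also have "\<dots> \<le> S n * (\<tau> / 2) + (\<tau> * G n) * (\<tau> / 2 * \<mu>)"
      using \<beta> \<tau> S_nonneg G_nonneg by (intro add_mono mult_left_mono) auto
    also have "\<dots> = \<tau> / 2 * S n + \<tau>\<^sup>2 / 2 * \<mu> * G n" by (simp add: power2_eq_square algebra_simps)
    finally show ?thesis using dissipation_bound[OF small, of n] by linarith
  qed
  moreover obtain n where "E 0 + \<bar>a0\<bar> * measure lebesgue \<Omega> < real n * (\<eta> * \<beta>)"
    using reals_Archimedean3[of "\<eta> * \<beta>"] \<eta> \<beta> by auto
  ultimately show False by (metis mult.assoc not_le)
qed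

lemma terminates:
  assumes "cH * (cH / 2 + 67 * cH) * \<bar>a0\<bar> * \<tau> < 1" "0 < \<epsilon>"
  shows "\<exists>!i. terminates_at \<Omega> T \<iota> a11 a22 a12 a0 \<tau> \<epsilon> (m1_0, m2_0) i"
proof -
  have eq: "terminates_at \<Omega> T \<iota> a11 a22 a12 a0 \<tau> \<epsilon> (m1_0, m2_0) i \<longleftrightarrow>
      stopping_criterion \<Omega> \<iota> \<tau> \<epsilon> (v i) \<and> (\<forall>j<i. \<not> stopping_criterion \<Omega> \<iota> \<tau> \<epsilon> (v j))" for i
    by (simp add: terminates_at_def v_def m_def Let_def)
  define k where "k = (LEAST i. stopping_criterion \<Omega> \<iota> \<tau> \<epsilon> (v i))"
  have k: "stopping_criterion \<Omega> \<iota> \<tau> \<epsilon> (v k)" "\<forall>j<k. \<not> stopping_criterion \<Omega> \<iota> \<tau> \<epsilon> (v j)"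
    unfolding k_def using stops[OF assms] by (auto intro: LeastI_ex dest: not_less_Least)
  show ?thesis
    unfolding eq
  proof (rule ex1I[of _ k])
    fix i assume "stopping_criterion \<Omega> \<iota> \<tau> \<epsilon> (v i) \<and> (\<forall>j<i. \<not> stopping_criterion \<Omega> \<iota> \<tau> \<epsilon> (v j))"
    with k show "i = k" by (cases i k rule: linorder_cases) auto
  qed (use k in blast)
qed

text \<open>The excess of the lumped norm is at most
  \<open>66 * \<tau>\<^sup>2 * cH\<^sup>2 * S n\<close>, while \<open>\<tau> / 2 * S n\<close> is
  bounded by the dissipation, so one factor \<open>\<tau>\<close> remains and
  \<open>132 = 2 * 66\<close>.\<close>

lemma length_error:
  assumes small: "cH * (cH / 2 + 67 * cH) * \<bar>a0\<bar> * \<tau> < 1" and M: "M \<in> {m1 n, m2 n}"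
  shows "L1_norm \<Omega> (\<lambda>x. nodal_interpolant T (\<lambda>y. (norm (M y))\<^sup>2) x - 1) \<le>
    132 * cH\<^sup>2 * ((a11 + a22 + \<bar>a12\<bar> + \<bar>a0\<bar>) / 2 + 66 * \<bar>a0\<bar>) * \<tau> *
      (1 + ((H1_norm \<Omega> m1_0)\<^sup>2 + (H1_norm \<Omega> m2_0)\<^sup>2))"
proof -
  define A H where "A = (a11 + a22 + \<bar>a12\<bar> + \<bar>a0\<bar>) / 2"
    and "H = (H1_norm \<Omega> m1_0)\<^sup>2 + (H1_norm \<Omega> m2_0)\<^sup>2"
  have H1: "(L2_norm \<Omega> m1_0)\<^sup>2 \<le> H" by (simp add: H_def H1_norm_def)
  \<comment> \<open>Unit nodal values make the lumped norm equal to the volume. Bounding the volume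
    by the initial norm keeps the domain out of the constant.\<close>
  have "measure lebesgue \<Omega> \<le> 66 * (L2_norm \<Omega> m1_0)\<^sup>2"
    using lumped_le_L2_norm[OF m0(1)] lumped_unit[OF unit(1)] by simp
  then have "\<bar>a0\<bar> * measure lebesgue \<Omega> \<le> \<bar>a0\<bar> * (66 * H)"
    using H1 by (intro mult_left_mono) auto
  moreover have "E 0 \<le> A * H"
    using energy_upper_bound[OF m0] by (simp add: m_def A_def H_def)
  moreover have "0 \<le> \<tau>\<^sup>2 / 2 * \<mu> * G n" using \<mu>_pos G_nonneg[of n] by simp
  ultimately have "\<tau> / 2 * S n \<le> (A + 66 * \<bar>a0\<bar>) * H"
    using dissipation_bound[OF small, of n] by (simp add: algebra_simps)
  also have "\<dots> \<le> (A + 66 * \<bar>a0\<bar>) * (1 + H)"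
    using trace by (intro mult_left_mono) (auto simp: A_def)
  finally have "132 * cH\<^sup>2 * \<tau> * (\<tau> / 2 * S n) \<le> 132 * cH\<^sup>2 * \<tau> * ((A + 66 * \<bar>a0\<bar>) * (1 + H))"
    using \<tau> by (intro mult_left_mono) auto
  moreover have "lumped M \<le> measure lebesgue \<Omega> + 66 * \<tau>\<^sup>2 * cH\<^sup>2 * S n"
  proof -
    have "(\<Sum>i<n. (norm (\<iota> (v1 i)))\<^sup>2) \<le> S n" "(\<Sum>i<n. (norm (\<iota> (v2 i)))\<^sup>2) \<le> S n"
      unfolding S_def by (auto intro!: sum_mono)
    then have "66 * \<tau>\<^sup>2 * cH\<^sup>2 * (\<Sum>i<n. (norm (\<iota> (v1 i)))\<^sup>2) \<le> 66 * \<tau>\<^sup>2 * cH\<^sup>2 * S n"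
      "66 * \<tau>\<^sup>2 * cH\<^sup>2 * (\<Sum>i<n. (norm (\<iota> (v2 i)))\<^sup>2) \<le> 66 * \<tau>\<^sup>2 * cH\<^sup>2 * S n"
      by (auto intro!: mult_left_mono)
    then show ?thesis using M lumped_growth[of n] by auto
  qed
  moreover have "L1_norm \<Omega> (\<lambda>x. nodal_interpolant T (\<lambda>y. (norm (M y))\<^sup>2) x - 1) = lumped M - measure lebesgue \<Omega>"
    using M node_norm_ge_1 by (intro L1_norm_interpolant) auto
  moreover have "132 * cH\<^sup>2 * \<tau> * (\<tau> / 2 * S n) = 66 * \<tau>\<^sup>2 * cH\<^sup>2 * S n"
    by (simp add: power2_eq_square)
  ultimately have "L1_norm \<Omega> (\<lambda>x. nodal_interpolant T (\<lambda>y. (norm (M y))\<^sup>2) x - 1) \<le>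
      132 * cH\<^sup>2 * \<tau> * ((A + 66 * \<bar>a0\<bar>) * (1 + H))"
    by linarith
  then show ?thesis by (simp add: A_def H_def mult_ac)
qed

end

theorem proposition4p7:
  fixes \<kappa> :: real
  shows
  "\<exists>k>0. \<forall>cH\<ge>1. \<exists>cT. 0 < cT \<and> cT \<le> k * cH \<and>
   (\<forall>a11 a22 a12 a0 :: real. a11 + a22 > 0 \<and> a11 * a22 > a12\<^sup>2 \<longrightarrow>
    (\<exists>C>0. \<forall>\<Omega> I Th (\<iota> :: (real^3 \<Rightarrow> real^3) \<Rightarrow> 'h::{real_inner,complete_space}) h \<tau> \<epsilon> m1_0 m2_0.
      lipschitz_polyhedral_domain \<Omega> \<and> hilbert_embedding \<Omega> cH \<iota> \<and>
      shape_regular_family \<kappa> \<Omega> I Th \<and> h \<in> I \<and> \<tau> > 0 \<and> \<epsilon> > 0 \<and>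
      m1_0 \<in> S1_vec (Th h) \<and> m2_0 \<in> S1_vec (Th h) \<and>
      (\<forall>z\<in>nodes (Th h). norm (m1_0 z) = 1 \<and> norm (m2_0 z) = 1)
    \<longrightarrow>
     (let m = dgf_iterate \<Omega> (Th h) \<iota> a11 a22 a12 a0 \<tau> (m1_0, m2_0);
          v = (\<lambda>i. dgf_update \<Omega> (Th h) \<iota> a11 a22 a12 a0 \<tau> (m i));
          v1 = (\<lambda>i. fst (v i)); v2 = (\<lambda>i. snd (v i))
      in
        (\<forall>i. \<exists>!w. dgf_solution \<Omega> (Th h) \<iota> a11 a22 a12 a0 \<tau> (m i) w)
      \<and>
        (cH * (cH / 2 + cT) * \<bar>a0\<bar> * \<tau> < 1 \<longrightarrow>
           (\<exists>i. terminates_at \<Omega> (Th h) \<iota> a11 a22 a12 a0 \<tau> \<epsilon> (m1_0, m2_0) i) \<and>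
           (\<exists>!M. approx_stationary_point \<Omega> (Th h) \<iota> a11 a22 a12 a0 \<tau> \<epsilon> (m1_0, m2_0) M))
      \<and>
        (\<forall>i. energy \<Omega> a11 a22 a12 a0 (m (Suc i)) - energy \<Omega> a11 a22 a12 a0 (m i) =
             - \<tau> * ((norm (\<iota> (v1 i)))\<^sup>2 + (norm (\<iota> (v2 i)))\<^sup>2)
             - \<tau>\<^sup>2 / 2 * (a11 * (L2_norm \<Omega> (grad \<Omega> (v1 i)))\<^sup>2 + a22 * (L2_norm \<Omega> (grad \<Omega> (v2 i)))\<^sup>2)
             + a12 * \<tau>\<^sup>2 * L2_inner \<Omega> (grad \<Omega> (v1 i)) (grad \<Omega> (v2 i))
             - a0 * \<tau>\<^sup>2 * L2_inner \<Omega> (v1 i) (v2 i))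
      \<and>
        (cH\<^sup>2 * \<bar>a0\<bar> * \<tau> \<le> 2 \<longrightarrow>
           (\<forall>i. energy \<Omega> a11 a22 a12 a0 (m (Suc i)) \<le> energy \<Omega> a11 a22 a12 a0 (m i)))
      \<and>
        (cH * (cH / 2 + cT) * \<bar>a0\<bar> * \<tau> < 1 \<longrightarrow>
           (\<forall>M1 M2. approx_stationary_point \<Omega> (Th h) \<iota> a11 a22 a12 a0 \<tau> \<epsilon> (m1_0, m2_0) (M1, M2) \<longrightarrow>
              (\<forall>M\<in>{M1, M2}.
                 L1_norm \<Omega> (\<lambda>x. nodal_interpolant (Th h) (\<lambda>y. (norm (M y))\<^sup>2) x - 1)
                 \<le> C * \<tau> * (1 + ((H1_norm \<Omega> m1_0)\<^sup>2 + (H1_norm \<Omega> m2_0)\<^sup>2))))))))"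
proof (rule exI[of _ 67], intro conjI allI impI, goal_cases)
  case (2 cH)
  show ?case
  proof (rule exI[of _ "67 * cH"], intro conjI allI impI, goal_cases)
    case (3 a11 a22 a12 a0)
    \<comment> \<open>The coefficient from \<open>length_error\<close>, fixed before the domain, the
      mesh and the step size are introduced.\<close>
    define C where "C = 132 * cH\<^sup>2 * ((a11 + a22 + \<bar>a12\<bar> + \<bar>a0\<bar>) / 2 + 66 * \<bar>a0\<bar>)"
    have C: "0 < C" unfolding C_def using 2 3 by (intro mult_pos_pos add_pos_nonneg) auto
    show ?case
    proof (rule exI[of _ C], rule conjI[OF C], intro allI impI, goal_cases)
      case (1 \<Omega> I Th \<iota> h \<tau> \<epsilon> m1_0 m2_0)
      interpret dgf_run \<Omega> "Th h" \<iota> cH a11 a22 a12 a0 \<tau> m1_0 m2_0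
        by unfold_locales (use 1 2 3 in \<open>auto simp: shape_regular_family_def\<close>)
      have \<epsilon>: "0 < \<epsilon>" using 1 by blast
      have asp: "approx_stationary_point \<Omega> (Th h) \<iota> a11 a22 a12 a0 \<tau> \<epsilon> (m1_0, m2_0) M \<longleftrightarrow>
          (\<exists>i. terminates_at \<Omega> (Th h) \<iota> a11 a22 a12 a0 \<tau> \<epsilon> (m1_0, m2_0) i \<and> M = m i)" for M
        by (simp add: approx_stationary_point_def m_def)
      show ?case
        unfolding Let_def m_def[symmetric] v_def[symmetric]
      proof (intro conjI allI impI ballI, goal_cases)
        case (1 i)
        show ?case using dgf_solution_unique[of "m1 i" "m2 i"] m_S1[of i] by simp
      next
        case 2
        then show ?case using terminates[OF _ \<epsilon>] by blast
      next
        case 3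
        then show ?case unfolding asp using terminates[OF _ \<epsilon>] by blast
      next
        case (4 i)
        show ?case
          using energy_step[of "m1 i" "m2 i" "v1 i" "v2 i"] m_S1[of i] v_solution[of i] by (simp add: m_Suc)
      next
        case (5 i)
        have "0 \<le> \<tau> * (1 - cH\<^sup>2 * \<bar>a0\<bar> * \<tau> / 2) * ((norm (\<iota> (v1 i)))\<^sup>2 + (norm (\<iota> (v2 i)))\<^sup>2)"
          "0 \<le> \<tau>\<^sup>2 / 2 * \<mu> * ((L2_norm \<Omega> (grad \<Omega> (v1 i)))\<^sup>2 + (L2_norm \<Omega> (grad \<Omega> (v2 i)))\<^sup>2)"
          using 5 \<tau> \<mu>_pos by (auto intro!: mult_nonneg_nonneg)
        then show ?case
          using energy_decrease[of "m1 i" "m2 i" "v1 i" "v2 i"] m_S1[of i] v_solution[of i]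
          by (simp add: m_Suc)
      next
        case (6 M1 M2 M)
        \<comment> \<open>\<open>length_error\<close> holds for every iterate, in particular for the
          one at which the iteration stops.\<close>
        then obtain n where n: "(M1, M2) = m n" unfolding asp by blast
        then have "M \<in> {m1 n, m2 n}" using 6(3) by (metis fst_conv snd_conv)
        then show ?case using length_error[OF 6(1)] by (simp add: C_def)
      qed
    qed
  qed (use 2 in auto)
qed simp

end
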